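(* Let $(X,d,\mu)$ be a quasi-metric-measure space and suppose there exists $\delta_0\in(0,\infty)$ such that $\mu$ is $(C_d,\delta)$-doubling for every $\delta\in(0,\delta_0]$. Then the following statements are equivalent. (1) $(X,d)$ is totally bounded. (2) $\mu$ is integrable. (3) For all exponents $\alpha,p\in(0,\infty)$ and $q\in(0,\infty]$ with $\alpha\preceq_q\mathrm{ind}(X,d)$, the embedding $M^\alpha_{p,q}(X,d,\mu)\hookrightarrow L^p(X,\mu)$ is compact. (4) For all exponents $\alpha,p\in(0,\infty)$ and $q\in(0,\infty]$ with $\alpha\preceq_q\mathrm{ind}(X,d)$, the embedding $N^\alpha_{p,q}(X,d,\mu)\hookrightarrow L^p(X,\mu)$ is compact. (5) There exist exponents $\alpha,p\in(0,\infty)$ and $q\in(0,\infty]$ with $\alpha\preceq_q\mathrm{ind}(X,d)$ such that the embedding $M^\alpha_{p,q}(X,d,\mu)\hookrightarrow L^p(X,\mu)$ is compact. (6) There exist exponents $\alpha,p\in(0,\infty)$ and $q\in(0,\infty]$ with $\alpha\preceq_q\mathrm{ind}(X,d)$ such that the embedding $N^\alpha_{p,q}(X,d,\mu)\hookrightarrow L^p(X,\mu)$ is compact.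
   Context: A quasi-metric space $(X,d)$ is a set $X$ with at least two elements and a function $d:X\times X\to[0,\infty)$ for which there are constants $C_0,C_1\in(0,\infty)$ such that for all $x,y,z\in X$: $d(x,y)=0$ iff $x=y$; $d(y,x)\le C_0 d(x,y)$; $d(x,y)\le C_1\max\{d(x,z),d(z,y)\}$ (symmetry is not required). $C_d:=\sup\frac{d(x,y)}{\max\{d(x,z),d(z,y)\}}\in[1,\infty)$, the supremum over all $x,y,z\in X$ not all equal. Balls are $B_d(x,r):=\{y\in X:d(x,y)<r\}$. The topology $\tau_d$ consists of all $\mathcal O\subseteq X$ such that for each $x\in\mathcal O$ there is $r>0$ with $B_d(x,r)\subseteq\mathcal O$. A quasi-metric-measure space $(X,d,\mu)$ is a quasi-metric space with a nonnegative measure $\mu$ on a $\sigma$-algebra containing the Borel sets of $\tau_d$, such that all $d$-balls are measurable and $\mu(B_d(x,r))\in(0,\infty)$ for all $x\in X$, $r\in(0,\infty)$. $(X,d)$ is totally bounded if for every $\varepsilon>0$ it is covered by finitely many balls $B_d(x_i,\varepsilon)$. $\mu$ is $(c,\delta)$-doubling ($c\ge1$, $\delta>0$) if there is $C(\delta)\in[1,\infty)$ with $\mu(B_d(x,c\delta))\le C(\delta)\mu(B_d(x,\delta))$ for all $x\in X$. Quasi-metrics $d,\rho$ are equivalent ($\rho\approx d$) if $\kappa^{-1}\rho\le d\le\kappa\rho$ on $X\times X$ for some constant $\kappa>0$. $\mathrm{ind}(X,d):=\sup_{\rho\approx d}(\log_2C_\rho)^{-1}\in(0,\infty]$ (with $1/0:=\infty$).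 The notation $\alpha\preceq_q\mathrm{ind}(X,d)$ means $\alpha\le\mathrm{ind}(X,d)$, where $\alpha=\mathrm{ind}(X,d)$ is permitted only when $q=\infty$ and the supremum defining $\mathrm{ind}(X,d)$ is attained. $\mu$ is integrable if there is a quasi-metric $\rho\approx d$ such that for each fixed $r\in(0,\infty)$ the mapping $x\mapsto\mu(B_\rho(x,r))$ is well defined (i.e. $\rho$-balls are measurable), measurable, and $\int_X\frac{1}{\mu(B_\rho(x,r))}\,d\mu(x)<\infty$. Fractional gradients: for $\alpha\in(0,\infty)$ and measurable $u:X\to\mathbb R$, $\mathbb D^\alpha_d(u)$ is the set of sequences $\vec g=\{g_k\}_{k\in\mathbb Z}$ of nonnegative measurable functions on $X$ for which there is a measurable $E$ with $\mu(E)=0$ and $|u(x)-u(y)|\le[d(x,y)]^\alpha(g_k(x)+g_k(y))$ for all $k\in\mathbb Z$ and $x,y\in X\setminus E$ with $2^{-k-1}\le d(x,y)<2^{-k}$. The Hajłasz–Triebel–Lizorkin space $M^\alpha_{p,q}(X,d,\mu)$ is the set of $u\in L^p(X,\mu)$ with finite (quasi-)norm $\|u\|_{L^p(X,\mu)}+\inf_{\vec g\in\mathbb D^\alpha_d(u)}\big\|\,\|\{g_k\}_k\|_{\ell^q(\mathbb Z)}\big\|_{L^p(X,\mu)}$; the Hajłasz–Besov space $N^\alpha_{p,q}(X,d,\mu)$ is the set of $u\in L^p(X,\mu)$ with finite (quasi-)norm $\|u\|_{L^p(X,\mu)}+\inf_{\vec g\in\mathbb D^\alpha_d(u)}\big\|\{\|g_k\|_{L^p(X,\mu)}\}_k\big\|_{\ell^q(\mathbb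 Z)}$. An embedding is compact if the inclusion map is well defined and maps bounded sets to totally bounded sets. *)

theory Defs
  imports "HOL-Analysis.Analysis"
begin

text \<open>
  The underlying set of a space is a subset \<open>X\<close> of a type, and \<open>X = space M\<close> once a measure
  \<open>M\<close> is given. The values of a quasi-metric or of a function outside \<open>X\<close> play no role.
\<close>

definition quasi_metric :: "'a set \<Rightarrow> ('a \<Rightarrow> 'a \<Rightarrow> real) \<Rightarrow> bool" where
  "quasi_metric X d \<longleftrightarrow>
     (\<exists>x\<in>X. \<exists>y\<in>X. x \<noteq> y) \<and>
     (\<forall>x\<in>X. \<forall>y\<in>X. 0 \<le> d x y) \<and>
     (\<forall>x\<in>X. \<forall>y\<in>X. d x y = 0 \<longleftrightarrow> x = y) \<and>
     (\<exists>C0>0. \<forall>x\<in>X. \<forall>y\<in>X. d y x \<le> C0 * d x y) \<and>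
     (\<exists>C1>0. \<forall>x\<in>X. \<forall>y\<in>X. \<forall>z\<in>X. d x y \<le> C1 * max (d x z) (d z y))"

text \<open>The optimal constant \<open>C\<^sub>d\<close> in the quasi-triangle inequality.\<close>

definition qm_const :: "'a set \<Rightarrow> ('a \<Rightarrow> 'a \<Rightarrow> real) \<Rightarrow> real" where
  "qm_const X d =
     Sup {d x y / max (d x z) (d z y) | x y z.
            x \<in> X \<and> y \<in> X \<and> z \<in> X \<and> \<not> (x = y \<and> y = z)}"

definition qball :: "'a set \<Rightarrow> ('a \<Rightarrow> 'a \<Rightarrow> real) \<Rightarrow> 'a \<Rightarrow> real \<Rightarrow> 'a set" where
  "qball X d x r = {y \<in> X. d x y < r}"

definition qm_open_sets :: "'a set \<Rightarrow> ('a \<Rightarrow> 'a \<Rightarrow> real) \<Rightarrow> 'a set set" where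
  "qm_open_sets X d = {U. U \<subseteq> X \<and> (\<forall>x\<in>U. \<exists>r>0. qball X d x r \<subseteq> U)}"

definition quasi_metric_measure_space :: "'a measure \<Rightarrow> ('a \<Rightarrow> 'a \<Rightarrow> real) \<Rightarrow> bool" where
  "quasi_metric_measure_space M d \<longleftrightarrow>
     quasi_metric (space M) d \<and>
     sigma_sets (space M) (qm_open_sets (space M) d) \<subseteq> sets M \<and>
     (\<forall>x\<in>space M. \<forall>r>0. qball (space M) d x r \<in> sets M \<and>
        0 < emeasure M (qball (space M) d x r) \<and> emeasure M (qball (space M) d x r) < \<infinity>)"

text \<open>
  The definition makes sense for any distance-like function; below it is also applied to
  subsets of \<open>L\<^sup>p\<close>, where the distance of two functions that agree almost everywhere is \<open>0\<close>.
\<close>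

definition qm_totally_bounded :: "'a set \<Rightarrow> ('a \<Rightarrow> 'a \<Rightarrow> real) \<Rightarrow> bool" where
  "qm_totally_bounded X d \<longleftrightarrow>
     (\<forall>\<epsilon>>0. \<exists>F. finite F \<and> F \<subseteq> X \<and> X \<subseteq> (\<Union>x\<in>F. qball X d x \<epsilon>))"

definition doubling :: "'a measure \<Rightarrow> ('a \<Rightarrow> 'a \<Rightarrow> real) \<Rightarrow> real \<Rightarrow> real \<Rightarrow> bool" where
  "doubling M d c \<delta> \<longleftrightarrow>
     (\<exists>C::real. 1 \<le> C \<and>
        (\<forall>x\<in>space M. emeasure M (qball (space M) d x (c * \<delta>))
                        \<le> ennreal C * emeasure M (qball (space M) d x \<delta>)))"

definition qm_equivalent :: "'a set \<Rightarrow> ('a \<Rightarrow> 'a \<Rightarrow> real) \<Rightarrow> ('a \<Rightarrow> 'a \<Rightarrow> real) \<Rightarrow> bool" where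
  "qm_equivalent X \<rho> d \<longleftrightarrow>
     quasi_metric X \<rho> \<and> quasi_metric X d \<and>
     (\<exists>\<kappa>>0. \<forall>x\<in>X. \<forall>y\<in>X. inverse \<kappa> * \<rho> x y \<le> d x y \<and> d x y \<le> \<kappa> * \<rho> x y)"

text \<open>In \<^typ>\<open>ereal\<close> one has \<open>inverse 0 = \<infinity>\<close>, the convention needed when \<open>C\<^sub>\<rho> = 1\<close>.\<close>

definition qm_exponent :: "'a set \<Rightarrow> ('a \<Rightarrow> 'a \<Rightarrow> real) \<Rightarrow> ereal" where
  "qm_exponent X \<rho> = inverse (ereal (log 2 (qm_const X \<rho>)))"

definition ind :: "'a set \<Rightarrow> ('a \<Rightarrow> 'a \<Rightarrow> real) \<Rightarrow> ereal" where
  "ind X d = (SUP \<rho>\<in>{\<rho>. qm_equivalent X \<rho> d}. qm_exponent X \<rho>)"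

text \<open>The relation \<open>\<alpha> \<preceq>\<^sub>q ind(X,d)\<close>.\<close>

definition le_ind :: "real \<Rightarrow> ennreal \<Rightarrow> 'a set \<Rightarrow> ('a \<Rightarrow> 'a \<Rightarrow> real) \<Rightarrow> bool" where
  "le_ind \<alpha> q X d \<longleftrightarrow>
     ereal \<alpha> \<le> ind X d \<and>
     (ereal \<alpha> = ind X d \<longrightarrow>
        q = \<infinity> \<and> (\<exists>\<rho>. qm_equivalent X \<rho> d \<and> qm_exponent X \<rho> = ind X d))"

definition integrable_measure :: "'a measure \<Rightarrow> ('a \<Rightarrow> 'a \<Rightarrow> real) \<Rightarrow> bool" where
  "integrable_measure M d \<longleftrightarrow>
     (\<exists>\<rho>. qm_equivalent (space M) \<rho> d \<and>
        (\<forall>r>0. (\<forall>x\<in>space M. qball (space M) \<rho> x r \<in> sets M) \<and>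
               (\<lambda>x. emeasure M (qball (space M) \<rho> x r)) \<in> borel_measurable M \<and>
               (\<integral>\<^sup>+x. 1 / emeasure M (qball (space M) \<rho> x r) \<partial>M) < \<infinity>))"

text \<open>Real powers on \<open>[0,\<infinity>]\<close>, only used with exponent \<open>a > 0\<close>.\<close>

definition epowr :: "ennreal \<Rightarrow> real \<Rightarrow> ennreal" where
  "epowr x a = (if x = \<infinity> then \<infinity> else ennreal (enn2real x powr a))"

definition Lp_enorm :: "'a measure \<Rightarrow> real \<Rightarrow> ('a \<Rightarrow> ennreal) \<Rightarrow> ennreal" where
  "Lp_enorm M p f = epowr (\<integral>\<^sup>+x. epowr (f x) p \<partial>M) (1 / p)"

definition Lp_norm :: "'a measure \<Rightarrow> real \<Rightarrow> ('a \<Rightarrow> real) \<Rightarrow> ennreal" where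
  "Lp_norm M p u = Lp_enorm M p (\<lambda>x. ennreal \<bar>u x\<bar>)"

text \<open>
  Elements of \<open>L\<^sup>p\<close> and of its subspaces are represented by functions rather than by classes
  modulo almost everywhere equality; all the (quasi-)norms below are invariant under it.
\<close>

definition Lp_space :: "'a measure \<Rightarrow> real \<Rightarrow> ('a \<Rightarrow> real) set" where
  "Lp_space M p = {u \<in> borel_measurable M. Lp_norm M p u < \<infinity>}"

definition lq_enorm :: "ennreal \<Rightarrow> (int \<Rightarrow> ennreal) \<Rightarrow> ennreal" where
  "lq_enorm q a =
     (if q = \<infinity> then (SUP k. a k)
      else epowr (\<integral>\<^sup>+k. epowr (a k) (enn2real q) \<partial>count_space UNIV) (1 / enn2real q))"

definition frac_gradients ::
    "'a measure \<Rightarrow> ('a \<Rightarrow> 'a \<Rightarrow> real) \<Rightarrow> real \<Rightarrow> ('a \<Rightarrow> real) \<Rightarrow> (int \<Rightarrow> 'a \<Rightarrow> real) set" where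
  "frac_gradients M d \<alpha> u =
     {g. (\<forall>k. g k \<in> borel_measurable M \<and> (\<forall>x\<in>space M. 0 \<le> g k x)) \<and>
         (\<exists>E\<in>null_sets M. \<forall>k. \<forall>x\<in>space M - E. \<forall>y\<in>space M - E.
            2 powi (- k - 1) \<le> d x y \<and> d x y < 2 powi (- k) \<longrightarrow>
            \<bar>u x - u y\<bar> \<le> d x y powr \<alpha> * (g k x + g k y))}"

definition HTL_norm ::
    "'a measure \<Rightarrow> ('a \<Rightarrow> 'a \<Rightarrow> real) \<Rightarrow> real \<Rightarrow> real \<Rightarrow> ennreal \<Rightarrow> ('a \<Rightarrow> real) \<Rightarrow> ennreal" where
  "HTL_norm M d \<alpha> p q u =
     Lp_norm M p u +
     (INF g\<in>frac_gradients M d \<alpha> u. Lp_enorm M p (\<lambda>x. lq_enorm q (\<lambda>k. ennreal (g k x))))"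

definition HB_norm ::
    "'a measure \<Rightarrow> ('a \<Rightarrow> 'a \<Rightarrow> real) \<Rightarrow> real \<Rightarrow> real \<Rightarrow> ennreal \<Rightarrow> ('a \<Rightarrow> real) \<Rightarrow> ennreal" where
  "HB_norm M d \<alpha> p q u =
     Lp_norm M p u +
     (INF g\<in>frac_gradients M d \<alpha> u. lq_enorm q (\<lambda>k. Lp_norm M p (g k)))"

text \<open>The Hajlasz--Triebel--Lizorkin space \<open>M\<close> and the Hajlasz--Besov space \<open>N\<close>.\<close>

definition HTL_space ::
    "'a measure \<Rightarrow> ('a \<Rightarrow> 'a \<Rightarrow> real) \<Rightarrow> real \<Rightarrow> real \<Rightarrow> ennreal \<Rightarrow> ('a \<Rightarrow> real) set" where
  "HTL_space M d \<alpha> p q = {u \<in> Lp_space M p. HTL_norm M d \<alpha> p q u < \<infinity>}"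

definition HB_space ::
    "'a measure \<Rightarrow> ('a \<Rightarrow> 'a \<Rightarrow> real) \<Rightarrow> real \<Rightarrow> real \<Rightarrow> ennreal \<Rightarrow> ('a \<Rightarrow> real) set" where
  "HB_space M d \<alpha> p q = {u \<in> Lp_space M p. HB_norm M d \<alpha> p q u < \<infinity>}"

definition compactly_embedded_Lp ::
    "'a measure \<Rightarrow> real \<Rightarrow> ('a \<Rightarrow> real) set \<Rightarrow> (('a \<Rightarrow> real) \<Rightarrow> ennreal) \<Rightarrow> bool" where
  "compactly_embedded_Lp M p V N \<longleftrightarrow>
     V \<subseteq> Lp_space M p \<and>
     (\<forall>S\<subseteq>V. (\<exists>R::real. \<forall>u\<in>S. N u \<le> ennreal R) \<longrightarrow>
        qm_totally_bounded S (\<lambda>u v. enn2real (Lp_norm M p (\<lambda>x. u x - v x))))"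

definition HTL_compact ::
    "'a measure \<Rightarrow> ('a \<Rightarrow> 'a \<Rightarrow> real) \<Rightarrow> real \<Rightarrow> real \<Rightarrow> ennreal \<Rightarrow> bool" where
  "HTL_compact M d \<alpha> p q \<longleftrightarrow>
     compactly_embedded_Lp M p (HTL_space M d \<alpha> p q) (HTL_norm M d \<alpha> p q)"

definition HB_compact ::
    "'a measure \<Rightarrow> ('a \<Rightarrow> 'a \<Rightarrow> real) \<Rightarrow> real \<Rightarrow> real \<Rightarrow> ennreal \<Rightarrow> bool" where
  "HB_compact M d \<alpha> p q \<longleftrightarrow>
     compactly_embedded_Lp M p (HB_space M d \<alpha> p q) (HB_norm M d \<alpha> p q)"

end

theory Submission
  imports Defs
begin


text \<open>
  Total boundedness, integrability of the measure and compactness of the embeddings are linked by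
  the packing of disjoint balls.

  Suppose \<open>X\<close> is totally bounded. Then \<open>\<mu>(X)\<close> is finite and the balls of a fixed radius have measure
  bounded below, because each of them contains one of finitely many smaller balls. The only delicate
  point about integrability is that the ball measure must depend measurably on the centre; this is
  arranged by passing to an equivalent quasi-metric that is a power of a genuine metric, for
  which it is lower semicontinuous (\<open>totally_bounded_imp_integrable\<close>).
  For compactness, cut \<open>X\<close> into finitely many cells of small diameter. Every pair of points of a cell
  lies in an annulus of small radius, so the oscillation of \<open>u\<close> there is controlled by a
  function \<open>H\<close> built from the gradients \<open>g\<^sub>k\<close> with large \<open>k\<close>. The factor \<open>2\<^sup>-\<^sup>k\<^sup>\<alpha>\<close> makes \<open>H\<close> small
  in \<open>L\<^sup>1\<close>, uniformly on bounded sets, as soon as the norms \<open>\<parallel>g\<^sub>k\<parallel>\<^sub>p\<close> are bounded in \<open>k\<close>, and both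
  the Triebel--Lizorkin and the Besov norm bound these. Sampling \<open>u\<close> at a point of each cell where
  \<open>H\<close> is at most its average approximates \<open>u\<close> in \<open>L\<^sup>p\<close> by an element of a bounded
  subset of a finite-dimensional space of step functions (\<open>totally_bounded_imp_compact\<close>). Working with \<open>p\<close>-th powers and samples instead of
  averages treats all \<open>p > 0\<close> alike.

  Suppose \<open>X\<close> is not totally bounded. Then it contains infinitely many disjoint balls of one radius.
  The choice of constants is such that one application of the \<open>C\<^sub>d\<close>-doubling condition makes each of
  them contribute a fixed amount to the integral of the reciprocal ball measure, which is therefore
  infinite (\<open>integrable_imp_totally_bounded\<close>).
  The normalised bump functions living on such balls are separated in \<open>L\<^sup>p\<close>, and they are
  bounded in the smoothness space provided that they are Hoelder continuous of an order \<open>\<beta>\<close> which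
  exceeds \<open>\<alpha>\<close>, or equals it when \<open>q = \<infinity>\<close>. The definition of the index supplies a quasi-metric
  whose \<open>\<beta>\<close>-th power satisfies the quasi-triangle inequality with constant \<open>2\<close>, and
  Frink's chain construction turns such a function into a genuine metric \<open>D\<close>; the bumps are then
  Lipschitz functions of \<open>D\<close> (\<open>compact_imp_totally_bounded\<close>).
\<close>

section \<open>Quasi-metrics and the metrics equivalent to their powers\<close>

lemma quasi_metricD:
  assumes "quasi_metric X d" "x \<in> X" "y \<in> X"
  shows "0 \<le> d x y" "d x y = 0 \<longleftrightarrow> x = y"
  using assms unfolding quasi_metric_def by blast+

lemma quasi_symmetric:
  assumes "quasi_metric X d"
  obtains C where "1 \<le> C" "\<And>x y. x \<in> X \<Longrightarrow> y \<in> X \<Longrightarrow> d y x \<le> C * d x y"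
proof -
  obtain C where C: "C > 0" "\<forall>x\<in>X. \<forall>y\<in>X. d y x \<le> C * d x y"
    using assms unfolding quasi_metric_def by blast
  have "d y x \<le> max 1 C * d x y" if "x \<in> X" "y \<in> X" for x y
  proof -
    have "d y x \<le> C * d x y" using C that by blast
    also have "\<dots> \<le> max 1 C * d x y"
      using quasi_metricD(1)[OF assms that] by (intro mult_right_mono) auto
    finally show ?thesis .
  qed
  then show thesis using that[of "max 1 C"] by simp
qed

lemma
  assumes "quasi_metric X d"
  shows qm_const_bound:
      "\<And>x y z. x \<in> X \<Longrightarrow> y \<in> X \<Longrightarrow> z \<in> X \<Longrightarrow> d x y \<le> qm_const X d * max (d x z) (d z y)"
    and qm_const_ge_1: "1 \<le> qm_const X d"
proof -
  let ?S = "{d x y / max (d x z) (d z y) | x y z.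
            x \<in> X \<and> y \<in> X \<and> z \<in> X \<and> \<not> (x = y \<and> y = z)}"
  obtain C where C: "C > 0" "\<forall>x\<in>X. \<forall>y\<in>X. \<forall>z\<in>X. d x y \<le> C * max (d x z) (d z y)"
    using assms unfolding quasi_metric_def by blast
  have pos: "max (d x z) (d z y) > 0" if "x \<in> X" "y \<in> X" "z \<in> X" "\<not> (x = y \<and> y = z)" for x y z
    using that quasi_metricD[OF assms, of x z] quasi_metricD[OF assms, of z y] by (auto simp: less_max_iff_disj)
  have bdd: "bdd_above ?S"
    by (rule bdd_aboveI[of _ C]) (use C pos in \<open>auto simp: pos_divide_le_eq\<close>)
  show "d x y \<le> qm_const X d * max (d x z) (d z y)" if xyz: "x \<in> X" "y \<in> X" "z \<in> X" for x y z
  proof (cases "x = y \<and> y = z")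
    case True
    then show ?thesis using quasi_metricD[OF assms, of x x] xyz by auto
  next
    case False
    have "d x y / max (d x z) (d z y) \<le> qm_const X d"
      unfolding qm_const_def by (rule cSup_upper[OF _ bdd]) (use False xyz in blast)
    then show ?thesis using pos[OF xyz False] by (simp add: pos_divide_le_eq)
  qed
  obtain x y where xy: "x \<in> X" "y \<in> X" "x \<noteq> y" using assms unfolding quasi_metric_def by blast
  have "d x y / max (d x y) (d y y) = 1"
    using quasi_metricD[OF assms, of x y] quasi_metricD[OF assms, of y y] xy by auto
  then have "1 \<in> ?S" using xy by fastforce
  then show "1 \<le> qm_const X d" unfolding qm_const_def by (rule cSup_upper[OF _ bdd])
qed

lemma qm_equivalent_refl: "quasi_metric X d \<Longrightarrow> qm_equivalent X d d"
  unfolding qm_equivalent_def by (auto intro!: exI[of _ 1])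

text \<open>
  For a quasi-metric \<open>d\<close>, \<open>D\<close> is a metric on \<open>X\<close> comparable to the snowflaked distance \<open>d\<^sup>\<beta>\<close>; that it
  separates points follows from comparability. The constant is exposed because the radii of the
  bump functions depend on it.
\<close>

definition power_metric ::
    "'a set \<Rightarrow> ('a \<Rightarrow> 'a \<Rightarrow> real) \<Rightarrow> real \<Rightarrow> ('a \<Rightarrow> 'a \<Rightarrow> real) \<Rightarrow> real \<Rightarrow> bool" where
  "power_metric X d \<beta> D c \<longleftrightarrow> 0 < c \<and>
     (\<forall>x\<in>X. \<forall>y\<in>X. 0 \<le> D x y \<and> D x y = D y x \<and>
        D x y \<le> c * d x y powr \<beta> \<and> d x y powr \<beta> \<le> c * D x y \<and>
        (\<forall>z\<in>X. D x z \<le> D x y + D y z))"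

text \<open>
  Frink's lemma: with constant \<open>2\<close>, the distance between the end points of a chain is dominated by the
  length of the chain. Cut at the last vertex that is at distance at least half of the whole from
  the end; its successor is then at least that far from the start, so both pieces account for one half,
  and they overlap in one edge. Counting the extreme edges of a chain with weight \<open>2\<close> and the inner ones
  with weight \<open>4\<close> is exactly what makes the overlap harmless in the induction. A chain of one edge
  does not satisfy the weighted bound, hence \<open>m + 2 \<le> n\<close>.
\<close>

lemma chain_inequality:
  fixes f :: "'a \<Rightarrow> 'a \<Rightarrow> real"
  assumes nonneg: "\<And>x y. x \<in> X \<Longrightarrow> y \<in> X \<Longrightarrow> 0 \<le> f x y"
    and quasi: "\<And>x y z. x \<in> X \<Longrightarrow> y \<in> X \<Longrightarrow> z \<in> X \<Longrightarrow> f x y \<le> 2 * max (f x z) (f z y)"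
    and s: "\<And>i. i \<le> N \<Longrightarrow> s i \<in> X"
    and "m + 2 \<le> n" "n \<le> N"
  shows "f (s m) (s n) \<le> 4 * (\<Sum>i=m..<n. f (s i) (s (Suc i)))
           - 2 * f (s m) (s (Suc m)) - 2 * f (s (n - 1)) (s n)"
  using assms(4,5)
proof (induction "n - m" arbitrary: m n rule: less_induct)
  case less
  let ?L = "f (s m) (s n)"
  let ?E = "\<lambda>i. f (s i) (s (Suc i))"
  have E0: "?E i \<ge> 0" if "i < n" for i using nonneg s that less.prems by simp
  have L0: "?L \<ge> 0" using nonneg s less.prems by simp
  have half: "?L / 2 \<le> f (s m) (s i) \<or> ?L / 2 \<le> f (s i) (s n)" if "i \<le> n" for i
    using quasi[OF s s s, of m n i] that less.prems by auto
  \<comment> \<open>the last vertex that is still far from the end of the chain\<close>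
  let ?P = "\<lambda>i. m \<le> i \<and> i < n \<and> ?L / 2 \<le> f (s i) (s n)"
  have "?P m" using L0 less.prems by auto
  define k where "k = (GREATEST i. ?P i)"
  have Pk: "?P k" unfolding k_def
    by (rule GreatestI_nat[where P="?P", OF \<open>?P m\<close>, of n]) auto
  have kmax: "i \<le> k" if "?P i" for i unfolding k_def
    by (rule Greatest_le_nat[where P="?P", OF that, of n]) auto
  have next_far: "?L / 2 \<le> f (s m) (s (Suc k))"
  proof (cases "Suc k = n")
    case True then show ?thesis using L0 by simp
  next
    case False
    then have "\<not> ?P (Suc k)" using kmax[of "Suc k"] by auto
    then have "\<not> ?L / 2 \<le> f (s (Suc k)) (s n)" using False Pk by auto
    then show ?thesis using half[of "Suc k"] Pk False by auto
  qed
  have split: "(\<Sum>i=m..<n. ?E i) = (\<Sum>i=m..<k. ?E i) + ?E k + (\<Sum>i=Suc k..<n. ?E i)"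
    using Pk sum.atLeastLessThan_concat[of m k n ?E] by (simp add: sum.atLeast_Suc_lessThan)
  have nn: "(\<Sum>i=a..<b. ?E i) \<ge> 0" if "b \<le> n" for a b
    by (rule sum_nonneg) (use E0 that in auto)
  have last: "f (s (n - 1)) (s n) = ?E (n - 1)" using less.prems by simp
  have two: "(\<Sum>i=m..<n. ?E i) \<ge> ?E m + ?E (n - 1)"
  proof -
    have "(\<Sum>i=m..<n. ?E i) = ?E m + (\<Sum>i=Suc m..<n - 1. ?E i) + ?E (n - 1)"
      using less.prems sum.atLeastLessThan_concat[of "Suc m" "n - 1" n ?E]
      by (simp add: sum.atLeast_Suc_lessThan Suc_diff_Suc)
    then show ?thesis using nn[of "n - 1" "Suc m"] by simp
  qed
  \<comment> \<open>if a piece is a single edge, that edge alone is at least half as long as \<open>?L\<close>\<close>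
  consider "k = m" | "k = n - 1" "k \<noteq> m" | "m < k" "Suc k < n" using Pk by linarith
  then show ?case
  proof cases
    case 1
    then have "?L \<le> 2 * ?E m" using next_far by simp
    then show ?thesis using two E0[of "n - 1"] less.prems unfolding last by simp
  next
    case 2
    then have "?L \<le> 2 * ?E (n - 1)" using Pk by (simp add: last[symmetric])
    then show ?thesis using two E0[of m] less.prems unfolding last by simp
  next
    case 3
    have "f (s m) (s (Suc k)) \<le> 4 * (\<Sum>i=m..<Suc k. ?E i) - 2 * ?E m - 2 * ?E k"
      using less.hyps[of "Suc k" m] 3 less.prems by simp
    moreover have "f (s k) (s n) \<le> 4 * (\<Sum>i=k..<n. ?E i) - 2 * ?E k - 2 * ?E (n - 1)"
      using less.hyps[of n k] 3 less.prems last by simp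
    moreover have "(\<Sum>i=m..<Suc k. ?E i) = (\<Sum>i=m..<k. ?E i) + ?E k" using 3 by simp
    moreover have "(\<Sum>i=k..<n. ?E i) = ?E k + (\<Sum>i=Suc k..<n. ?E i)"
      using 3 by (simp add: sum.atLeast_Suc_lessThan)
    ultimately show ?thesis using Pk next_far split unfolding last by simp
  qed
qed

text \<open>
  The infimum of the lengths of chains is symmetric and satisfies the triangle inequality because
  chains can be reversed and concatenated; it stays comparable to \<open>f\<close> by the chain inequality.
\<close>

lemma chain_metric_exists:
  fixes f :: "'a \<Rightarrow> 'a \<Rightarrow> real"
  assumes nonneg: "\<And>x y. x \<in> X \<Longrightarrow> y \<in> X \<Longrightarrow> 0 \<le> f x y"
    and refl: "\<And>x. x \<in> X \<Longrightarrow> f x x = 0"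
    and sym: "\<And>x y. x \<in> X \<Longrightarrow> y \<in> X \<Longrightarrow> f x y = f y x"
    and quasi: "\<And>x y z. x \<in> X \<Longrightarrow> y \<in> X \<Longrightarrow> z \<in> X \<Longrightarrow> f x y \<le> 2 * max (f x z) (f z y)"
  obtains D where "\<And>x y. x \<in> X \<Longrightarrow> y \<in> X \<Longrightarrow> 0 \<le> D x y \<and> D x y = D y x \<and> D x y \<le> f x y \<and> f x y \<le> 4 * D x y"
    "\<And>x y z. x \<in> X \<Longrightarrow> y \<in> X \<Longrightarrow> z \<in> X \<Longrightarrow> D x z \<le> D x y + D y z"
proof -
  define S where "S x y = {t. \<exists>n s. t = (\<Sum>i<n. f (s i) (s (Suc i))) \<and>
      s 0 = x \<and> s n = y \<and> (\<forall>i\<le>n. s i \<in> X)}" for x y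
  note S_E = CollectD[of _ "\<lambda>t. \<exists>n s. t = (\<Sum>i<n. f (s i) (s (Suc i))) \<and>
      s 0 = x \<and> s n = y \<and> (\<forall>i\<le>n. s i \<in> X)" for x y, folded S_def]
  define D where "D x y = Inf (S x y)" for x y
  have S_low: "f x y \<le> 4 * t" if h: "t \<in> S x y" for x y t
  proof -
    obtain n s where s: "t = (\<Sum>i<n. f (s i) (s (Suc i)))" "s 0 = x" "s n = y" "\<forall>i\<le>n. s i \<in> X"
      using S_E[OF h] by (elim exE conjE) (rule that)
    consider "n = 0" | "n = 1" | "2 \<le> n" by linarith
    then show ?thesis
    proof cases
      case 1 then show ?thesis using s refl[of x] by auto
    next
      case 2 then show ?thesis using s nonneg[of x y] by auto
    next
      case 3
      have "f (s 0) (s n) \<le> 4 * (\<Sum>i=0..<n. f (s i) (s (Suc i)))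
           - 2 * f (s 0) (s (Suc 0)) - 2 * f (s (n - 1)) (s n)"
        by (rule chain_inequality[where X=X and N=n]) (use nonneg quasi s 3 in auto)
      moreover have "0 \<le> f (s 0) (s (Suc 0))" "0 \<le> f (s (n - 1)) (s n)"
        using nonneg s 3 by auto
      ultimately show ?thesis using s by (simp add: atLeast0LessThan)
    qed
  qed
  have S_edge: "f x y \<in> S x y" if "x \<in> X" "y \<in> X" for x y
    unfolding S_def
    by (rule CollectI, rule exI[of _ 1], rule exI[of _ "\<lambda>i. if i = 0 then x else y"]) (use that in auto)
  have S_rev: "t \<in> S y x" if h: "t \<in> S x y" for x y t
  proof -
    obtain n s where s: "t = (\<Sum>i<n. f (s i) (s (Suc i)))" "s 0 = x" "s n = y" "\<forall>i\<le>n. s i \<in> X"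
      using S_E[OF h] by (elim exE conjE) (rule that)
    have "t = (\<Sum>i<n. f (s (n - Suc i)) (s (Suc (n - Suc i))))"
      unfolding s(1) using sum.nat_diff_reindex[of "\<lambda>i. f (s i) (s (Suc i))" n] by simp
    also have "\<dots> = (\<Sum>i<n. f (s (n - i)) (s (n - Suc i)))"
      by (rule sum.cong) (use s sym in \<open>auto simp: Suc_diff_Suc\<close>)
    finally show ?thesis unfolding S_def
      by (intro CollectI exI[of _ n] exI[of _ "\<lambda>i. s (n - i)"]) (use s in auto)
  qed
  have S_trans: "t + t' \<in> S x z" if h: "t \<in> S x y" "t' \<in> S y z" for x y z t t'
  proof -
    obtain n s where s: "t = (\<Sum>i<n. f (s i) (s (Suc i)))" "s 0 = x" "s n = y" "\<forall>i\<le>n. s i \<in> X"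
      using S_E[OF h(1)] by (elim exE conjE) (rule that)
    obtain m r where r: "t' = (\<Sum>i<m. f (r i) (r (Suc i)))" "r 0 = y" "r m = z" "\<forall>i\<le>m. r i \<in> X"
      using S_E[OF h(2)] by (elim exE conjE) (rule that)
    define w where "w i = (if i \<le> n then s i else r (i - n))" for i
    have "(\<Sum>i<n + m. f (w i) (w (Suc i)))
        = (\<Sum>i<n. f (w i) (w (Suc i))) + (\<Sum>i<m. f (w (n + i)) (w (Suc (n + i))))"
      by (induction m) (auto simp: add.assoc)
    also have "(\<Sum>i<n. f (w i) (w (Suc i))) = t" unfolding s(1) by (rule sum.cong) (auto simp: w_def)
    also have "(\<Sum>i<m. f (w (n + i)) (w (Suc (n + i)))) = t'"
      unfolding r(1) by (rule sum.cong) (use s r in \<open>auto simp: w_def\<close>)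
    finally show ?thesis unfolding S_def
      by (intro CollectI exI[of _ "n + m"] exI[of _ w]) (use s r in \<open>auto simp: w_def\<close>)
  qed
  have S_nonneg: "0 \<le> t" if "t \<in> S x y" "x \<in> X" "y \<in> X" for x y t
    using S_low[OF that(1)] nonneg[OF that(2,3)] by linarith
  have bdd: "bdd_below (S x y)" if "x \<in> X" "y \<in> X" for x y
    using S_nonneg that by (auto intro!: bdd_belowI[of _ 0])
  show thesis
  proof
    fix x y assume xy: "x \<in> X" "y \<in> X"
    have "S x y = S y x" using S_rev by blast
    moreover have "0 \<le> D x y" unfolding D_def
      by (rule cInf_greatest) (use S_edge[OF xy] S_nonneg xy in auto)
    moreover have "D x y \<le> f x y" unfolding D_def by (rule cInf_lower[OF S_edge[OF xy] bdd[OF xy]])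
    moreover have "f x y / 4 \<le> D x y" unfolding D_def
      by (rule cInf_greatest) (use S_edge[OF xy] S_low in force)+
    ultimately show "0 \<le> D x y \<and> D x y = D y x \<and> D x y \<le> f x y \<and> f x y \<le> 4 * D x y"
      by (auto simp: D_def)
  next
    fix x y z assume xyz: "x \<in> X" "y \<in> X" "z \<in> X"
    have ne: "S x y \<noteq> {}" "S y z \<noteq> {}" using S_edge xyz by blast+
    have "D x z - t \<le> D y z" if "t \<in> S x y" for t
      unfolding D_def[of y z]
    proof (rule cInf_greatest[OF ne(2)])
      fix t' assume "t' \<in> S y z"
      then have "D x z \<le> t + t'" unfolding D_def using S_trans that bdd xyz by (auto intro: cInf_lower)
      then show "D x z - t \<le> t'" by simp
    qed
    then have "D x z - D y z \<le> D x y"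
      unfolding D_def[of x y] by (intro cInf_greatest[OF ne(1)]) (auto simp: algebra_simps)
    then show "D x z \<le> D x y + D y z" by simp
  qed
qed

text \<open>
  Symmetrising by the maximum of both directions keeps the optimal constant of \<open>\<rho>\<close>, so the exponent
  \<open>\<beta>\<close> may be as large as \<open>1 / log\<^sub>2 C\<^sub>\<rho>\<close>, the number whose supremum is the index.
\<close>

lemma power_metric_exists:
  assumes eq: "qm_equivalent X \<rho> d" and "0 < \<beta>" and two: "qm_const X \<rho> powr \<beta> \<le> 2"
  obtains D c where "power_metric X d \<beta> D c"
proof -
  have qm: "quasi_metric X \<rho>" "quasi_metric X d" using eq unfolding qm_equivalent_def by auto
  obtain \<kappa> where k: "\<kappa> > 0" "\<And>x y. x \<in> X \<Longrightarrow> y \<in> X \<Longrightarrow> inverse \<kappa> * \<rho> x y \<le> d x y"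
     "\<And>x y. x \<in> X \<Longrightarrow> y \<in> X \<Longrightarrow> d x y \<le> \<kappa> * \<rho> x y"
    using eq unfolding qm_equivalent_def by blast
  have k': "\<rho> x y \<le> \<kappa> * d x y" if "x \<in> X" "y \<in> X" for x y
    using k(2)[OF that] k(1) by (simp add: field_simps)
  obtain C where C: "1 \<le> C" "\<And>x y. x \<in> X \<Longrightarrow> y \<in> X \<Longrightarrow> d y x \<le> C * d x y"
    using quasi_symmetric[OF qm(2)] by blast
  note r0 = quasi_metricD(1)[OF qm(1)] and d0 = quasi_metricD(1)[OF qm(2)]
  define \<sigma> where "\<sigma> x y = max (\<rho> x y) (\<rho> y x)" for x y
  define f where "f x y = \<sigma> x y powr \<beta>" for x y
  have s0: "0 \<le> \<sigma> x y" if "x \<in> X" "y \<in> X" for x y using r0 that by (auto simp: \<sigma>_def le_max_iff_disj)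
  have quasi_s: "\<sigma> x y \<le> qm_const X \<rho> * max (\<sigma> x z) (\<sigma> z y)" if "x \<in> X" "y \<in> X" "z \<in> X" for x y z
  proof -
    have 1: "0 \<le> qm_const X \<rho>" using qm_const_ge_1[OF qm(1)] by simp
    have "\<rho> x y \<le> qm_const X \<rho> * max (\<rho> x z) (\<rho> z y)" using qm_const_bound[OF qm(1)] that by blast
    also have "\<dots> \<le> qm_const X \<rho> * max (\<sigma> x z) (\<sigma> z y)"
      by (intro mult_left_mono 1) (auto simp: \<sigma>_def)
    finally have a: "\<rho> x y \<le> qm_const X \<rho> * max (\<sigma> x z) (\<sigma> z y)" .
    have "\<rho> y x \<le> qm_const X \<rho> * max (\<rho> y z) (\<rho> z x)" using qm_const_bound[OF qm(1)] that by blast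
    also have "\<dots> \<le> qm_const X \<rho> * max (\<sigma> x z) (\<sigma> z y)"
      by (intro mult_left_mono 1) (auto simp: \<sigma>_def)
    finally show ?thesis using a by (simp add: \<sigma>_def)
  qed
  have pm: "max a b powr \<beta> = max (a powr \<beta>) (b powr \<beta>)" if "0 \<le> a" "0 \<le> b" for a b :: real
    using that \<open>0 < \<beta>\<close> powr_mono2[of \<beta> a b] powr_mono2[of \<beta> b a] by (auto simp: max_def)
  have quasi_f: "f x y \<le> 2 * max (f x z) (f z y)" if "x \<in> X" "y \<in> X" "z \<in> X" for x y z
  proof -
    have 1: "0 \<le> qm_const X \<rho>" using qm_const_ge_1[OF qm(1)] by simp
    have m0: "0 \<le> max (\<sigma> x z) (\<sigma> z y)" using s0 that by (auto simp: le_max_iff_disj)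
    have "f x y \<le> (qm_const X \<rho> * max (\<sigma> x z) (\<sigma> z y)) powr \<beta>"
      unfolding f_def by (rule powr_mono2) (use s0 quasi_s that \<open>0 < \<beta>\<close> in auto)
    also have "\<dots> = qm_const X \<rho> powr \<beta> * max (f x z) (f z y)"
      unfolding f_def using 1 m0 s0 that by (simp add: powr_mult pm)
    also have "\<dots> \<le> 2 * max (f x z) (f z y)"
      by (rule mult_right_mono[OF two]) (auto simp: f_def le_max_iff_disj)
    finally show ?thesis .
  qed
  obtain D where D: "\<And>x y. x \<in> X \<Longrightarrow> y \<in> X \<Longrightarrow> 0 \<le> D x y \<and> D x y = D y x \<and> D x y \<le> f x y \<and> f x y \<le> 4 * D x y"
    "\<And>x y z. x \<in> X \<Longrightarrow> y \<in> X \<Longrightarrow> z \<in> X \<Longrightarrow> D x z \<le> D x y + D y z"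
    by (rule chain_metric_exists[of X f]) (use quasi_f quasi_metricD(2)[OF qm(1)] in \<open>auto simp: f_def \<sigma>_def max.commute\<close>)
  define c where "c = max ((\<kappa> * C) powr \<beta>) (4 * \<kappa> powr \<beta>)"
  have "power_metric X d \<beta> D c" unfolding power_metric_def
  proof (intro conjI ballI)
    show "0 < c" using k by (auto simp: c_def less_max_iff_disj)
    fix x y assume xy: "x \<in> X" "y \<in> X"
    show "0 \<le> D x y" "D x y = D y x" using D xy by auto
    have "\<sigma> x y \<le> (\<kappa> * C) * d x y"
    proof -
      have "d x y \<le> C * d x y" using C(1) d0[OF xy] mult_right_mono[of 1 C "d x y"] by simp
      then have "\<kappa> * d x y \<le> \<kappa> * (C * d x y)" using k(1) by simp
      moreover have "\<kappa> * d y x \<le> \<kappa> * (C * d x y)" using k(1) C(2)[OF xy] by simp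
      ultimately show ?thesis using k'[OF xy] k'[OF xy(2,1)] unfolding \<sigma>_def by (simp add: mult.assoc)
    qed
    then have "f x y \<le> ((\<kappa> * C) * d x y) powr \<beta>"
      unfolding f_def using s0 xy \<open>0 < \<beta>\<close> by (intro powr_mono2) auto
    also have "\<dots> = (\<kappa> * C) powr \<beta> * d x y powr \<beta>" using k C d0 xy by (simp add: powr_mult)
    also have "\<dots> \<le> c * d x y powr \<beta>" by (intro mult_right_mono) (auto simp: c_def)
    finally show "D x y \<le> c * d x y powr \<beta>" using D(1)[OF xy] by linarith
    have "d x y \<le> \<kappa> * \<sigma> x y" using k(3)[OF xy] k(1) mult_left_mono[of "\<rho> x y" "\<sigma> x y" \<kappa>] unfolding \<sigma>_def by linarith
    then have "d x y powr \<beta> \<le> (\<kappa> * \<sigma> x y) powr \<beta>" using d0 xy \<open>0 < \<beta>\<close> by (intro powr_mono2) auto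
    also have "\<dots> = \<kappa> powr \<beta> * f x y" using k s0 xy by (simp add: powr_mult f_def)
    also have "\<dots> \<le> \<kappa> powr \<beta> * (4 * D x y)" using D(1)[OF xy] by (intro mult_left_mono) auto
    also have "\<dots> = (4 * \<kappa> powr \<beta>) * D x y" by simp
    also have "\<dots> \<le> c * D x y" using D(1)[OF xy] by (intro mult_right_mono) (auto simp: c_def)
    finally show "d x y powr \<beta> \<le> c * D x y" .
    fix z assume "z \<in> X"
    then show "D x z \<le> D x y + D y z" using D xy by auto
  qed
  then show thesis using that by blast
qed

lemma powr_le_2_of_exponent:
  assumes "1 \<le> C" "0 < \<beta>" "ereal \<beta> \<le> inverse (ereal (log 2 C))"
  shows "C powr \<beta> \<le> 2"
proof (cases "C = 1")
  case False
  then have l: "log 2 C > 0" using assms by simp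
  then have "\<beta> \<le> 1 / log 2 C" using assms(3) by (simp add: inverse_eq_divide)
  then have "\<beta> * log 2 C \<le> 1" using l by (simp add: pos_le_divide_eq)
  then have "2 powr (log 2 C * \<beta>) \<le> 2 powr 1" by (intro powr_mono) (auto simp: mult.commute)
  then show ?thesis using assms by (simp add: powr_powr[symmetric])
qed simp

text \<open>
  The meaning of \<open>\<alpha> \<preceq>\<^sub>q ind(X,d)\<close> for the construction of Hoelder functions: below the index there is room for an
  exponent \<open>\<beta> > \<alpha>\<close>, while at the index attainment provides \<open>\<beta> = \<alpha>\<close>, at the price of \<open>q = \<infinity>\<close>.
\<close>

lemma le_ind_power_metric:
  assumes "quasi_metric X d" "0 < \<alpha>" "le_ind \<alpha> q X d"
  obtains \<beta> D c where "\<alpha> \<le> \<beta>" "\<beta> = \<alpha> \<Longrightarrow> q = \<infinity>" "power_metric X d \<beta> D c"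
proof (cases "ereal \<alpha> = ind X d")
  case True
  then obtain \<rho> where \<rho>: "qm_equivalent X \<rho> d" "qm_exponent X \<rho> = ereal \<alpha>" and q: "q = \<infinity>"
    using assms(3) unfolding le_ind_def by auto
  have "qm_const X \<rho> powr \<alpha> \<le> 2"
    by (rule powr_le_2_of_exponent)
      (use \<rho> assms qm_const_ge_1 in \<open>auto simp: qm_equivalent_def qm_exponent_def\<close>)
  then show thesis using power_metric_exists[OF \<rho>(1) assms(2)] that[OF order_refl q] by metis
next
  case False
  then have "ereal \<alpha> < (SUP \<rho>\<in>{\<rho>. qm_equivalent X \<rho> d}. qm_exponent X \<rho>)"
    using assms(3) unfolding le_ind_def ind_def by auto
  then obtain \<rho> where \<rho>: "qm_equivalent X \<rho> d" "ereal \<alpha> < qm_exponent X \<rho>"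
    unfolding less_SUP_iff by auto
  then obtain \<beta> where \<beta>: "\<alpha> < \<beta>" "ereal \<beta> < qm_exponent X \<rho>"
    using ereal_dense2[OF \<rho>(2)] by auto
  have "qm_const X \<rho> powr \<beta> \<le> 2"
    by (rule powr_le_2_of_exponent)
      (use \<rho> \<beta> assms qm_const_ge_1 in \<open>auto simp: qm_equivalent_def qm_exponent_def less_imp_le\<close>)
  then obtain D c where "power_metric X d \<beta> D c" using power_metric_exists[OF \<rho>(1), of \<beta>] \<beta> assms by auto
  then show thesis using that[of \<beta>] \<beta> by auto
qed

text \<open>
  The index is positive since \<open>C\<^sub>d\<close> is finite, so admissible exponents exist.
\<close>

lemma le_ind_exists:
  assumes "quasi_metric X d"
  obtains \<alpha> where "0 < \<alpha>" "\<And>q. le_ind \<alpha> q X d"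
proof -
  have "0 \<le> log 2 (qm_const X d)" using qm_const_ge_1[OF assms] by simp
  then have "0 < qm_exponent X d" unfolding qm_exponent_def
    by (cases "log 2 (qm_const X d) = 0") auto
  also have "\<dots> \<le> ind X d" unfolding ind_def by (rule SUP_upper) (simp add: qm_equivalent_refl assms)
  finally obtain \<alpha> where "0 < \<alpha>" "ereal \<alpha> < ind X d" using ereal_dense2 by force
  moreover from this have "le_ind \<alpha> q X d" for q unfolding le_ind_def by auto
  ultimately show thesis using that by blast
qed



section \<open>Total boundedness and integrability of the measure\<close>

lemma one_divide_antimono_ennreal: "(a::ennreal) \<le> b \<Longrightarrow> 1 / b \<le> 1 / a"
proof -
  assume "a \<le> b"
  then have "inverse b \<le> inverse a" by (simp add: less_eq_ennreal.rep_eq inverse_ennreal.rep_eq ereal_inverse_antimono)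
  then show ?thesis by (simp add: divide_ennreal_def)
qed

lemma qmm_space:
  assumes "quasi_metric_measure_space M d"
  shows "quasi_metric (space M) d" "qm_open_sets (space M) d \<subseteq> sets M"
    "\<And>x r. x \<in> space M \<Longrightarrow> 0 < r \<Longrightarrow> qball (space M) d x r \<in> sets M"
    "\<And>x r. x \<in> space M \<Longrightarrow> 0 < r \<Longrightarrow> 0 < emeasure M (qball (space M) d x r)"
    "\<And>x r. x \<in> space M \<Longrightarrow> 0 < r \<Longrightarrow> emeasure M (qball (space M) d x r) < \<infinity>"
proof -
  have sub: "sigma_sets (space M) (qm_open_sets (space M) d) \<subseteq> sets M"
    using assms unfolding quasi_metric_measure_space_def by blast
  show "qm_open_sets (space M) d \<subseteq> sets M"
    using sigma_sets_superset_generator sub by (rule order_trans)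
qed (use assms in \<open>simp_all add: quasi_metric_measure_space_def\<close>)

lemma power_metric_ball_open:
  assumes qm: "quasi_metric X d" and "0 < \<beta>" and D: "power_metric X d \<beta> D c" and x: "x \<in> X"
  shows "{y\<in>X. D x y < r} \<in> qm_open_sets X d"
  unfolding qm_open_sets_def
proof (intro CollectI conjI ballI)
  fix y assume "y \<in> {y \<in> X. D x y < r}"
  then have y: "y \<in> X" "D x y < r" by auto
  have c: "c > 0" using D unfolding power_metric_def by blast
  define t where "t = ((r - D x y) / c) powr (1 / \<beta>)"
  have "t > 0" using y c by (simp add: t_def)
  moreover have "D x z < r" if z: "z \<in> X" "d y z < t" for z
  proof -
    have "d y z powr \<beta> < t powr \<beta>"
      using z quasi_metricD(1)[OF qm y(1) z(1)] \<open>0 < \<beta>\<close> by (intro powr_less_mono2) auto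
    also have "\<dots> = (r - D x y) / c" using y c \<open>0 < \<beta>\<close> by (simp add: t_def powr_powr)
    finally have "c * d y z powr \<beta> < r - D x y" using c by (simp add: field_simps)
    moreover have "D y z \<le> c * d y z powr \<beta>" "D x z \<le> D x y + D y z"
      using D x y z unfolding power_metric_def by blast+
    ultimately show ?thesis by simp
  qed
  ultimately show "\<exists>t>0. qball X d y t \<subseteq> {y \<in> X. D x y < r}" unfolding qball_def by blast
qed auto

text \<open>
  The root of \<open>D\<close> is the regularised quasi-metric with open balls that witnesses integrability.
\<close>

lemma power_metric_equivalent:
  assumes qm: "quasi_metric X d" and b: "0 < \<beta>" and D: "power_metric X d \<beta> D c"
  shows "qm_equivalent X (\<lambda>x y. D x y powr (1 / \<beta>)) d"
proof -
  have c: "c > 0" using D unfolding power_metric_def by blast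
  have D1: "0 \<le> D x y" "D x y = D y x" "D x y \<le> c * d x y powr \<beta>" "d x y powr \<beta> \<le> c * D x y"
    if "x \<in> X" "y \<in> X" for x y using D that unfolding power_metric_def by blast+
  have D2: "D x y \<le> D x z + D z y" if "x \<in> X" "y \<in> X" "z \<in> X" for x y z
    using D that unfolding power_metric_def by blast
  note d = quasi_metricD[OF qm]
  have zero: "D x y = 0 \<longleftrightarrow> x = y" if "x \<in> X" "y \<in> X" for x y
  proof -
    have "D x y = 0 \<longleftrightarrow> d x y powr \<beta> = 0"
      using D1[OF that] c by (auto simp: mult_le_0_iff)
    then show ?thesis using d that by auto
  qed
  have tri: "D x y powr (1 / \<beta>) \<le> 2 powr (1 / \<beta>) * max (D x z powr (1 / \<beta>)) (D z y powr (1 / \<beta>))"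
    if "x \<in> X" "y \<in> X" "z \<in> X" for x y z
  proof -
    have "D x y powr (1 / \<beta>) \<le> (2 * max (D x z) (D z y)) powr (1 / \<beta>)"
      by (rule powr_mono2) (use D1(1) D2[OF that] that b in auto)
    also have "\<dots> = 2 powr (1 / \<beta>) * max (D x z) (D z y) powr (1 / \<beta>)"
      using D1(1) that by (simp add: powr_mult le_max_iff_disj)
    also have "\<dots> \<le> 2 powr (1 / \<beta>) * max (D x z powr (1 / \<beta>)) (D z y powr (1 / \<beta>))"
      by (intro mult_left_mono) (auto simp: max_def)
    finally show ?thesis .
  qed
  have "quasi_metric X (\<lambda>x y. D x y powr (1 / \<beta>))"
    unfolding quasi_metric_def
  proof (intro conjI)
    show "\<exists>x\<in>X. \<exists>y\<in>X. x \<noteq> y" using qm unfolding quasi_metric_def by blast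
    show "\<forall>x\<in>X. \<forall>y\<in>X. (D x y powr (1 / \<beta>) = 0) = (x = y)" using zero by simp
    show "\<exists>C0>0. \<forall>x\<in>X. \<forall>y\<in>X. D y x powr (1 / \<beta>) \<le> C0 * D x y powr (1 / \<beta>)"
      by (rule exI[of _ 1]) (use D1(2) in simp)
    show "\<exists>C1>0. \<forall>x\<in>X. \<forall>y\<in>X. \<forall>z\<in>X.
        D x y powr (1 / \<beta>) \<le> C1 * max (D x z powr (1 / \<beta>)) (D z y powr (1 / \<beta>))"
      using tri by (intro exI[of _ "2 powr (1 / \<beta>)"]) auto
  qed auto
  moreover have "inverse (c powr (1 / \<beta>)) * D x y powr (1 / \<beta>) \<le> d x y"
    "d x y \<le> c powr (1 / \<beta>) * D x y powr (1 / \<beta>)" if xy: "x \<in> X" "y \<in> X" for x y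
  proof -
    have "D x y powr (1 / \<beta>) \<le> (c * d x y powr \<beta>) powr (1 / \<beta>)"
      by (rule powr_mono2) (use D1[OF xy] b in auto)
    also have "\<dots> = c powr (1 / \<beta>) * d x y" using c b d(1)[OF xy] by (simp add: powr_mult powr_powr)
    finally show "inverse (c powr (1 / \<beta>)) * D x y powr (1 / \<beta>) \<le> d x y" using c by (simp add: field_simps)
    have "d x y = (d x y powr \<beta>) powr (1 / \<beta>)" using b d(1)[OF xy] by (simp add: powr_powr)
    also have "\<dots> \<le> (c * D x y) powr (1 / \<beta>)"
      by (rule powr_mono2) (use D1[OF xy] b in auto)
    finally show "d x y \<le> c powr (1 / \<beta>) * D x y powr (1 / \<beta>)" using c D1(1)[OF xy] by (simp add: powr_mult)
  qed
  ultimately show ?thesis unfolding qm_equivalent_def using qm c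
    by (auto intro!: exI[of _ "c powr (1 / \<beta>)"])
qed

text \<open>
  The measure of a \<open>D\<close>-ball is lower semicontinuous in the centre: if it exceeds \<open>a\<close>, so does the
  measure of a slightly smaller concentric ball, which by the triangle inequality is contained in all
  balls of the original radius with centres nearby.
\<close>

lemma power_metric_ball_measure_measurable:
  assumes M: "quasi_metric_measure_space M d" and b: "0 < \<beta>"
    and D: "power_metric (space M) d \<beta> D c"
  shows "(\<lambda>x. emeasure M {y\<in>space M. D x y < s}) \<in> borel_measurable M"
proof (rule borel_measurableI_greater)
  fix a :: ennreal
  note qm = qmm_space(1)[OF M]
  have opn: "{y\<in>space M. D x y < r} \<in> qm_open_sets (space M) d" if "x \<in> space M" for x r
    by (rule power_metric_ball_open[OF qm b D that])
  have meas: "{y\<in>space M. D x y < r} \<in> sets M" if "x \<in> space M" for x r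
    using opn[OF that] qmm_space(2)[OF M] by blast
  have "{x\<in>space M. a < emeasure M {y\<in>space M. D x y < s}} \<in> qm_open_sets (space M) d"
    unfolding qm_open_sets_def
  proof (intro CollectI conjI ballI)
    fix x assume "x \<in> {x\<in>space M. a < emeasure M {y\<in>space M. D x y < s}}"
    then have x: "x \<in> space M" and ax: "a < emeasure M {y\<in>space M. D x y < s}" by auto
    define B where "B n = {y\<in>space M. D x y < s - inverse (Suc n)}" for n
    have "(\<Union>n. B n) = {y\<in>space M. D x y < s}"
    proof (intro equalityI subsetI)
      fix y assume "y \<in> {y\<in>space M. D x y < s}"
      then have y: "y \<in> space M" "0 < s - D x y" by auto
      obtain n where "inverse (real (Suc n)) < s - D x y" using reals_Archimedean[OF y(2)] by blast
      then have "y \<in> B n" using y by (simp add: B_def)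
      then show "y \<in> (\<Union>n. B n)" by blast
    next
      fix y assume "y \<in> (\<Union>n. B n)"
      then obtain n where "y \<in> space M" "D x y < s - inverse (Suc n)" unfolding B_def by blast
      moreover have "inverse (real (Suc n)) > 0" by simp
      ultimately have "D x y < s" by linarith
      then show "y \<in> {y\<in>space M. D x y < s}" using \<open>y \<in> space M\<close> by simp
    qed
    moreover have "incseq B"
    proof (rule incseq_SucI)
      fix n show "B n \<subseteq> B (Suc n)"
      proof
        fix y assume "y \<in> B n"
        moreover have "inverse (real (Suc (Suc n))) \<le> inverse (real (Suc n))" by (rule le_imp_inverse_le) auto
        ultimately show "y \<in> B (Suc n)" unfolding B_def mem_Collect_eq by linarith
      qed
    qed
    moreover have "range B \<subseteq> sets M" using meas[OF x] by (auto simp: B_def)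
    ultimately have "emeasure M {y\<in>space M. D x y < s} = (SUP n. emeasure M (B n))"
      using SUP_emeasure_incseq[of B M] by simp
    then obtain n where n: "a < emeasure M (B n)" using ax by (auto simp: less_SUP_iff)
    have "D x x \<le> 0"
    proof -
      have "D x x \<le> c * d x x powr \<beta>" using D x unfolding power_metric_def by blast
      then show ?thesis using quasi_metricD(2)[OF qm x x] by simp
    qed
    then have "x \<in> {y\<in>space M. D x y < inverse (Suc n)}" using x by (auto intro: le_less_trans)
    then obtain r where r: "r > 0" "qball (space M) d x r \<subseteq> {y\<in>space M. D x y < inverse (Suc n)}"
      using opn[OF x, of "inverse (Suc n)"] unfolding qm_open_sets_def by blast
    have "a < emeasure M {y\<in>space M. D z y < s}" if z: "z \<in> qball (space M) d x r" for z
    proof -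
      have z': "z \<in> space M" "D x z < inverse (Suc n)" using z r by auto
      have "B n \<subseteq> {y\<in>space M. D z y < s}"
      proof
        fix y assume "y \<in> B n"
        then have y: "y \<in> space M" "D x y < s - inverse (Suc n)" by (auto simp: B_def)
        have "D z y \<le> D z x + D x y" "D z x = D x z" using D x y z' unfolding power_metric_def by blast+
        then show "y \<in> {y\<in>space M. D z y < s}" using y z' by simp
      qed
      then show ?thesis using n meas[OF z'(1)] by (meson emeasure_mono less_le_trans)
    qed
    then show "\<exists>r>0. qball (space M) d x r \<subseteq> {x\<in>space M. a < emeasure M {y\<in>space M. D x y < s}}"
      using r(1) unfolding qball_def by blast
  qed auto
  then show "{x\<in>space M. a < emeasure M {y\<in>space M. D x y < s}} \<in> sets M"
    using qmm_space(2)[OF M] by blast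
qed

lemma totally_bounded_imp_finite_measure:
  assumes M: "quasi_metric_measure_space M d" and tb: "qm_totally_bounded (space M) d"
  shows "emeasure M (space M) < \<infinity>"
proof -
  obtain F where F: "finite F" "F \<subseteq> space M" "space M \<subseteq> (\<Union>x\<in>F. qball (space M) d x 1)"
    using tb unfolding qm_totally_bounded_def by (meson zero_less_one)
  have "emeasure M (space M) \<le> emeasure M (\<Union>x\<in>F. qball (space M) d x 1)"
    by (rule emeasure_mono) (use F qmm_space(3)[OF M] in \<open>auto intro!: sets.finite_UN\<close>)
  also have "\<dots> \<le> (\<Sum>x\<in>F. emeasure M (qball (space M) d x 1))"
    by (rule emeasure_subadditive_finite) (use F qmm_space(3)[OF M] in auto)
  also have "\<dots> < \<infinity>" using F qmm_space(5)[OF M, of _ 1] by (auto simp: less_top)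
  finally show ?thesis .
qed

lemma totally_bounded_imp_integrable:
  assumes M: "quasi_metric_measure_space M d" and tb: "qm_totally_bounded (space M) d"
  shows "integrable_measure M d"
proof -
  note qm = qmm_space(1)[OF M]
  obtain \<beta> D c where b: "0 < \<beta>" and D: "power_metric (space M) d \<beta> D c"
  proof -
    obtain \<alpha> where "0 < \<alpha>" "le_ind \<alpha> \<infinity> (space M) d" using le_ind_exists[OF qm] by metis
    then show thesis using le_ind_power_metric[OF qm] that by (metis less_le_trans)
  qed
  have c: "c > 0" using D unfolding power_metric_def by blast
  have D0: "0 \<le> D x y" if "x \<in> space M" "y \<in> space M" for x y using D that unfolding power_metric_def by blast
  let ?\<rho> = "\<lambda>x y. D x y powr (1 / \<beta>)"
  have ball: "qball (space M) ?\<rho> x r = {y\<in>space M. D x y < r powr \<beta>}" if x: "x \<in> space M" and r: "r > 0" for x r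
  proof -
    have "D x y powr (1 / \<beta>) < r \<longleftrightarrow> D x y < r powr \<beta>" if y: "y \<in> space M" for y
    proof
      assume "D x y powr (1 / \<beta>) < r"
      then have "(D x y powr (1 / \<beta>)) powr \<beta> < r powr \<beta>" using b by (intro powr_less_mono2) auto
      then show "D x y < r powr \<beta>" using b D0[OF x y] by (simp add: powr_powr)
    next
      assume "D x y < r powr \<beta>"
      then have "D x y powr (1 / \<beta>) < (r powr \<beta>) powr (1 / \<beta>)"
        using b D0[OF x y] by (intro powr_less_mono2) auto
      then show "D x y powr (1 / \<beta>) < r" using b r by (simp add: powr_powr)
    qed
    then show ?thesis unfolding qball_def by auto
  qed
  have int: "(\<integral>\<^sup>+x. 1 / emeasure M {y\<in>space M. D x y < s} \<partial>M) < \<infinity>" if s: "s > 0" for s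
  proof -
    define e where "e = (s / (2 * c)) powr (1 / \<beta>)"
    have e: "e > 0" "c * e powr \<beta> = s / 2" using s c b by (auto simp: e_def powr_powr)
    obtain F where F: "finite F" "F \<subseteq> space M" "space M \<subseteq> (\<Union>a\<in>F. qball (space M) d a e)"
      using tb e unfolding qm_totally_bounded_def by meson
    \<comment> \<open>a lower bound for the measure of all \<open>D\<close>-balls of radius \<open>s\<close>\<close>
    define m where "m = Min ((\<lambda>a. emeasure M (qball (space M) d a e)) ` F)"
    have "space M \<noteq> {}" using qm unfolding quasi_metric_def by blast
    then have Fne: "F \<noteq> {}" using F by blast
    have m: "0 < m" unfolding m_def using F Fne qmm_space(4)[OF M _ e(1)] by (auto simp: Min_gr_iff)
    have le: "m \<le> emeasure M {y\<in>space M. D x y < s}" if x: "x \<in> space M" for x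
    proof -
      obtain a where a: "a \<in> F" "a \<in> space M" "d a x < e" using F x unfolding qball_def by blast
      have half: "D a z < s / 2" if z: "z \<in> space M" "d a z < e" for z
      proof -
        have "D a z \<le> c * d a z powr \<beta>" using D a z unfolding power_metric_def by blast
        also have "\<dots> < c * e powr \<beta>"
          using z c b quasi_metricD(1)[OF qm a(2) z(1)] by (intro mult_strict_left_mono powr_less_mono2) auto
        finally show ?thesis using e by simp
      qed
      have "qball (space M) d a e \<subseteq> {y\<in>space M. D x y < s}"
      proof
        fix y assume "y \<in> qball (space M) d a e"
        then have y: "y \<in> space M" "d a y < e" unfolding qball_def by auto
        have "D x y \<le> D x a + D a y" "D x a = D a x" using D x y a unfolding power_metric_def by blast+
        then show "y \<in> {y\<in>space M. D x y < s}" using half[OF x a(3)] half[OF y] y by simp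
      qed
      moreover have "{y\<in>space M. D x y < s} \<in> sets M"
        using power_metric_ball_open[OF qm b D x] qmm_space(2)[OF M] by blast
      ultimately have "emeasure M (qball (space M) d a e) \<le> emeasure M {y\<in>space M. D x y < s}" by (rule emeasure_mono)
      moreover have "m \<le> emeasure M (qball (space M) d a e)" unfolding m_def using F a by (intro Min_le) auto
      ultimately show ?thesis by simp
    qed
    have "(\<integral>\<^sup>+x. 1 / emeasure M {y\<in>space M. D x y < s} \<partial>M) \<le> (\<integral>\<^sup>+x. 1 / m \<partial>M)"
      by (rule nn_integral_mono) (use le in \<open>auto intro: one_divide_antimono_ennreal\<close>)
    also have "\<dots> = (1 / m) * emeasure M (space M)" by simp
    also have "1 / m < \<infinity>"
    proof -
      have "1 / m \<noteq> top" using m by (simp add: ennreal_divide_eq_top_iff)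
      then show ?thesis by (simp add: less_top)
    qed
    then have "(1 / m) * emeasure M (space M) < \<infinity>"
      using totally_bounded_imp_finite_measure[OF M tb] by (simp add: ennreal_mult_less_top)
    finally show ?thesis .
  qed
  show ?thesis unfolding integrable_measure_def
  proof (intro exI[of _ ?\<rho>] conjI allI impI)
    show "qm_equivalent (space M) ?\<rho> d" by (rule power_metric_equivalent[OF qm b D])
    fix r :: real assume r: "r > 0"
    show "\<forall>x\<in>space M. qball (space M) ?\<rho> x r \<in> sets M"
    proof
      fix x assume x: "x \<in> space M"
      show "qball (space M) ?\<rho> x r \<in> sets M"
        unfolding ball[OF x r] using power_metric_ball_open[OF qm b D x] qmm_space(2)[OF M] by (rule subsetD[rotated])
    qed
    have "(\<lambda>x. emeasure M (qball (space M) ?\<rho> x r)) \<in> borel_measurable M \<longleftrightarrow>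
        (\<lambda>x. emeasure M {y\<in>space M. D x y < r powr \<beta>}) \<in> borel_measurable M"
      by (rule measurable_cong) (simp only: ball[OF _ r])
    then show "(\<lambda>x. emeasure M (qball (space M) ?\<rho> x r)) \<in> borel_measurable M"
      using power_metric_ball_measure_measurable[OF M b D, of "r powr \<beta>"] by simp
    have "(\<integral>\<^sup>+x. 1 / emeasure M (qball (space M) ?\<rho> x r) \<partial>M)
        = (\<integral>\<^sup>+x. 1 / emeasure M {y\<in>space M. D x y < r powr \<beta>} \<partial>M)"
      by (rule nn_integral_cong) (simp only: ball[OF _ r])
    then show "(\<integral>\<^sup>+x. 1 / emeasure M (qball (space M) ?\<rho> x r) \<partial>M) < \<infinity>"
      using int[of "r powr \<beta>"] r by simp
  qed
qed

lemma not_totally_bounded_separated: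
  assumes "\<not> qm_totally_bounded X d"
  obtains \<epsilon> and x :: "nat \<Rightarrow> 'a" where "0 < \<epsilon>" "\<And>n. x n \<in> X" "\<And>m n. m < n \<Longrightarrow> \<epsilon> \<le> d (x m) (x n)"
proof -
  define cover where "cover F e \<longleftrightarrow> X \<subseteq> (\<Union>x\<in>F. qball X d x e)" for F e
  have "\<not> (\<forall>e>0. \<exists>F. finite F \<and> F \<subseteq> X \<and> cover F e)"
    using assms unfolding qm_totally_bounded_def cover_def .
  then obtain e where e: "e > 0" "\<And>F. finite F \<Longrightarrow> F \<subseteq> X \<Longrightarrow> \<not> cover F e" by blast
  have "\<exists>x::nat \<Rightarrow> 'a. \<forall>n. x n \<in> X \<and> (\<forall>m<n. e \<le> d (x m) (x n))"
  proof -
    define P where "P f (n::nat) r \<longleftrightarrow> ((\<forall>m<n. f m \<in> X) \<longrightarrow> r \<in> X \<and> (\<forall>m<n. e \<le> d (f m) r))" for f n r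
    have "\<exists>x. \<forall>n. P x n (x n)"
    proof (rule dependent_wellorder_choice[where P = P])
      show "P f n r = P g n r" if "\<And>m. m < n \<Longrightarrow> f m = g m" for f g n r using that unfolding P_def by auto
      show "\<exists>r. P f n r" for f n
      proof (cases "\<forall>m<n. f m \<in> X")
        case True
        then have "\<not> X \<subseteq> (\<Union>m<n. qball X d (f m) e)"
          using e(2)[of "f ` {..<n}"] by (auto simp: cover_def)
        then obtain r where "r \<in> X" "\<forall>m<n. r \<notin> qball X d (f m) e" by auto
        then show ?thesis unfolding P_def qball_def by (auto simp: not_less)
      qed (auto simp: P_def)
    qed
    then obtain x where x: "\<And>n. P x n (x n)" by blast
    have "x n \<in> X" for n by (induction n rule: less_induct) (use x in \<open>auto simp: P_def\<close>)
    then show ?thesis using x unfolding P_def by blast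
  qed
  then show thesis using that e by blast
qed

text \<open>
  The radius is chosen so that a common point of the two balls would violate the quasi-triangle
  inequality; the factor \<open>C\<close> pays for reversing the distance to the second centre.
\<close>

lemma separated_balls_disjoint:
  assumes qm: "quasi_metric X d" and "0 < \<epsilon>"
  obtains t where "0 < t" "\<And>x y. x \<in> X \<Longrightarrow> y \<in> X \<Longrightarrow> \<epsilon> \<le> d x y \<Longrightarrow> qball X d x t \<inter> qball X d y t = {}"
proof -
  obtain C where C: "1 \<le> C" "\<And>x y. x \<in> X \<Longrightarrow> y \<in> X \<Longrightarrow> d y x \<le> C * d x y" using quasi_symmetric[OF qm] by blast
  let ?K = "qm_const X d"
  have K: "1 \<le> ?K" by (rule qm_const_ge_1[OF qm])
  define t where "t = \<epsilon> / (?K * C)"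
  have KC: "?K * C > 0" using K C(1) by simp
  have t: "t > 0" "?K * (C * t) = \<epsilon>" using KC \<open>0 < \<epsilon>\<close> K C(1) by (auto simp: t_def)
  have False if xy: "x \<in> X" "y \<in> X" "\<epsilon> \<le> d x y" and z: "z \<in> X" "d x z < t" "d y z < t" for x y z
  proof -
    have "d z y \<le> C * d y z" using C(2) xy z by blast
    also have "\<dots> < C * t" using C(1) z by simp
    finally have "d z y < C * t" .
    moreover have "d x z < C * t" using z(2) C(1) t(1) mult_right_mono[of 1 C t] by linarith
    ultimately have "?K * max (d x z) (d z y) < ?K * (C * t)" using K by (intro mult_strict_left_mono) auto
    then show False using qm_const_bound[OF qm xy(1,2) z(1)] xy(3) t by simp
  qed
  then show thesis using that[of t] t unfolding qball_def by blast
qed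

text \<open>
  Moving the centre within a ball costs exactly the factor \<open>C\<^sub>d\<close> in the radius. Because the centre \<open>x\<close>
  stays in the first argument, no symmetry constant appears, and the doubling condition with factor
  \<open>C\<^sub>d\<close> applies in one step, also when \<open>C\<^sub>d = 1\<close>.
\<close>

lemma qball_shift:
  assumes qm: "quasi_metric X d" and "x \<in> X" "y \<in> qball X d x t" 
  shows "qball X d y t \<subseteq> qball X d x (qm_const X d * t)"
proof
  fix z assume "z \<in> qball X d y t"
  then have z: "z \<in> X" "d y z < t" and y: "y \<in> X" "d x y < t" using assms unfolding qball_def by auto
  have "d x z \<le> qm_const X d * max (d x y) (d y z)" by (rule qm_const_bound[OF qm]) (use assms y z in auto)
  also have "\<dots> < qm_const X d * t" using y z qm_const_ge_1[OF qm] by (intro mult_strict_left_mono) auto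
  finally show "z \<in> qball X d x (qm_const X d * t)" using z by (simp add: qball_def)
qed

text \<open>
  On a ball \<open>B\<close> of radius \<open>\<delta>\<close> around \<open>x\<close> the integrand is at least \<open>1 / \<mu>(B\<^sub>d(x, C\<^sub>d \<delta>))\<close>, and the
  doubling condition bounds \<open>\<mu>(B)\<close> times this number below by \<open>1 / C\<close>. Infinitely many disjoint
  balls of radius \<open>\<delta>\<close> would make the integral infinite. The quasi-metric \<open>\<rho>\<close> from the
  definition of integrability is compared with \<open>d\<close> by shrinking its radius to \<open>\<delta> / \<kappa>\<close>.
\<close>

lemma integrable_imp_totally_bounded:
  assumes M: "quasi_metric_measure_space M d" 
    and dbl: "\<And>\<delta>. 0 < \<delta> \<Longrightarrow> \<delta> \<le> \<delta>\<^sub>0 \<Longrightarrow> doubling M d (qm_const (space M) d) \<delta>" and "0 < \<delta>\<^sub>0"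
    and int: "integrable_measure M d"
  shows "qm_totally_bounded (space M) d"
proof (rule ccontr)
  assume ntb: "\<not> ?thesis"
  note qm = qmm_space(1)[OF M]
  let ?X = "space M" let ?K = "qm_const ?X d"
  obtain \<epsilon> and x :: "nat \<Rightarrow> 'a" where e: "0 < \<epsilon>" and x: "\<And>n. x n \<in> ?X" and sep: "\<And>m n. m < n \<Longrightarrow> \<epsilon> \<le> d (x m) (x n)"
    using not_totally_bounded_separated[OF ntb] by blast
  obtain t where t: "0 < t" "\<And>x y. x \<in> ?X \<Longrightarrow> y \<in> ?X \<Longrightarrow> \<epsilon> \<le> d x y \<Longrightarrow> qball ?X d x t \<inter> qball ?X d y t = {}"
    using separated_balls_disjoint[OF qm e] by blast
  define \<delta> where "\<delta> = min t \<delta>\<^sub>0"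
  have \<delta>: "0 < \<delta>" "\<delta> \<le> \<delta>\<^sub>0" "\<delta> \<le> t" using t \<open>0 < \<delta>\<^sub>0\<close> by (auto simp: \<delta>_def)
  define B where "B n = qball ?X d (x n) \<delta>" for n
  define w where "w n = emeasure M (qball ?X d (x n) (?K * \<delta>))" for n
  have K: "?K * \<delta> > 0" using qm_const_ge_1[OF qm] \<delta> by simp
  have w: "0 < w n" "w n < \<infinity>" for n unfolding w_def using qmm_space(4,5)[OF M x K] by auto
  have Bm: "B n \<in> sets M" for n unfolding B_def by (rule qmm_space(3)[OF M x \<delta>(1)])
  have "B m \<inter> B n = {}" if "m < n" for m n
    using t(2)[OF x x sep[OF that]] \<delta> unfolding B_def qball_def by fastforce
  then have disj: "disjoint_family B" unfolding disjoint_family_on_def by (metis inf_commute nat_neq_iff)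
  obtain C where C: "1 \<le> C" "\<And>n. w n \<le> ennreal C * emeasure M (B n)"
    using dbl[OF \<delta>(1,2)] x unfolding doubling_def w_def B_def by blast
  obtain \<rho> where \<rho>: "qm_equivalent ?X \<rho> d"
    "\<And>r. r > 0 \<Longrightarrow> \<forall>x\<in>?X. qball ?X \<rho> x r \<in> sets M" "\<And>r. r > 0 \<Longrightarrow> (\<integral>\<^sup>+y. 1 / emeasure M (qball ?X \<rho> y r) \<partial>M) < \<infinity>"
    using int unfolding integrable_measure_def by blast
  obtain \<kappa> where k: "\<kappa> > 0" "\<And>x y. x \<in> ?X \<Longrightarrow> y \<in> ?X \<Longrightarrow> d x y \<le> \<kappa> * \<rho> x y"
    using \<rho>(1) unfolding qm_equivalent_def by blast
  let ?I = "\<integral>\<^sup>+y. 1 / emeasure M (qball ?X \<rho> y (\<delta> / \<kappa>)) \<partial>M"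
  have mono: "1 / w n \<le> 1 / emeasure M (qball ?X \<rho> y (\<delta> / \<kappa>))" if y: "y \<in> B n" for n y
  proof -
    have "y \<in> ?X" using y by (auto simp: B_def qball_def)
    then have "d y z < \<delta>" if "z \<in> ?X" "\<rho> y z < \<delta> / \<kappa>" for z
      using k(2)[of y z] that k(1) by (simp add: pos_less_divide_eq mult.commute)
    then have "qball ?X \<rho> y (\<delta> / \<kappa>) \<subseteq> qball ?X d y \<delta>" unfolding qball_def by blast
    then have "qball ?X \<rho> y (\<delta> / \<kappa>) \<subseteq> qball ?X d (x n) (?K * \<delta>)"
      using qball_shift[OF qm x, of y n \<delta>] y unfolding B_def by blast
    then have "emeasure M (qball ?X \<rho> y (\<delta> / \<kappa>)) \<le> w n"
      unfolding w_def by (rule emeasure_mono) (rule qmm_space(3)[OF M x K])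
    then show ?thesis by (rule one_divide_antimono_ennreal)
  qed
  have "of_nat N * (1 / ennreal C) \<le> ?I" for N
  proof -
    have one: "1 / ennreal C \<le> emeasure M (B n) * (1 / w n)" for n
    proof -
      have "1 = w n * (1 / w n)" using w[of n] by (simp add: ennreal_times_divide)
      also have "\<dots> \<le> ennreal C * emeasure M (B n) * (1 / w n)" by (rule mult_right_mono[OF C(2)]) simp
      finally have "1 / ennreal C \<le> (ennreal C * (emeasure M (B n) * (1 / w n))) / ennreal C"
        by (intro divide_right_mono_ennreal) (simp add: mult.assoc)
      also have "\<dots> = emeasure M (B n) * (1 / w n)"
        using C(1) mult_divide_eq_ennreal[of "ennreal C" "emeasure M (B n) * (1 / w n)"] by (simp add: mult_ac)
      finally show ?thesis .
    qed
    have "of_nat N * (1 / ennreal C) = (\<Sum>n<N. 1 / ennreal C)" by simp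
    also have "\<dots> \<le> (\<Sum>n<N. emeasure M (B n) * (1 / w n))" by (rule sum_mono[OF one])
    also have "\<dots> = (\<Sum>n<N. \<integral>\<^sup>+y. (1 / w n) * indicator (B n) y \<partial>M)"
      by (intro sum.cong refl) (subst nn_integral_cmult_indicator[OF Bm], rule mult.commute)
    also have "\<dots> = (\<integral>\<^sup>+y. (\<Sum>n<N. (1 / w n) * indicator (B n) y) \<partial>M)"
      by (subst nn_integral_sum) (use Bm in auto)
    also have "\<dots> \<le> ?I"
    proof (rule nn_integral_mono)
      fix y assume "y \<in> ?X"
      show "(\<Sum>n<N. (1 / w n) * indicator (B n) y) \<le> 1 / emeasure M (qball ?X \<rho> y (\<delta> / \<kappa>))"
      proof (cases "\<exists>n<N. y \<in> B n")
        case True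
        then obtain n where n: "n < N" "y \<in> B n" by blast
        have "(\<Sum>i<N. (1 / w i) * indicator (B i) y) = (\<Sum>i<N. if i = n then 1 / w n else 0)"
          by (rule sum.cong) (use n disj in \<open>auto simp: indicator_def disjoint_family_on_def\<close>)
        then show ?thesis using n mono by simp
      next
        case False
        then have "(\<Sum>i<N. (1 / w i) * indicator (B i) y) = 0" by (intro sum.neutral) auto
        then show ?thesis by simp
      qed
    qed
    finally show ?thesis .
  qed
  moreover obtain v where v: "?I = ennreal v" "v \<ge> 0" using \<rho>(3)[of "\<delta> / \<kappa>"] \<delta> k by (cases ?I) auto
  moreover have "of_nat N * (1 / ennreal C) = ennreal (real N * (1 / C))" for N
  proof -
    have "1 / ennreal C = ennreal (1 / C)" using divide_ennreal[of 1 C] C(1) by simp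
    then show ?thesis using C(1) ennreal_mult[of "real N" "1 / C"] by (simp add: ennreal_of_nat_eq_real_of_nat)
  qed
  ultimately have "ennreal (real N * (1 / C)) \<le> ennreal v" for N by (metis (no_types))
  then have "real N * (1 / C) \<le> v" for N using v(2) by (simp add: ennreal_le_iff)
  then have "real N \<le> v * C" for N using C(1) by (simp add: field_simps)
  then show False using reals_Archimedean2[of "v * C"] by (meson not_less)
qed



section \<open>Powers, \<open>L\<^sup>p\<close> and \<open>\<ell>\<^sup>q\<close> quasi-norms\<close>

lemma epowr_mono: "x \<le> y \<Longrightarrow> 0 < a \<Longrightarrow> epowr x a \<le> epowr y a"
  unfolding epowr_def
  by (auto intro!: ennreal_leI powr_mono2 enn2real_mono simp: top_unique less_top)

lemma epowr_ennreal: "0 \<le> x \<Longrightarrow> epowr (ennreal x) a = ennreal (x powr a)"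
  by (simp add: epowr_def)

lemma epowr_epowr: "epowr (epowr x a) b = epowr x (a * b)"
  by (cases x) (simp_all add: epowr_def powr_powr)

lemma epowr_one: "epowr x 1 = x"
  by (cases x) (simp_all add: epowr_def)

lemma epowr_eq_top_iff: "epowr x a = \<infinity> \<longleftrightarrow> x = \<infinity>"
  by (auto simp: epowr_def)

lemma epowr_mult: "epowr (x * y) a = epowr x a * epowr y a"
proof (cases "x = \<infinity> \<or> y = \<infinity>")
  case True
  then show ?thesis
    by (auto simp: epowr_def ennreal_top_mult ennreal_mult_top enn2real_eq_0_iff)
next
  case False
  then obtain r s where "x = ennreal r" "y = ennreal s" "0 \<le> r" "0 \<le> s" by (cases x; cases y) auto
  then show ?thesis by (simp add: ennreal_mult[symmetric] epowr_ennreal powr_mult)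
qed

lemma epowr_le_iff:
  assumes "0 < p"
  shows "epowr x (1 / p) \<le> y \<longleftrightarrow> x \<le> epowr y p"
proof
  assume "epowr x (1 / p) \<le> y"
  then have "epowr (epowr x (1 / p)) p \<le> epowr y p" using assms by (rule epowr_mono)
  then show "x \<le> epowr y p" using assms by (simp add: epowr_epowr epowr_one)
next
  assume "x \<le> epowr y p"
  then have "epowr x (1 / p) \<le> epowr (epowr y p) (1 / p)" using assms by (intro epowr_mono) auto
  then show "epowr x (1 / p) \<le> y" using assms by (simp add: epowr_epowr epowr_one)
qed

lemma Lp_norm_eq: "Lp_norm M p u = epowr (\<integral>\<^sup>+x. ennreal (\<bar>u x\<bar> powr p) \<partial>M) (1 / p)"
  unfolding Lp_norm_def Lp_enorm_def by (simp add: epowr_ennreal)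

lemma Lp_norm_le_iff:
  assumes "0 < p" "0 \<le> R"
  shows "Lp_norm M p u \<le> ennreal R \<longleftrightarrow> (\<integral>\<^sup>+x. ennreal (\<bar>u x\<bar> powr p) \<partial>M) \<le> ennreal (R powr p)"
  unfolding Lp_norm_eq epowr_le_iff[OF assms(1)] using assms by (simp add: epowr_ennreal)

lemma Lp_norm_finite_iff: "Lp_norm M p u < \<infinity> \<longleftrightarrow> (\<integral>\<^sup>+x. ennreal (\<bar>u x\<bar> powr p) \<partial>M) < \<infinity>"
  unfolding Lp_norm_eq less_top[symmetric] infinity_ennreal_def[symmetric] using epowr_eq_top_iff
  by (metis infinity_ennreal_def less_top)

lemma Lp_enorm_mono:
  assumes "0 < p" "\<And>x. x \<in> space M \<Longrightarrow> f x \<le> g x"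
  shows "Lp_enorm M p f \<le> Lp_enorm M p g"
  unfolding Lp_enorm_def by (intro epowr_mono nn_integral_mono) (use assms in auto)

lemma lq_enorm_upper:
  assumes "0 < q"
  shows "a k \<le> lq_enorm q a"
proof (cases "q = \<infinity>")
  case True
  then show ?thesis by (auto simp: lq_enorm_def intro: SUP_upper)
next
  case False
  then have q: "0 < enn2real q" using assms by (simp add: enn2real_positive_iff less_top)
  have "epowr (a k) (enn2real q) = (\<integral>\<^sup>+j. epowr (a j) (enn2real q) * indicator {k} j \<partial>count_space UNIV)"
    by (subst nn_integral_indicator_singleton) auto
  also have "\<dots> \<le> (\<integral>\<^sup>+j. epowr (a j) (enn2real q) \<partial>count_space UNIV)"
    by (intro nn_integral_mono) (auto simp: indicator_def)
  finally have "epowr (epowr (a k) (enn2real q)) (1 / enn2real q) \<le> lq_enorm q a"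
    using False q unfolding lq_enorm_def by (auto intro: epowr_mono)
  then show ?thesis using q by (simp add: epowr_epowr epowr_one)
qed

lemma powr_sum2_le:
  fixes a b :: real assumes "0 < p"
  shows "\<bar>a + b\<bar> powr p \<le> 2 powr p * (\<bar>a\<bar> powr p + \<bar>b\<bar> powr p)"
proof -
  have "\<bar>a + b\<bar> powr p \<le> (2 * max \<bar>a\<bar> \<bar>b\<bar>) powr p" using assms by (intro powr_mono2) auto
  also have "\<dots> = 2 powr p * max \<bar>a\<bar> \<bar>b\<bar> powr p" by (simp add: powr_mult)
  also have "\<dots> \<le> 2 powr p * (\<bar>a\<bar> powr p + \<bar>b\<bar> powr p)"
    by (intro mult_left_mono) (auto simp: max_def)
  finally show ?thesis .
qed

lemma powr_sum3_le:
  fixes a b c :: real assumes "0 < p"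
  shows "\<bar>a + b + c\<bar> powr p \<le> 3 powr p * (\<bar>a\<bar> powr p + \<bar>b\<bar> powr p + \<bar>c\<bar> powr p)"
proof -
  let ?m = "max \<bar>a\<bar> (max \<bar>b\<bar> \<bar>c\<bar>)"
  have "\<bar>a + b + c\<bar> powr p \<le> (3 * ?m) powr p" using assms by (intro powr_mono2) auto
  also have "\<dots> = 3 powr p * ?m powr p" by (simp add: powr_mult)
  also have "\<dots> \<le> 3 powr p * (\<bar>a\<bar> powr p + \<bar>b\<bar> powr p + \<bar>c\<bar> powr p)"
    by (intro mult_left_mono) (auto simp: max_def)
  finally show ?thesis .
qed

section \<open>Total boundedness implies compactness\<close>

text \<open>
  A two-point bound \<open>|u(x) - u(y)|\<^sup>p \<le> H(x) + H(y)\<close> can be turned into an approximation of \<open>u\<close> by a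
  constant: freeze \<open>y = a\<close> at a point where \<open>H\<close> is at most its average over the cell, and integrate in \<open>x\<close>.
\<close>

lemma oscillation_on_cell:
  assumes A: "A \<in> sets M" "emeasure M A < \<infinity>" and E: "E \<in> null_sets M"
    and H[measurable]: "H \<in> borel_measurable M"
    and osc: "\<And>x y. x \<in> A - E \<Longrightarrow> y \<in> A - E \<Longrightarrow> ennreal (\<bar>u x - u y\<bar> powr p) \<le> H x + H y"
  obtains a where "(\<integral>\<^sup>+x. ennreal (\<bar>u x - a\<bar> powr p) * indicator A x \<partial>M) \<le> 2 * (\<integral>\<^sup>+x. H x * indicator A x \<partial>M)"
proof -
  note [measurable] = A(1)
  let ?I = "\<integral>\<^sup>+x. H x * indicator A x \<partial>M"
  have notE: "AE x in M. x \<notin> E" using E by (rule AE_not_in)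
  consider "?I = \<infinity>" | "emeasure M A = 0" | "?I < \<infinity>" "0 < emeasure M A"
    by (metis less_top infinity_ennreal_def not_gr_zero)
  then show thesis
  proof cases
    case 1
    have "2 * (\<infinity>::ennreal) = \<infinity>" by (simp add: ennreal_mult_top)
    then show ?thesis using that[of 0] unfolding 1 by simp
  next
    case 2
    then have "AE x in M. x \<notin> A" using A(1) by (intro AE_not_in) auto
    then have "(\<integral>\<^sup>+x. ennreal (\<bar>u x - 0\<bar> powr p) * indicator A x \<partial>M) = (\<integral>\<^sup>+x. 0 \<partial>M)"
      by (intro nn_integral_cong_AE) auto
    then show ?thesis using that[of 0] by simp
  next
    case 3
    let ?m = "?I / emeasure M A"
    have m: "?m * emeasure M A = ?I"
      using 3 A(2) by (simp add: ennreal_divide_times ennreal_times_divide[symmetric])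
    \<comment> \<open>a point where \<open>H\<close> does not exceed its average\<close>
    have "\<exists>a\<in>A - E. H a \<le> ?m"
    proof (rule ccontr)
      assume "\<not> ?thesis"
      then have gt: "?m < H a" if "a \<in> A - E" for a using that by (meson not_le)
      have "(\<integral>\<^sup>+x. ?m * indicator A x \<partial>M) < (\<integral>\<^sup>+x. H x * indicator A x \<partial>M)"
      proof (rule nn_integral_less)
        show "(\<integral>\<^sup>+x. ?m * indicator A x \<partial>M) \<noteq> \<infinity>" using m 3 by (simp add: nn_integral_cmult_indicator)
        show "AE x in M. ?m * indicator A x \<le> H x * indicator A x"
          using notE by eventually_elim (use gt in \<open>auto simp: indicator_def less_imp_le\<close>)
        show "\<not> (AE x in M. H x * indicator A x \<le> ?m * indicator A x)"
        proof
          assume "AE x in M. H x * indicator A x \<le> ?m * indicator A x"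
          then have "AE x in M. x \<notin> A" using notE
            by eventually_elim (use gt in \<open>auto simp: indicator_def not_le split: if_splits dest: leD\<close>)
          then have "emeasure M {x\<in>space M. x \<in> A} = 0" by (rule emeasure_eq_0_AE)
          moreover have "{x\<in>space M. x \<in> A} = A" using sets.sets_into_space[OF A(1)] by blast
          ultimately have "emeasure M A = 0" by simp
          then show False using 3 by simp
        qed
      qed auto
      then show False using m by (simp add: nn_integral_cmult_indicator)
    qed
    then obtain a where a: "a \<in> A - E" "H a \<le> ?m" by blast
    have "(\<integral>\<^sup>+x. ennreal (\<bar>u x - u a\<bar> powr p) * indicator A x \<partial>M)
        \<le> (\<integral>\<^sup>+x. H x * indicator A x + ?m * indicator A x \<partial>M)"
    proof (rule nn_integral_mono_AE)
      show "AE x in M. ennreal (\<bar>u x - u a\<bar> powr p) * indicator A x \<le> H x * indicator A x + ?m * indicator A x"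
        using notE
      proof eventually_elim
        case (elim x)
        then show ?case
          using order_trans[OF osc[of x a] add_left_mono[OF a(2), of "H x"]] a(1) by (cases "x \<in> A") auto
      qed
    qed
    also have "\<dots> = ?I + ?m * emeasure M A" by (subst nn_integral_add) (auto simp: nn_integral_cmult_indicator)
    also have "\<dots> = 2 * ?I" unfolding m by (simp add: mult_2)
    finally show ?thesis by (rule that)
  qed
qed

definition step_function :: "(nat \<Rightarrow> 'a set) \<Rightarrow> nat \<Rightarrow> (nat \<Rightarrow> real) \<Rightarrow> 'a \<Rightarrow> real" where
  "step_function A n a x = (\<Sum>i<n. a i * indicator (A i) x)"

lemma step_function_eq:
  assumes "disjoint_family A" "i < n" "x \<in> A i"
  shows "step_function A n a x = a i"
proof -
  have "step_function A n a x = (\<Sum>j<n. if j = i then a i else 0)"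
    unfolding step_function_def
    by (rule sum.cong) (use assms in \<open>auto simp: disjoint_family_on_def indicator_def\<close>)
  then show ?thesis using assms by simp
qed

text \<open>
  Step functions over one finite partition form a finite-dimensional space. On the cells of positive
  measure their values are bounded in terms of the \<open>L\<^sup>p\<close> bound, so rounding the values to multiples
  of \<open>\<theta>\<close> leaves finitely many codes, and members of \<open>S\<close> with the same code are close to each other.
  Choosing one member per code yields the finite net inside \<open>S\<close>.
\<close>

lemma totally_bounded_by_step_functions:
  assumes p: "0 < p" and R: "0 \<le> R"
    and S: "\<And>u. u \<in> S \<Longrightarrow> u \<in> borel_measurable M"
      "\<And>u. u \<in> S \<Longrightarrow> (\<integral>\<^sup>+x. ennreal (\<bar>u x\<bar> powr p) \<partial>M) \<le> ennreal R"
    and fin: "emeasure M (space M) < \<infinity>"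
    and approx: "\<And>\<eta>::real. 0 < \<eta> \<Longrightarrow> \<exists>A n. (\<forall>i. A i \<in> sets M) \<and> disjoint_family A \<and> space M = (\<Union>i<n. A i) \<and>
        (\<forall>u\<in>S. \<exists>a. (\<integral>\<^sup>+x. ennreal (\<bar>u x - step_function A n a x\<bar> powr p) \<partial>M) \<le> ennreal \<eta>)"
  shows "qm_totally_bounded S (\<lambda>u v. enn2real (Lp_norm M p (\<lambda>x. u x - v x)))"
  unfolding qm_totally_bounded_def
proof (intro allI impI)
  fix \<epsilon> :: real assume e: "0 < \<epsilon>"
  define m where "m = measure M (space M)"
  have m: "emeasure M (space M) = ennreal m" "0 \<le> m"
    using fin unfolding m_def by (auto simp: emeasure_eq_ennreal_measure less_top)
  define c where "c = (3::real) powr p"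
  have c: "c > 0" by (simp add: c_def)
  \<comment> \<open>the two approximation errors and the rounding error must sum up to less than \<open>\<epsilon>\<^sup>p / c\<close>\<close>
  define \<eta> where "\<eta> = \<epsilon> powr p / (4 * c)"
  have \<eta>: "\<eta> > 0" using e c by (simp add: \<eta>_def)
  define \<theta> where "\<theta> = (\<eta> / (m + 1)) powr (1 / p)"
  have \<theta>: "\<theta> > 0" "\<theta> powr p = \<eta> / (m + 1)" using \<eta> m p by (auto simp: \<theta>_def powr_powr)
  have total: "c * (\<eta> + \<theta> powr p * m + \<eta>) < \<epsilon> powr p"
  proof -
    have "\<theta> powr p * m < \<eta>" unfolding \<theta>(2) using m(2) \<eta> by (simp add: field_simps)
    then have "c * (\<eta> + \<theta> powr p * m + \<eta>) < c * (4 * \<eta>)" using c \<eta> by (intro mult_strict_left_mono) auto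
    then show ?thesis using c by (simp add: \<eta>_def)
  qed
  obtain A n where A: "\<And>i. A i \<in> sets M" "disjoint_family A" "space M = (\<Union>i<n. A i)"
    and ex: "\<forall>u\<in>S. \<exists>a. (\<integral>\<^sup>+x. ennreal (\<bar>u x - step_function A n a x\<bar> powr p) \<partial>M) \<le> ennreal \<eta>"
    using approx[OF \<eta>] by metis
  note [measurable] = A(1)
  have [measurable]: "step_function A n a \<in> borel_measurable M" for a
    unfolding step_function_def[abs_def] by measurable
  obtain a where a: "\<And>u. u \<in> S \<Longrightarrow> (\<integral>\<^sup>+x. ennreal (\<bar>u x - step_function A n (a u) x\<bar> powr p) \<partial>M) \<le> ennreal \<eta>"
    using bchoice[OF ex] by blast
  define \<mu> where "\<mu> i = measure M (A i)" for i
  have fA: "emeasure M (A i) = ennreal (\<mu> i)" for i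
  proof -
    have "emeasure M (A i) \<le> emeasure M (space M)" by (rule emeasure_space)
    then have "emeasure M (A i) \<noteq> top" using fin by (metis infinity_ennreal_def leD)
    then show ?thesis by (simp add: \<mu>_def emeasure_eq_ennreal_measure)
  qed
  \<comment> \<open>values on null cells are neither bounded nor relevant, so only the cells in \<open>J\<close> are coded\<close>
  define J where "J = {i. i < n \<and> 0 < \<mu> i}"
  define B where "B i = (2 powr p * (R + \<eta>) / \<mu> i) powr (1 / p)" for i
  have bound: "\<bar>a u i\<bar> \<le> B i" if u: "u \<in> S" and i: "i \<in> J" for u i
  proof -
    note [measurable] = S(1)[OF u]
    let ?v = "step_function A n (a u)"
    have i': "i < n" "0 < \<mu> i" using i by (auto simp: J_def)
    have "ennreal (\<bar>a u i\<bar> powr p * \<mu> i) = (\<integral>\<^sup>+x. ennreal (\<bar>a u i\<bar> powr p) * indicator (A i) x \<partial>M)"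
      using i' by (simp add: nn_integral_cmult_indicator fA ennreal_mult)
    also have "\<dots> \<le> (\<integral>\<^sup>+x. ennreal (2 powr p) * (ennreal (\<bar>u x\<bar> powr p) + ennreal (\<bar>u x - ?v x\<bar> powr p)) \<partial>M)"
    proof (rule nn_integral_mono)
      fix x
      show "ennreal (\<bar>a u i\<bar> powr p) * indicator (A i) x
          \<le> ennreal (2 powr p) * (ennreal (\<bar>u x\<bar> powr p) + ennreal (\<bar>u x - ?v x\<bar> powr p))"
      proof (cases "x \<in> A i")
        case True
        then have v: "?v x = a u i" using step_function_eq[OF A(2) i'(1)] by blast
        have "\<bar>a u i\<bar> powr p \<le> 2 powr p * (\<bar>u x\<bar> powr p + \<bar>u x - ?v x\<bar> powr p)"
          using powr_sum2_le[OF p, of "u x" "a u i - u x"] unfolding v by (simp add: abs_minus_commute)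
        then show ?thesis using True
          by (simp add: ennreal_mult[symmetric] ennreal_plus[symmetric] del: ennreal_plus)
      qed simp
    qed
    also have "\<dots> = ennreal (2 powr p) * ((\<integral>\<^sup>+x. ennreal (\<bar>u x\<bar> powr p) \<partial>M) + (\<integral>\<^sup>+x. ennreal (\<bar>u x - ?v x\<bar> powr p) \<partial>M))"
      by (subst nn_integral_cmult, simp, subst nn_integral_add) auto
    also have "\<dots> \<le> ennreal (2 powr p) * (ennreal R + ennreal \<eta>)"
      by (intro mult_left_mono add_mono S(2)[OF u] a[OF u]) auto
    also have "\<dots> = ennreal (2 powr p * (R + \<eta>))" using R \<eta> by (simp add: ennreal_mult)
    finally have "\<bar>a u i\<bar> powr p * \<mu> i \<le> 2 powr p * (R + \<eta>)" using R \<eta> by (simp add: ennreal_le_iff)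
    then have "\<bar>a u i\<bar> powr p \<le> 2 powr p * (R + \<eta>) / \<mu> i" using i' by (simp add: field_simps)
    then have "(\<bar>a u i\<bar> powr p) powr (1 / p) \<le> B i" unfolding B_def using p by (intro powr_mono2) auto
    then show ?thesis using p by (simp add: powr_powr)
  qed
  define code where "code u = restrict (\<lambda>i. \<lfloor>a u i / \<theta>\<rfloor>) J" for u
  have "code ` S \<subseteq> (\<Pi>\<^sub>E i\<in>J. {\<lfloor>- B i / \<theta>\<rfloor>..\<lfloor>B i / \<theta>\<rfloor>})"
  proof
    fix f assume "f \<in> code ` S"
    then obtain u where u: "u \<in> S" "f = code u" by blast
    have "\<lfloor>a u i / \<theta>\<rfloor> \<in> {\<lfloor>- B i / \<theta>\<rfloor>..\<lfloor>B i / \<theta>\<rfloor>}" if i: "i \<in> J" for i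
    proof -
      have "- B i / \<theta> \<le> a u i / \<theta>" "a u i / \<theta> \<le> B i / \<theta>"
        using bound[OF u(1) i] \<theta>(1) by (intro divide_right_mono; linarith)+
      then show ?thesis by (simp add: floor_mono)
    qed
    then show "f \<in> (\<Pi>\<^sub>E i\<in>J. {\<lfloor>- B i / \<theta>\<rfloor>..\<lfloor>B i / \<theta>\<rfloor>})"
      unfolding u(2) code_def by (auto simp del: atLeastAtMost_iff)
  qed
  then have "finite (code ` S)" by (rule finite_subset) (auto intro!: finite_PiE simp: J_def)
  then obtain F where F: "F \<subseteq> S" "finite F" "code ` S = code ` F"
    using finite_subset_image[of "code ` S" code S] by auto
  have close: "enn2real (Lp_norm M p (\<lambda>x. w x - u x)) < \<epsilon>"
    if u: "u \<in> S" and w: "w \<in> S" and cw: "code w = code u" for u w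
  proof -
    note [measurable] = S(1)[OF u] S(1)[OF w]
    let ?v = "step_function A n (a u)" and ?y = "step_function A n (a w)"
    have near: "\<bar>a w i - a u i\<bar> \<le> \<theta>" if i: "i \<in> J" for i
    proof -
      have "\<lfloor>a w i / \<theta>\<rfloor> = \<lfloor>a u i / \<theta>\<rfloor>" using fun_cong[OF cw, of i] i by (simp add: code_def)
      then have "\<bar>a w i / \<theta> - a u i / \<theta>\<bar> < 1" by linarith
      then show ?thesis using \<theta>(1) by (simp add: diff_divide_distrib[symmetric] abs_divide)
    qed
    have "AE x in M. \<forall>i<n. i \<notin> J \<longrightarrow> x \<notin> A i"
    proof -
      have "AE x in M. x \<notin> A i" if "i < n" "i \<notin> J" for i
      proof (rule AE_not_in)
        have "\<mu> i = 0" using that measure_nonneg[of M "A i"] unfolding J_def \<mu>_def mem_Collect_eq by linarith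
        then show "A i \<in> null_sets M" using fA[of i] by auto
      qed
      then have "AE x in M. i \<notin> J \<longrightarrow> x \<notin> A i" if "i < n" for i using that by (cases "i \<in> J") auto
      then have "AE x in M. \<forall>i\<in>{..<n}. i \<notin> J \<longrightarrow> x \<notin> A i" by (subst AE_finite_all) auto
      then show ?thesis by (simp add: lessThan_iff Ball_def)
    qed
    then have "AE x in M. ennreal (\<bar>w x - u x\<bar> powr p) \<le>
        ennreal c * (ennreal (\<bar>w x - ?y x\<bar> powr p) + ennreal (\<theta> powr p) + ennreal (\<bar>u x - ?v x\<bar> powr p))"
      using AE_space
    proof eventually_elim
      case (elim x)
      then obtain i where i: "i < n" "x \<in> A i" using A(3) by blast
      then have "i \<in> J" using elim by blast
      then have "\<bar>?y x - ?v x\<bar> \<le> \<theta>" using near step_function_eq[OF A(2) i] by simp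
      then have t: "\<bar>?y x - ?v x\<bar> powr p \<le> \<theta> powr p" using p by (intro powr_mono2) auto
      have "\<bar>w x - u x\<bar> powr p \<le> c * (\<bar>w x - ?y x\<bar> powr p + \<bar>?y x - ?v x\<bar> powr p + \<bar>u x - ?v x\<bar> powr p)"
        using powr_sum3_le[OF p, of "w x - ?y x" "?y x - ?v x" "?v x - u x"] unfolding c_def
        by (simp add: abs_minus_commute)
      also have "\<dots> \<le> c * (\<bar>w x - ?y x\<bar> powr p + \<theta> powr p + \<bar>u x - ?v x\<bar> powr p)"
        using t c by (intro mult_left_mono) auto
      finally show ?case
        using c by (simp add: ennreal_mult[symmetric] ennreal_plus[symmetric] del: ennreal_plus)
    qed
    then have "(\<integral>\<^sup>+x. ennreal (\<bar>w x - u x\<bar> powr p) \<partial>M) \<le>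
        (\<integral>\<^sup>+x. ennreal c * (ennreal (\<bar>w x - ?y x\<bar> powr p) + ennreal (\<theta> powr p) + ennreal (\<bar>u x - ?v x\<bar> powr p)) \<partial>M)"
      by (rule nn_integral_mono_AE)
    also have "\<dots> = ennreal c * ((\<integral>\<^sup>+x. ennreal (\<bar>w x - ?y x\<bar> powr p) \<partial>M) + ennreal (\<theta> powr p) * ennreal m
        + (\<integral>\<^sup>+x. ennreal (\<bar>u x - ?v x\<bar> powr p) \<partial>M))"
      by (subst nn_integral_cmult, simp, subst nn_integral_add, simp, simp, subst nn_integral_add) (auto simp: m(1))
    also have "\<dots> \<le> ennreal c * (ennreal \<eta> + ennreal (\<theta> powr p) * ennreal m + ennreal \<eta>)"
      by (intro mult_left_mono add_mono a u w) auto
    also have "\<dots> = ennreal (c * (\<eta> + \<theta> powr p * m + \<eta>))"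
    proof -
      have nn: "0 \<le> c" "0 \<le> \<eta>" "0 \<le> \<theta> powr p" "0 \<le> \<theta> powr p * m" "0 \<le> \<eta> + \<theta> powr p * m"
        using c \<eta> m by auto
      show ?thesis by (simp only: ennreal_mult'[OF nn(1)] ennreal_mult'[OF nn(3)] ennreal_plus nn)
    qed
    finally have le: "(\<integral>\<^sup>+x. ennreal (\<bar>w x - u x\<bar> powr p) \<partial>M) \<le> ennreal (c * (\<eta> + \<theta> powr p * m + \<eta>))" .
    let ?t = "c * (\<eta> + \<theta> powr p * m + \<eta>)"
    have t0: "0 \<le> ?t" using c \<eta> m by simp
    have "Lp_norm M p (\<lambda>x. w x - u x) \<le> ennreal (?t powr (1 / p))"
      by (subst Lp_norm_le_iff[OF p]) (use le p t0 in \<open>auto simp: powr_powr\<close>)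
    then have "enn2real (Lp_norm M p (\<lambda>x. w x - u x)) \<le> ?t powr (1 / p)"
      by (intro enn2real_leI) auto
    also have "\<dots> < (\<epsilon> powr p) powr (1 / p)" using total t0 p by (intro powr_less_mono2) auto
    also have "\<dots> = \<epsilon>" using p e by (simp add: powr_powr)
    finally show ?thesis .
  qed
  have "S \<subseteq> (\<Union>w\<in>F. qball S (\<lambda>u v. enn2real (Lp_norm M p (\<lambda>x. u x - v x))) w \<epsilon>)"
  proof
    fix u assume u: "u \<in> S"
    then obtain w where w: "w \<in> F" "code u = code w" using F(3) by (metis image_iff)
    then have "u \<in> qball S (\<lambda>u v. enn2real (Lp_norm M p (\<lambda>x. u x - v x))) w \<epsilon>"
      using close[OF u, of w] u F(1) by (auto simp: qball_def)
    then show "u \<in> (\<Union>w\<in>F. qball S (\<lambda>u v. enn2real (Lp_norm M p (\<lambda>x. u x - v x))) w \<epsilon>)" using w(1) by blast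
  qed
  then show "\<exists>F. finite F \<and> F \<subseteq> S \<and> S \<subseteq> (\<Union>w\<in>F. qball S (\<lambda>u v. enn2real (Lp_norm M p (\<lambda>x. u x - v x))) w \<epsilon>)"
    using F by blast
qed



lemma dyadic_scale:
  fixes K :: int and t :: real
  assumes "0 < t" "t < 2 powi (- K)"
  obtains n :: nat where "2 powi (- (K + int n) - 1) \<le> t" "t < 2 powi (- (K + int n))"
proof -
  have pw: "2 powi j = (2::real) powr real_of_int j" for j :: int by (simp add: powr_real_of_int')
  define k where "k = \<lceil>- log 2 t\<rceil> - 1"
  have t: "t = 2 powr (log 2 t)" using assms by simp
  have "2 powr (log 2 t) < 2 powr real_of_int (- K)" using assms unfolding pw t[symmetric] by simp
  then have "log 2 t < - real_of_int K" by simp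
  then have "K \<le> k" unfolding k_def by linarith
  moreover have "2 powi (- k - 1) \<le> t"
  proof -
    have "real_of_int (- k - 1) \<le> log 2 t" unfolding k_def by linarith
    then have "2 powr real_of_int (- k - 1) \<le> 2 powr (log 2 t)" by (intro powr_mono) auto
    then show ?thesis unfolding pw t[symmetric] .
  qed
  moreover have "t < 2 powi (- k)"
  proof -
    have "log 2 t < real_of_int (- k)" unfolding k_def by linarith
    then have "2 powr (log 2 t) < 2 powr real_of_int (- k)" by (intro powr_less_mono) auto
    then show ?thesis unfolding pw t[symmetric] .
  qed
  ultimately show thesis using that[of "nat (k - K)"] by simp
qed

text \<open>
  \<open>H\<close> is the sum of the functions \<open>2\<^sup>p 2\<^sup>-\<^sup>k\<^sup>\<alpha>\<^sup>p g\<^sub>k\<^sup>p\<close> over \<open>k \<ge> K\<close>. For two points at distance less than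
  \<open>2\<^sup>-\<^sup>K\<close> one of the annuli of index \<open>k \<ge> K\<close> contains their distance, and the corresponding summand
  already dominates the oscillation; the integral of \<open>H\<close> is a geometric series of order \<open>2\<^sup>-\<^sup>K\<^sup>\<alpha>\<^sup>p\<close>.
\<close>

lemma gradient_small_scale_control:
  assumes p: "0 < p" and a: "0 < \<alpha>" and R: "0 \<le> R"
    and qm: "quasi_metric (space M) d"
    and g: "g \<in> frac_gradients M d \<alpha> u" "\<And>k. Lp_norm M p (g k) \<le> ennreal R"
  obtains H E where "H \<in> borel_measurable M" "E \<in> null_sets M"
    "(\<integral>\<^sup>+x. H x \<partial>M) \<le> ennreal (2 powr p * R powr p / (1 - 2 powr (- \<alpha> * p)) * 2 powr (- \<alpha> * p * K))"
    "\<And>x y. x \<in> space M - E \<Longrightarrow> y \<in> space M - E \<Longrightarrow> d x y < 2 powi (- int K) \<Longrightarrow>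
       ennreal (\<bar>u x - u y\<bar> powr p) \<le> H x + H y"
proof -
  define b where "b n = 2 powr (- \<alpha> * p * real (K + n))" for n :: nat
  have b0: "0 \<le> b n" for n by (simp add: b_def)
  define h where "h n x = 2 powr p * b n * \<bar>g (int (K + n)) x\<bar> powr p" for n x
  have h0: "0 \<le> h n x" for n x using b0 by (simp add: h_def)
  define H where "H x = (\<Sum>n. ennreal (h n x))" for x
  have gm[measurable]: "g k \<in> borel_measurable M" for k using g(1) unfolding frac_gradients_def by auto
  have [measurable]: "h n \<in> borel_measurable M" for n unfolding h_def by measurable
  obtain E where E: "E \<in> null_sets M" and osc: "\<forall>k. \<forall>x\<in>space M - E. \<forall>y\<in>space M - E.
            2 powi (- k - 1) \<le> d x y \<and> d x y < 2 powi (- k) \<longrightarrow>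
            \<bar>u x - u y\<bar> \<le> d x y powr \<alpha> * (g k x + g k y)"
    using g(1) unfolding frac_gradients_def by blast
  have q: "0 < 2 powr (- \<alpha> * p)" "2 powr (- \<alpha> * p) < 1" using a p by (auto simp: powr_less_one)
  have b_eq: "b n = 2 powr (- \<alpha> * p * K) * (2 powr (- \<alpha> * p)) ^ n" for n
    by (simp add: b_def powr_realpow[symmetric] powr_powr powr_add[symmetric] algebra_simps)
  have b_sums: "(\<lambda>n. 2 powr p * b n * R powr p) sums
      (2 powr p * R powr p / (1 - 2 powr (- \<alpha> * p)) * 2 powr (- \<alpha> * p * K))"
  proof -
    have "(\<lambda>n. (2 powr (- \<alpha> * p)) ^ n) sums (1 / (1 - 2 powr (- \<alpha> * p)))" using q by (intro geometric_sums) auto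
    from sums_mult[OF this, of "2 powr p * R powr p * 2 powr (- \<alpha> * p * K)"]
    show ?thesis unfolding b_eq by (simp add: mult_ac)
  qed
  show thesis
  proof
    show "H \<in> borel_measurable M" unfolding H_def[abs_def] by measurable
    show "E \<in> null_sets M" by fact
    have "(\<integral>\<^sup>+x. H x \<partial>M) = (\<Sum>n. \<integral>\<^sup>+x. ennreal (h n x) \<partial>M)"
      unfolding H_def by (rule nn_integral_suminf) measurable
    also have "\<dots> \<le> (\<Sum>n. ennreal (2 powr p * b n * R powr p))"
    proof (intro suminf_le summableI)
      fix n
      have "(\<integral>\<^sup>+x. ennreal (h n x) \<partial>M) = ennreal (2 powr p * b n) * (\<integral>\<^sup>+x. ennreal (\<bar>g (int (K + n)) x\<bar> powr p) \<partial>M)"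
        unfolding h_def using b0 by (subst nn_integral_cmult[symmetric]) (auto simp: ennreal_mult)
      also have "\<dots> \<le> ennreal (2 powr p * b n) * ennreal (R powr p)"
        using g(2) R p by (intro mult_left_mono) (auto simp: Lp_norm_le_iff)
      also have "\<dots> = ennreal (2 powr p * b n * R powr p)" using b0 by (simp add: ennreal_mult)
      finally show "(\<integral>\<^sup>+x. ennreal (h n x) \<partial>M) \<le> ennreal (2 powr p * b n * R powr p)" .
    qed
    also have "\<dots> = ennreal (2 powr p * R powr p / (1 - 2 powr (- \<alpha> * p)) * 2 powr (- \<alpha> * p * K))"
      using b_sums b0 by (intro suminf_ennreal_eq) auto
    finally show "(\<integral>\<^sup>+x. H x \<partial>M) \<le> ennreal (2 powr p * R powr p / (1 - 2 powr (- \<alpha> * p)) * 2 powr (- \<alpha> * p * K))" .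
  next
    fix x y assume x: "x \<in> space M - E" and y: "y \<in> space M - E" and dxy: "d x y < 2 powi (- int K)"
    show "ennreal (\<bar>u x - u y\<bar> powr p) \<le> H x + H y"
    proof (cases "x = y")
      case True
      then show ?thesis using p by simp
    next
      case False
      then have "0 < d x y" using quasi_metricD[OF qm, of x y] x y by auto
      then obtain n :: nat where n: "2 powi (- (int K + int n) - 1) \<le> d x y" "d x y < 2 powi (- (int K + int n))"
        using dyadic_scale[OF _ dxy] by blast
      let ?k = "int (K + n)"
      have "\<bar>u x - u y\<bar> \<le> d x y powr \<alpha> * (g ?k x + g ?k y)"
        using osc x y n by simp
      also have "\<dots> \<le> d x y powr \<alpha> * \<bar>g ?k x + g ?k y\<bar>" by (intro mult_left_mono) auto
      also have "\<dots> \<le> (2 powi (- ?k)) powr \<alpha> * \<bar>g ?k x + g ?k y\<bar>"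
        using n \<open>0 < d x y\<close> a by (intro mult_right_mono powr_mono2) auto
      finally have "\<bar>u x - u y\<bar> powr p \<le> ((2 powi (- ?k)) powr \<alpha> * \<bar>g ?k x + g ?k y\<bar>) powr p"
        using p by (intro powr_mono2) auto
      also have "\<dots> = b n * \<bar>g ?k x + g ?k y\<bar> powr p"
      proof -
        have "2 powi (- ?k) = (2::real) powr (- real (K + n))" by (simp add: powr_real_of_int'[symmetric])
        then have "((2 powi (- ?k)) powr \<alpha>) powr p = b n" by (simp add: b_def powr_powr algebra_simps)
        then show ?thesis by (simp add: powr_mult)
      qed
      also have "\<dots> \<le> b n * (2 powr p * (\<bar>g ?k x\<bar> powr p + \<bar>g ?k y\<bar> powr p))"
        by (intro mult_left_mono powr_sum2_le p b0)
      also have "\<dots> = h n x + h n y" by (simp add: h_def algebra_simps)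
      finally have "ennreal (\<bar>u x - u y\<bar> powr p) \<le> ennreal (h n x) + ennreal (h n y)"
        using h0 by (simp add: ennreal_plus[symmetric] del: ennreal_plus)
      also have "\<dots> \<le> H x + H y"
      proof (rule add_mono)
        have "ennreal (h n z) \<le> H z" for z
          unfolding H_def using sum_le_suminf[OF summableI, of "{n}" "\<lambda>n. ennreal (h n z)"] by simp
        then show "ennreal (h n x) \<le> H x" "ennreal (h n y) \<le> H y" by auto
      qed
      finally show ?thesis .
    qed
  qed
qed

lemma totally_bounded_small_cells:
  assumes qm: "quasi_metric (space M) d" and tb: "qm_totally_bounded (space M) d" and "0 < r"
    and ball: "\<And>x r. x \<in> space M \<Longrightarrow> 0 < r \<Longrightarrow> qball (space M) d x r \<in> sets M"
  obtains A and n :: nat where "\<And>i. A i \<in> sets M" "disjoint_family A" "space M = (\<Union>i<n. A i)"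
    "\<And>i x y. x \<in> A i \<Longrightarrow> y \<in> A i \<Longrightarrow> d x y < r"
proof -
  obtain C where C: "1 \<le> C" "\<And>x y. x \<in> space M \<Longrightarrow> y \<in> space M \<Longrightarrow> d y x \<le> C * d x y"
    using quasi_symmetric[OF qm] by blast
  let ?K = "qm_const (space M) d"
  have K: "1 \<le> ?K" by (rule qm_const_ge_1[OF qm])
  define t where "t = r / (?K * C)"
  have KC: "?K * C > 0" using K C(1) by simp
  have t: "t > 0" "?K * (C * t) = r" using KC \<open>0 < r\<close> K C(1) by (auto simp: t_def)
  obtain F where F: "finite F" "F \<subseteq> space M" "space M \<subseteq> (\<Union>x\<in>F. qball (space M) d x t)"
    using tb t unfolding qm_totally_bounded_def by meson
  obtain f where f: "bij_betw f {0..<card F} F" using ex_bij_betw_nat_finite[OF F(1)] by blast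
  define n where "n = card F"
  have fF: "f ` {0..<n} = F" using f unfolding n_def bij_betw_def by blast
  define B where "B i = (if i < n then qball (space M) d (f i) t else {})" for i
  have fm: "f i \<in> space M" if "i < n" for i using F(2) fF that by force
  have small: "d x y < r" if xy: "x \<in> B i" "y \<in> B i" for i x y
  proof -
    have i: "i < n" "x \<in> space M" "y \<in> space M" "d (f i) x < t" "d (f i) y < t"
      using xy by (auto simp: B_def qball_def split: if_splits)
    have "d x (f i) \<le> C * d (f i) x" using C(2) fm i by blast
    also have "\<dots> < C * t" using C(1) i by simp
    finally have "d x (f i) < C * t" .
    moreover have "d (f i) y < C * t" using i(5) C(1) t(1) mult_right_mono[of 1 C t] by linarith
    ultimately have "?K * max (d x (f i)) (d (f i) y) < ?K * (C * t)" using K by (intro mult_strict_left_mono) auto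
    then show ?thesis using qm_const_bound[OF qm i(2,3) fm[OF i(1)]] t by simp
  qed
  show thesis
  proof
    show "disjointed B i \<in> sets M" for i
      using sets.range_disjointed_sets[of B M] ball[OF fm t(1)] by (auto simp: B_def)
    show "disjoint_family (disjointed B)" by (rule disjoint_family_disjointed)
    show "space M = (\<Union>i<n. disjointed B i)"
    proof -
      have "(\<Union>i<n. disjointed B i) = (\<Union>i<n. B i)"
        using finite_UN_disjointed_eq[of B n] by (simp add: atLeast0LessThan)
      also have "\<dots> = (\<Union>x\<in>F. qball (space M) d x t)" unfolding fF[symmetric] by (auto simp: B_def)
      also have "\<dots> = space M" using F(3) by (auto simp: qball_def)
      finally show ?thesis ..
    qed
    show "d x y < r" if "x \<in> disjointed B i" "y \<in> disjointed B i" for i x y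
      using small that disjointed_subset[of B i] by blast
  qed
qed

lemma step_approximation:
  assumes p: "0 < p" and A: "\<And>i. A i \<in> sets M" "disjoint_family A" "space M = (\<Union>i<n. A i)"
    and fin: "emeasure M (space M) < \<infinity>" and u[measurable]: "u \<in> borel_measurable M"
    and E: "E \<in> null_sets M" and H[measurable]: "H \<in> borel_measurable M"
    and osc: "\<And>i x y. x \<in> A i - E \<Longrightarrow> y \<in> A i - E \<Longrightarrow> ennreal (\<bar>u x - u y\<bar> powr p) \<le> H x + H y"
  obtains a where "(\<integral>\<^sup>+x. ennreal (\<bar>u x - step_function A n a x\<bar> powr p) \<partial>M) \<le> 2 * (\<integral>\<^sup>+x. H x \<partial>M)"
proof -
  note [measurable] = A(1)
  have "\<forall>i. \<exists>a. (\<integral>\<^sup>+x. ennreal (\<bar>u x - a\<bar> powr p) * indicator (A i) x \<partial>M)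
      \<le> 2 * (\<integral>\<^sup>+x. H x * indicator (A i) x \<partial>M)"
  proof
    fix i
    have "emeasure M (A i) < \<infinity>" using emeasure_space[of M "A i"] fin by (rule le_less_trans)
    then show "\<exists>a. (\<integral>\<^sup>+x. ennreal (\<bar>u x - a\<bar> powr p) * indicator (A i) x \<partial>M)
        \<le> 2 * (\<integral>\<^sup>+x. H x * indicator (A i) x \<partial>M)"
      by (rule oscillation_on_cell[OF A(1) _ E H osc[where i = i]]) (assumption, assumption, rule exI)
  qed
  from choice[OF this] obtain a where a: "\<And>i. (\<integral>\<^sup>+x. ennreal (\<bar>u x - a i\<bar> powr p) * indicator (A i) x \<partial>M)
      \<le> 2 * (\<integral>\<^sup>+x. H x * indicator (A i) x \<partial>M)" by blast
  have ind: "(\<Sum>i<n. f i * indicator (A i) x) = f i" if "i < n" "x \<in> A i" for f :: "nat \<Rightarrow> ennreal" and i x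
  proof -
    have "(\<Sum>j<n. f j * indicator (A j) x) = (\<Sum>j<n. if j = i then f i else 0)"
      by (rule sum.cong) (use that A(2) in \<open>auto simp: disjoint_family_on_def indicator_def\<close>)
    then show ?thesis using that by simp
  qed
  have "(\<integral>\<^sup>+x. ennreal (\<bar>u x - step_function A n a x\<bar> powr p) \<partial>M)
      = (\<integral>\<^sup>+x. (\<Sum>i<n. ennreal (\<bar>u x - a i\<bar> powr p) * indicator (A i) x) \<partial>M)"
  proof (rule nn_integral_cong)
    fix x assume "x \<in> space M"
    then obtain i where i: "i < n" "x \<in> A i" using A(3) by blast
    show "ennreal (\<bar>u x - step_function A n a x\<bar> powr p) = (\<Sum>i<n. ennreal (\<bar>u x - a i\<bar> powr p) * indicator (A i) x)"
      using ind[OF i] step_function_eq[OF A(2) i] by simp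
  qed
  also have "\<dots> = (\<Sum>i<n. \<integral>\<^sup>+x. ennreal (\<bar>u x - a i\<bar> powr p) * indicator (A i) x \<partial>M)"
    by (rule nn_integral_sum) measurable
  also have "\<dots> \<le> (\<Sum>i<n. 2 * (\<integral>\<^sup>+x. H x * indicator (A i) x \<partial>M))" by (rule sum_mono[OF a])
  also have "\<dots> = 2 * (\<integral>\<^sup>+x. (\<Sum>i<n. H x * indicator (A i) x) \<partial>M)"
    by (subst nn_integral_sum) (auto simp: sum_distrib_left)
  also have "(\<integral>\<^sup>+x. (\<Sum>i<n. H x * indicator (A i) x) \<partial>M) = (\<integral>\<^sup>+x. H x \<partial>M)"
  proof (rule nn_integral_cong)
    fix x assume "x \<in> space M"
    then obtain i where "i < n" "x \<in> A i" using A(3) by blast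
    then show "(\<Sum>i<n. H x * indicator (A i) x) = H x" by (rule ind)
  qed
  finally show thesis by (rule that)
qed

text \<open>
  The weakest of all norms in question, with \<open>sup\<^sub>k \<parallel>g\<^sub>k\<parallel>\<^sub>p\<close> as gradient part, suffices for compactness.
\<close>

lemma totally_bounded_imp_gradient_bounded_compact:
  assumes M: "quasi_metric_measure_space M d" and tb: "qm_totally_bounded (space M) d"
    and p: "0 < p" and a: "0 < \<alpha>" and R: "0 \<le> R"
    and S: "S \<subseteq> Lp_space M p" "\<And>u. u \<in> S \<Longrightarrow> Lp_norm M p u \<le> ennreal R"
    and g: "\<And>u. u \<in> S \<Longrightarrow> \<exists>g\<in>frac_gradients M d \<alpha> u. \<forall>k. Lp_norm M p (g k) \<le> ennreal R"
  shows "qm_totally_bounded S (\<lambda>u v. enn2real (Lp_norm M p (\<lambda>x. u x - v x)))"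
proof (rule totally_bounded_by_step_functions[OF p])
  note qm = qmm_space(1)[OF M]
  show fin: "emeasure M (space M) < \<infinity>" by (rule totally_bounded_imp_finite_measure[OF M tb])
  show Sm: "u \<in> borel_measurable M" if "u \<in> S" for u using S(1) that unfolding Lp_space_def by blast
  show "(\<integral>\<^sup>+x. ennreal (\<bar>u x\<bar> powr p) \<partial>M) \<le> ennreal (R powr p)" if "u \<in> S" for u
    using S(2)[OF that] Lp_norm_le_iff[OF p R] by blast
  show "0 \<le> R powr p" by simp
  fix \<eta> :: real assume \<eta>: "0 < \<eta>"
  let ?c = "2 powr p * R powr p / (1 - 2 powr (- \<alpha> * p))"
  have "(\<lambda>K::nat. 2 * (?c * 2 powr (- \<alpha> * p * K))) \<longlonglongrightarrow> 2 * (?c * 0)"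
  proof (intro tendsto_mult tendsto_const)
    have "(\<lambda>K::nat. (2 powr (- \<alpha> * p)) ^ K) \<longlonglongrightarrow> 0"
      using a p by (intro LIMSEQ_power_zero) (auto simp: powr_less_one)
    then show "(\<lambda>K::nat. 2 powr (- \<alpha> * p * real K)) \<longlonglongrightarrow> 0" by (simp add: powr_realpow[symmetric] powr_powr)
  qed
  then have "eventually (\<lambda>K::nat. 2 * (?c * 2 powr (- \<alpha> * p * K)) < \<eta>) sequentially"
    using \<eta> by (intro order_tendstoD(2)) auto
  then obtain K :: nat where K: "2 * (?c * 2 powr (- \<alpha> * p * K)) < \<eta>" by (auto simp: eventually_sequentially)
  obtain A and n :: nat where A: "\<And>i. A i \<in> sets M" "disjoint_family A" "space M = (\<Union>i<n. A i)"
    "\<And>i x y. x \<in> A i \<Longrightarrow> y \<in> A i \<Longrightarrow> d x y < 2 powi (- int K)"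
    using totally_bounded_small_cells[OF qm tb, of "2 powi (- int K)"] qmm_space(3)[OF M] by (metis zero_less_power_int zero_less_numeral)
  have "\<exists>b. (\<integral>\<^sup>+x. ennreal (\<bar>u x - step_function A n b x\<bar> powr p) \<partial>M) \<le> ennreal \<eta>" if u: "u \<in> S" for u
  proof -
    obtain g where g: "g \<in> frac_gradients M d \<alpha> u" "\<And>k. Lp_norm M p (g k) \<le> ennreal R" using g[OF u] by blast
    obtain H E where H: "H \<in> borel_measurable M" "E \<in> null_sets M"
      "(\<integral>\<^sup>+x. H x \<partial>M) \<le> ennreal (?c * 2 powr (- \<alpha> * p * K))"
      "\<And>x y. x \<in> space M - E \<Longrightarrow> y \<in> space M - E \<Longrightarrow> d x y < 2 powi (- int K) \<Longrightarrow>
         ennreal (\<bar>u x - u y\<bar> powr p) \<le> H x + H y"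
      using gradient_small_scale_control[OF p a R qm g, of K] by blast
    have Asp: "A i \<subseteq> space M" for i using A(1) sets.sets_into_space by blast
    obtain b where "(\<integral>\<^sup>+x. ennreal (\<bar>u x - step_function A n b x\<bar> powr p) \<partial>M) \<le> 2 * (\<integral>\<^sup>+x. H x \<partial>M)"
    proof (rule step_approximation[OF p A(1-3) fin Sm[OF u] H(2,1)])
      show "ennreal (\<bar>u x - u y\<bar> powr p) \<le> H x + H y" if "x \<in> A i - E" "y \<in> A i - E" for i x y
        using H(4)[of x y] A(4)[of x i y] that Asp[of i] by blast
    qed
    also have "2 * (\<integral>\<^sup>+x. H x \<partial>M) \<le> 2 * ennreal (?c * 2 powr (- \<alpha> * p * K))" by (intro mult_left_mono H(3)) auto
    also have "\<dots> = ennreal (2 * (?c * 2 powr (- \<alpha> * p * K)))"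
      using ennreal_mult'[of 2 "?c * 2 powr (- \<alpha> * p * K)"] by (simp only: ennreal_numeral)
    also have "\<dots> \<le> ennreal \<eta>" using K by (intro ennreal_leI) simp
    finally show ?thesis by blast
  qed
  then show "\<exists>A n. (\<forall>i. A i \<in> sets M) \<and> disjoint_family A \<and> space M = (\<Union>i<n. A i) \<and>
        (\<forall>u\<in>S. \<exists>b. (\<integral>\<^sup>+x. ennreal (\<bar>u x - step_function A n b x\<bar> powr p) \<partial>M) \<le> ennreal \<eta>)"
    using A(1-3) by blast
qed

lemma HB_norm_witness:
  assumes "HB_norm M d \<alpha> p q u \<le> ennreal R" "0 < q" "0 \<le> R"
  obtains g where "g \<in> frac_gradients M d \<alpha> u" "\<And>k. Lp_norm M p (g k) \<le> ennreal (R + 1)"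
proof -
  let ?I = "INF g\<in>frac_gradients M d \<alpha> u. lq_enorm q (\<lambda>k. Lp_norm M p (g k))"
  have "?I \<le> HB_norm M d \<alpha> p q u" unfolding HB_norm_def by simp
  also note assms(1)
  also have "ennreal R < ennreal (R + 1)" using assms(3) by (simp add: ennreal_less_iff)
  finally obtain g where g: "g \<in> frac_gradients M d \<alpha> u" "lq_enorm q (\<lambda>k. Lp_norm M p (g k)) < ennreal (R + 1)"
    unfolding INF_less_iff by blast
  have "Lp_norm M p (g k) \<le> ennreal (R + 1)" for k
    using lq_enorm_upper[OF assms(2), of "\<lambda>k. Lp_norm M p (g k)" k] g(2) by simp
  then show thesis using that g(1) by blast
qed

lemma HTL_norm_witness:
  assumes "HTL_norm M d \<alpha> p q u \<le> ennreal R" "0 < q" "0 \<le> R" "0 < p"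
  obtains g where "g \<in> frac_gradients M d \<alpha> u" "\<And>k. Lp_norm M p (g k) \<le> ennreal (R + 1)"
proof -
  let ?I = "INF g\<in>frac_gradients M d \<alpha> u. Lp_enorm M p (\<lambda>x. lq_enorm q (\<lambda>k. ennreal (g k x)))"
  have "?I \<le> HTL_norm M d \<alpha> p q u" unfolding HTL_norm_def by simp
  also note assms(1)
  also have "ennreal R < ennreal (R + 1)" using assms(3) by (simp add: ennreal_less_iff)
  finally obtain g where g: "g \<in> frac_gradients M d \<alpha> u"
      "Lp_enorm M p (\<lambda>x. lq_enorm q (\<lambda>k. ennreal (g k x))) < ennreal (R + 1)"
    unfolding INF_less_iff by blast
  have nn: "0 \<le> g k x" if "x \<in> space M" for k x using g(1) that unfolding frac_gradients_def by blast
  have "Lp_norm M p (g k) \<le> ennreal (R + 1)" for k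
  proof -
    have "Lp_norm M p (g k) \<le> Lp_enorm M p (\<lambda>x. lq_enorm q (\<lambda>k. ennreal (g k x)))"
      unfolding Lp_norm_def
    proof (rule Lp_enorm_mono[OF assms(4)])
      fix x assume "x \<in> space M"
      then show "ennreal \<bar>g k x\<bar> \<le> lq_enorm q (\<lambda>k. ennreal (g k x))"
        using lq_enorm_upper[OF assms(2), of "\<lambda>k. ennreal (g k x)" k] nn by simp
    qed
    then show ?thesis using g(2) by simp
  qed
  then show thesis using that g(1) by blast
qed

text \<open>
  The gradient parts of both scales of spaces dominate every single \<open>\<parallel>g\<^sub>k\<parallel>\<^sub>p\<close>, so bounded sets have
  members with uniformly bounded gradients; the infimum defining the norm costs the summand \<open>1\<close>.
\<close>

lemma totally_bounded_imp_compact: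
  assumes M: "quasi_metric_measure_space M d" and tb: "qm_totally_bounded (space M) d"
    and p: "0 < p" and a: "0 < \<alpha>" and q: "0 < q"
  shows "HB_compact M d \<alpha> p q" "HTL_compact M d \<alpha> p q"
proof -
  have main: "compactly_embedded_Lp M p V N"
    if V: "V \<subseteq> Lp_space M p" and N1: "\<And>u. Lp_norm M p u \<le> N u"
      and N2: "\<And>u R. N u \<le> ennreal R \<Longrightarrow> 0 \<le> R \<Longrightarrow>
        \<exists>g\<in>frac_gradients M d \<alpha> u. \<forall>k. Lp_norm M p (g k) \<le> ennreal (R + 1)" for V N
    unfolding compactly_embedded_Lp_def
  proof (intro conjI V allI impI)
    fix S assume S: "S \<subseteq> V" "\<exists>R::real. \<forall>u\<in>S. N u \<le> ennreal R"
    then obtain R0 :: real where R0: "\<And>u. u \<in> S \<Longrightarrow> N u \<le> ennreal R0" by blast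
    define R where "R = max R0 0"
    have R: "0 \<le> R" by (simp add: R_def)
    have NR: "N u \<le> ennreal R" if "u \<in> S" for u
      by (rule order_trans[OF R0[OF that] ennreal_leI]) (simp add: R_def)
    show "qm_totally_bounded S (\<lambda>u v. enn2real (Lp_norm M p (\<lambda>x. u x - v x)))"
    proof (rule totally_bounded_imp_gradient_bounded_compact[OF M tb p a])
      show "0 \<le> R + 1" using R by simp
      show "S \<subseteq> Lp_space M p" using S(1) V by blast
      show "\<exists>g\<in>frac_gradients M d \<alpha> u. \<forall>k. Lp_norm M p (g k) \<le> ennreal (R + 1)" if "u \<in> S" for u
        using N2[OF NR[OF that] R] .
      show "Lp_norm M p u \<le> ennreal (R + 1)" if "u \<in> S" for u
      proof -
        have "Lp_norm M p u \<le> ennreal R" using N1[of u] NR[OF that] by (rule order_trans)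
        also have "\<dots> \<le> ennreal (R + 1)" by (rule ennreal_leI) simp
        finally show ?thesis .
      qed
    qed
  qed
  show "HB_compact M d \<alpha> p q" unfolding HB_compact_def
  proof (rule main)
    show "HB_space M d \<alpha> p q \<subseteq> Lp_space M p" unfolding HB_space_def by blast
    show "Lp_norm M p u \<le> HB_norm M d \<alpha> p q u" for u unfolding HB_norm_def by simp
    show "\<exists>g\<in>frac_gradients M d \<alpha> u. \<forall>k. Lp_norm M p (g k) \<le> ennreal (R + 1)"
      if "HB_norm M d \<alpha> p q u \<le> ennreal R" "0 \<le> R" for u R
      using HB_norm_witness[OF that(1) q that(2)] by metis
  qed
  show "HTL_compact M d \<alpha> p q" unfolding HTL_compact_def
  proof (rule main)
    show "HTL_space M d \<alpha> p q \<subseteq> Lp_space M p" unfolding HTL_space_def by blast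
    show "Lp_norm M p u \<le> HTL_norm M d \<alpha> p q u" for u unfolding HTL_norm_def by simp
    show "\<exists>g\<in>frac_gradients M d \<alpha> u. \<forall>k. Lp_norm M p (g k) \<le> ennreal (R + 1)"
      if "HTL_norm M d \<alpha> p q u \<le> ennreal R" "0 \<le> R" for u R
      using HTL_norm_witness[OF that(1) q that(2) p] by metis
  qed
qed



section \<open>Separated bump functions\<close>

lemma lq_enorm_cmult:
  assumes "0 < q"
  shows "lq_enorm q (\<lambda>k. c * a k) = c * lq_enorm q a"
proof (cases "q = \<infinity>")
  case True
  then show ?thesis by (simp add: lq_enorm_def SUP_mult_left_ennreal)
next
  case False
  then have q: "0 < enn2real q" using assms by (simp add: enn2real_positive_iff less_top)
  then show ?thesis using False
    by (simp add: lq_enorm_def epowr_mult nn_integral_cmult epowr_epowr epowr_one)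
qed

lemma nn_integral_count_space_int_le:
  "(\<integral>\<^sup>+k. f k \<partial>count_space (UNIV :: int set)) \<le> (\<Sum>n. f (int n)) + (\<Sum>n. f (- int n))"
proof -
  have half: "(\<integral>\<^sup>+k. f k * indicator (range h) k \<partial>count_space UNIV) = (\<Sum>n. f (h n))"
    if "inj h" for h :: "nat \<Rightarrow> int"
  proof -
    have "(\<integral>\<^sup>+k. f k * indicator (range h) k \<partial>count_space UNIV) = (\<integral>\<^sup>+k. f k \<partial>count_space (range h))"
      by (rule nn_integral_count_space_indicator[symmetric]) simp
    also have "\<dots> = (\<integral>\<^sup>+n. f (h n) \<partial>count_space UNIV)"
      by (rule nn_integral_bij_count_space[symmetric]) (simp add: that bij_betw_def)
    finally show ?thesis by (simp add: nn_integral_count_space_nat)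
  qed
  have "(\<integral>\<^sup>+k. f k \<partial>count_space UNIV)
      \<le> (\<integral>\<^sup>+k. f k * indicator (range int) k + f k * indicator (range (\<lambda>n. - int n)) k \<partial>count_space UNIV)"
  proof (rule nn_integral_mono)
    fix k :: int
    have "k \<in> range int \<or> k \<in> range (\<lambda>n. - int n)" by (cases k rule: int_cases2) auto
    then show "f k \<le> f k * indicator (range int) k + f k * indicator (range (\<lambda>n. - int n)) k"
      by (auto simp: indicator_def)
  qed
  also have "\<dots> = (\<Sum>n. f (int n)) + (\<Sum>n. f (- int n))"
    by (subst nn_integral_add) (simp_all add: half inj_def)
  finally show ?thesis .
qed

text \<open>
  The size of the \<open>k\<close>-th gradient of a bump \<open>\<phi>\<close> with values in \<open>[0,1]\<close> and \<open>|\<phi>(x) - \<phi>(y)| \<le> L d(x,y)\<^sup>\<beta>\<close>.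
  On the annulus \<open>2\<^sup>-\<^sup>k\<^sup>-\<^sup>1 \<le> d(x,y) < 2\<^sup>-\<^sup>k\<close> the increment of \<open>\<phi>\<close> is at most the minimum below, and the first
  factor is the largest value of \<open>d(x,y)\<^sup>-\<^sup>\<alpha>\<close> there.
\<close>

definition bump_coeff :: "real \<Rightarrow> real \<Rightarrow> real \<Rightarrow> int \<Rightarrow> real" where
  "bump_coeff L \<alpha> \<beta> k = 2 powr (\<alpha> * (real_of_int k + 1)) * min 1 (L * 2 powr (- \<beta> * real_of_int k))"

text \<open>
  For \<open>k \<rightarrow> -\<infinity>\<close> the coefficients decay like \<open>2\<^sup>k\<^sup>\<alpha>\<close> because \<open>\<phi>\<close> is bounded, and for \<open>k \<rightarrow> \<infinity>\<close> like
  \<open>2\<^sup>-\<^sup>k\<^sup>(\<^sup>\<beta>\<^sup>-\<^sup>\<alpha>\<^sup>)\<close> by Hoelder continuity.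
\<close>

lemma bump_coeff_decay:
  assumes "0 < \<alpha>" "\<alpha> \<le> \<beta>" "0 \<le> L"
  shows "bump_coeff L \<alpha> \<beta> k \<le> 2 powr \<alpha> * max 1 L * 2 powr (- min \<alpha> (\<beta> - \<alpha>) * \<bar>real_of_int k\<bar>)"
proof (cases "k \<le> 0")
  case True
  have "\<alpha> * (real_of_int k + 1) = \<alpha> + - \<alpha> * \<bar>real_of_int k\<bar>" using True by (simp add: algebra_simps)
  also have "\<dots> \<le> \<alpha> + - min \<alpha> (\<beta> - \<alpha>) * \<bar>real_of_int k\<bar>" by (intro add_left_mono mult_right_mono) auto
  finally have "2 powr (\<alpha> * (real_of_int k + 1)) \<le> 2 powr (\<alpha> + - min \<alpha> (\<beta> - \<alpha>) * \<bar>real_of_int k\<bar>)"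
    by (intro powr_mono) auto
  also have "\<dots> = 2 powr \<alpha> * 2 powr (- min \<alpha> (\<beta> - \<alpha>) * \<bar>real_of_int k\<bar>)" by (rule powr_add)
  finally have "bump_coeff L \<alpha> \<beta> k \<le> (2 powr \<alpha> * 2 powr (- min \<alpha> (\<beta> - \<alpha>) * \<bar>real_of_int k\<bar>)) * max 1 L"
    unfolding bump_coeff_def using assms by (intro mult_mono) auto
  then show ?thesis by (simp add: mult_ac)
next
  case False
  have "bump_coeff L \<alpha> \<beta> k \<le> 2 powr (\<alpha> * (real_of_int k + 1)) * (L * 2 powr (- \<beta> * real_of_int k))"
    unfolding bump_coeff_def by (intro mult_left_mono) auto
  also have "\<dots> = L * 2 powr (\<alpha> * (real_of_int k + 1) + - \<beta> * real_of_int k)" by (simp only: powr_add mult_ac)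
  also have "\<dots> \<le> max 1 L * 2 powr (\<alpha> + - min \<alpha> (\<beta> - \<alpha>) * \<bar>real_of_int k\<bar>)"
  proof (intro mult_mono powr_mono)
    have "(\<alpha> - \<beta>) * real_of_int k \<le> - min \<alpha> (\<beta> - \<alpha>) * real_of_int k"
      using False by (intro mult_right_mono) auto
    then show "\<alpha> * (real_of_int k + 1) + - \<beta> * real_of_int k \<le> \<alpha> + - min \<alpha> (\<beta> - \<alpha>) * \<bar>real_of_int k\<bar>"
      using False by (simp add: algebra_simps)
  qed auto
  also have "\<dots> = 2 powr \<alpha> * max 1 L * 2 powr (- min \<alpha> (\<beta> - \<alpha>) * \<bar>real_of_int k\<bar>)"
    by (simp only: powr_add mult_ac)
  finally show ?thesis .
qed

lemma bump_coeff_nonneg: "0 \<le> L \<Longrightarrow> 0 \<le> bump_coeff L \<alpha> \<beta> k"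
  by (simp add: bump_coeff_def)

lemma bump_coeff_lq:
  assumes "0 < \<alpha>" "\<alpha> \<le> \<beta>" "0 \<le> L" "0 < q" "\<beta> = \<alpha> \<Longrightarrow> q = \<infinity>"
  shows "lq_enorm q (\<lambda>k. ennreal (bump_coeff L \<alpha> \<beta> k)) < \<infinity>"
proof -
  define \<gamma> where "\<gamma> = min \<alpha> (\<beta> - \<alpha>)"
  define c where "c = 2 powr \<alpha> * max 1 L"
  have c: "0 \<le> c" by (simp add: c_def)
  have dec: "bump_coeff L \<alpha> \<beta> k \<le> c * 2 powr (- \<gamma> * \<bar>real_of_int k\<bar>)" for k
    using bump_coeff_decay[OF assms(1-3)] unfolding \<gamma>_def c_def .
  note nn = bump_coeff_nonneg[OF assms(3)]
  show ?thesis
  proof (cases "q = \<infinity>")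
    case True
    have "(SUP k. ennreal (bump_coeff L \<alpha> \<beta> k)) \<le> ennreal c"
    proof (rule SUP_least)
      fix k
      have "2 powr (- \<gamma> * \<bar>real_of_int k\<bar>) \<le> 2 powr 0"
        using assms by (intro powr_mono) (auto simp: \<gamma>_def)
      then have "c * 2 powr (- \<gamma> * \<bar>real_of_int k\<bar>) \<le> c * 1" using c by (intro mult_left_mono) auto
      then show "ennreal (bump_coeff L \<alpha> \<beta> k) \<le> ennreal c" using dec[of k] by (intro ennreal_leI) simp
    qed
    then show ?thesis using True by (auto simp: lq_enorm_def intro: le_less_trans)
  next
    case False
    define r where "r = enn2real q"
    have r: "0 < r" unfolding r_def using False assms(4) by (simp add: enn2real_positive_iff less_top)
    have "\<beta> \<noteq> \<alpha>" using assms(5) False by blast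
    then have g: "0 < \<gamma>" using assms(1,2) by (simp add: \<gamma>_def)
    define z where "z = 2 powr (- \<gamma> * r)"
    have z: "0 < z" "z < 1" using g r by (auto simp: z_def powr_less_one)
    have le: "epowr (ennreal (bump_coeff L \<alpha> \<beta> k)) r \<le> ennreal (c powr r * z ^ nat \<bar>k\<bar>)" for k
    proof -
      have "bump_coeff L \<alpha> \<beta> k powr r \<le> (c * 2 powr (- \<gamma> * \<bar>real_of_int k\<bar>)) powr r"
        using dec nn r by (intro powr_mono2) auto
      also have "\<dots> = c powr r * z powr \<bar>real_of_int k\<bar>"
        using c by (simp add: powr_mult z_def powr_powr mult_ac)
      also have "z powr \<bar>real_of_int k\<bar> = z ^ nat \<bar>k\<bar>" using z by (simp add: powr_realpow[symmetric])
      finally show ?thesis using nn by (simp add: epowr_ennreal ennreal_leI)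
    qed
    have "(\<lambda>n. c powr r * z ^ n) sums (c powr r * (1 / (1 - z)))"
      using z by (intro sums_mult geometric_sums) auto
    then have geo: "(\<Sum>n. ennreal (c powr r * z ^ n)) = ennreal (c powr r * (1 / (1 - z)))"
      using z by (intro suminf_ennreal_eq) auto
    have "(\<integral>\<^sup>+k. epowr (ennreal (bump_coeff L \<alpha> \<beta> k)) r \<partial>count_space UNIV)
        \<le> (\<integral>\<^sup>+k. ennreal (c powr r * z ^ nat \<bar>k\<bar>) \<partial>count_space UNIV)"
      by (rule nn_integral_mono) (rule le)
    also have "\<dots> \<le> ennreal (c powr r * (1 / (1 - z))) + ennreal (c powr r * (1 / (1 - z)))"
      using nn_integral_count_space_int_le[of "\<lambda>k. ennreal (c powr r * z ^ nat \<bar>k\<bar>)"] by (simp add: geo)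
    also have "\<dots> < \<infinity>" by simp
    finally have "(\<integral>\<^sup>+k. epowr (ennreal (bump_coeff L \<alpha> \<beta> k)) r \<partial>count_space UNIV) \<noteq> \<infinity>" by simp
    then have "lq_enorm q (\<lambda>k. ennreal (bump_coeff L \<alpha> \<beta> k)) \<noteq> \<infinity>"
      using False epowr_eq_top_iff by (simp add: lq_enorm_def r_def)
    then show ?thesis by (simp add: less_top)
  qed
qed

text \<open>
  An increment of \<open>\<phi>\<close> between two points vanishes unless one of them lies in \<open>S\<close>; so the gradient may be
  taken to be constant on \<open>S\<close> and zero elsewhere, at every scale.
\<close>

lemma bump_gradient:
  fixes \<phi> :: "'a \<Rightarrow> real"
  assumes S: "S \<in> sets M" and L: "0 \<le> L" and a: "0 < \<alpha>" "\<alpha> \<le> \<beta>" and A: "0 \<le> A"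
    and range: "\<And>x. x \<in> space M \<Longrightarrow> 0 \<le> \<phi> x \<and> \<phi> x \<le> 1"
    and supp: "\<And>x. x \<in> space M - S \<Longrightarrow> \<phi> x = 0"
    and hoelder: "\<And>x y. x \<in> space M \<Longrightarrow> y \<in> space M \<Longrightarrow> \<bar>\<phi> x - \<phi> y\<bar> \<le> L * d x y powr \<beta>"
  shows "(\<lambda>k x. bump_coeff L \<alpha> \<beta> k * (A * indicator S x)) \<in> frac_gradients M d \<alpha> (\<lambda>x. A * \<phi> x)"
  unfolding frac_gradients_def
proof (intro CollectI conjI allI ballI)
  note [measurable] = S
  fix k
  show "(\<lambda>x. bump_coeff L \<alpha> \<beta> k * (A * indicator S x)) \<in> borel_measurable M" by measurable
  show "0 \<le> bump_coeff L \<alpha> \<beta> k * (A * indicator S x)" for x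
    using bump_coeff_nonneg[OF L] A by simp
next
  let ?g = "\<lambda>k x. bump_coeff L \<alpha> \<beta> k * (A * indicator S x)"
  show "\<exists>E\<in>null_sets M. \<forall>k. \<forall>x\<in>space M - E. \<forall>y\<in>space M - E.
      2 powi (- k - 1) \<le> d x y \<and> d x y < 2 powi (- k) \<longrightarrow>
      \<bar>A * \<phi> x - A * \<phi> y\<bar> \<le> d x y powr \<alpha> * (?g k x + ?g k y)"
  proof (intro bexI[of _ "{}"] allI ballI impI)
    fix k :: int and x y
    assume x: "x \<in> space M - {}" and y: "y \<in> space M - {}"
      and dk: "2 powi (- k - 1) \<le> d x y \<and> d x y < 2 powi (- k)"
    have pw: "2 powi j = (2::real) powr real_of_int j" for j :: int by (simp add: powr_real_of_int')
    have d1: "2 powr (- real_of_int k - 1) \<le> d x y" using dk pw[of "- k - 1"] by simp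
    have d2: "d x y \<le> 2 powr (- real_of_int k)" using dk pw[of "- k"] by simp
    have d0: "0 \<le> d x y" using d1 by (rule order_trans[rotated]) simp
    have gnn: "0 \<le> ?g k z" for z using bump_coeff_nonneg[OF L] A by simp
    show "\<bar>A * \<phi> x - A * \<phi> y\<bar> \<le> d x y powr \<alpha> * (?g k x + ?g k y)"
    proof (cases "x \<in> S \<or> y \<in> S")
      case False
      then show ?thesis using supp x y by simp
    next
      case True
      let ?m = "min 1 (L * 2 powr (- \<beta> * real_of_int k))"
      have "\<bar>\<phi> x - \<phi> y\<bar> \<le> ?m"
      proof (rule min.boundedI)
        show "\<bar>\<phi> x - \<phi> y\<bar> \<le> 1" using range[of x] range[of y] x y by auto
        have "L * d x y powr \<beta> \<le> L * (2 powr (- real_of_int k)) powr \<beta>"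
          using L d0 d2 a by (intro mult_left_mono powr_mono2) auto
        also have "\<dots> = L * 2 powr (- \<beta> * real_of_int k)" by (simp add: powr_powr mult_ac)
        finally show "\<bar>\<phi> x - \<phi> y\<bar> \<le> L * 2 powr (- \<beta> * real_of_int k)" using hoelder[of x y] x y by simp
      qed
      then have "\<bar>A * \<phi> x - A * \<phi> y\<bar> \<le> A * ?m"
        using A by (simp add: right_diff_distrib[symmetric] abs_mult mult_left_mono)
      also have "\<dots> = (2 powr (- real_of_int k - 1)) powr \<alpha> * (bump_coeff L \<alpha> \<beta> k * A)"
      proof -
        have "(2 powr (- real_of_int k - 1)) powr \<alpha> * 2 powr (\<alpha> * (real_of_int k + 1)) = 1"
          by (simp add: powr_powr powr_add[symmetric] algebra_simps)
        then have "(2 powr (- real_of_int k - 1)) powr \<alpha> * (bump_coeff L \<alpha> \<beta> k * A) = 1 * ?m * A"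
          unfolding bump_coeff_def by (simp only: mult.assoc[symmetric])
        then show ?thesis by (metis mult.commute mult_1)
      qed
      also have "\<dots> \<le> d x y powr \<alpha> * (bump_coeff L \<alpha> \<beta> k * A)"
        using bump_coeff_nonneg[OF L] A d1 a by (intro mult_right_mono powr_mono2) auto
      also have "\<dots> \<le> d x y powr \<alpha> * (?g k x + ?g k y)"
      proof (rule mult_left_mono)
        show "bump_coeff L \<alpha> \<beta> k * A \<le> ?g k x + ?g k y"
          using True gnn[of x] gnn[of y] bump_coeff_nonneg[OF L, of \<alpha> \<beta> k] A by (auto simp: indicator_def)
      qed simp
      finally show ?thesis .
    qed
  qed simp
qed

text \<open>
  Since the gradient is a sequence in \<open>k\<close> times one function of \<open>x\<close>, the order in which the \<open>\<ell>\<^sup>q\<close> and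
  \<open>L\<^sup>p\<close> norms are taken is irrelevant, and both smoothness norms have the same bound.
\<close>

lemma bump_norm_bounds:
  fixes \<phi> :: "'a \<Rightarrow> real"
  assumes S: "S \<in> sets M" and L: "0 \<le> L" and a: "0 < \<alpha>" "\<alpha> \<le> \<beta>" and A: "0 \<le> A"
    and range: "\<And>x. x \<in> space M \<Longrightarrow> 0 \<le> \<phi> x \<and> \<phi> x \<le> 1"
    and supp: "\<And>x. x \<in> space M - S \<Longrightarrow> \<phi> x = 0"
    and hoelder: "\<And>x y. x \<in> space M \<Longrightarrow> y \<in> space M \<Longrightarrow> \<bar>\<phi> x - \<phi> y\<bar> \<le> L * d x y powr \<beta>"
    and p: "0 < p" and q: "0 < q" and normal: "ennreal (A powr p) * emeasure M S = 1"
  shows "Lp_norm M p (\<lambda>x. A * \<phi> x) \<le> 1"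
    "HB_norm M d \<alpha> p q (\<lambda>x. A * \<phi> x) \<le> 1 + lq_enorm q (\<lambda>k. ennreal (bump_coeff L \<alpha> \<beta> k))"
    "HTL_norm M d \<alpha> p q (\<lambda>x. A * \<phi> x) \<le> 1 + lq_enorm q (\<lambda>k. ennreal (bump_coeff L \<alpha> \<beta> k))"
proof -
  note [measurable] = S
  let ?Q = "lq_enorm q (\<lambda>k. ennreal (bump_coeff L \<alpha> \<beta> k))"
  let ?g = "\<lambda>k x. bump_coeff L \<alpha> \<beta> k * (A * indicator S x)"
  note cnn = bump_coeff_nonneg[OF L]
  have grad: "?g \<in> frac_gradients M d \<alpha> (\<lambda>x. A * \<phi> x)"
    by (rule bump_gradient[OF S L a A range supp hoelder])
  have ind: "ennreal ((A * indicator S x) powr p) = ennreal (A powr p) * indicator S x" for x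
    using p by (auto simp: indicator_def)
  have one: "(\<integral>\<^sup>+x. ennreal ((A * indicator S x) powr p) \<partial>M) = 1"
    unfolding ind by (simp add: nn_integral_cmult_indicator normal)
  have "Lp_norm M p (\<lambda>x. A * \<phi> x) \<le> ennreal 1"
  proof (subst Lp_norm_le_iff[OF p])
    have "(\<integral>\<^sup>+x. ennreal (\<bar>A * \<phi> x\<bar> powr p) \<partial>M) \<le> (\<integral>\<^sup>+x. ennreal ((A * indicator S x) powr p) \<partial>M)"
    proof (intro nn_integral_mono ennreal_leI powr_mono2)
      fix x assume x: "x \<in> space M"
      show "\<bar>A * \<phi> x\<bar> \<le> A * indicator S x"
        using range[OF x] supp[of x] x A by (cases "x \<in> S") (auto simp: abs_mult mult_left_le)
    qed (use p in auto)
    then show "(\<integral>\<^sup>+x. ennreal (\<bar>A * \<phi> x\<bar> powr p) \<partial>M) \<le> ennreal (1 powr p)" unfolding one by simp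
  qed simp
  then show lp: "Lp_norm M p (\<lambda>x. A * \<phi> x) \<le> 1" by simp
  have "Lp_norm M p (?g k) = ennreal (bump_coeff L \<alpha> \<beta> k)" for k
  proof -
    have "(\<integral>\<^sup>+x. ennreal (\<bar>?g k x\<bar> powr p) \<partial>M)
        = (\<integral>\<^sup>+x. ennreal (bump_coeff L \<alpha> \<beta> k powr p) * ennreal ((A * indicator S x) powr p) \<partial>M)"
      using cnn A by (intro nn_integral_cong) (simp add: abs_mult powr_mult ennreal_mult)
    also have "\<dots> = ennreal (bump_coeff L \<alpha> \<beta> k powr p)" by (subst nn_integral_cmult) (auto simp: one)
    finally show ?thesis unfolding Lp_norm_eq using cnn p by (simp add: epowr_ennreal powr_powr)
  qed
  then have "(INF g\<in>frac_gradients M d \<alpha> (\<lambda>x. A * \<phi> x). lq_enorm q (\<lambda>k. Lp_norm M p (g k))) \<le> ?Q"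
    using INF_lower[OF grad, of "\<lambda>g. lq_enorm q (\<lambda>k. Lp_norm M p (g k))"] by simp
  then show "HB_norm M d \<alpha> p q (\<lambda>x. A * \<phi> x) \<le> 1 + ?Q"
    unfolding HB_norm_def using lp by (intro add_mono)
  have "Lp_enorm M p (\<lambda>x. lq_enorm q (\<lambda>k. ennreal (?g k x))) = ?Q"
  proof -
    have "lq_enorm q (\<lambda>k. ennreal (?g k x)) = ennreal (A * indicator S x) * ?Q" for x
      using A cnn by (simp add: lq_enorm_cmult[OF q, symmetric] ennreal_mult mult.commute)
    moreover have "epowr (ennreal (A * indicator S x)) p = ennreal ((A * indicator S x) powr p)" for x
      using A by (intro epowr_ennreal) auto
    ultimately have "Lp_enorm M p (\<lambda>x. lq_enorm q (\<lambda>k. ennreal (?g k x)))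
        = epowr (\<integral>\<^sup>+x. ennreal ((A * indicator S x) powr p) * epowr ?Q p \<partial>M) (1 / p)"
      unfolding Lp_enorm_def by (simp only: epowr_mult)
    also have "(\<integral>\<^sup>+x. ennreal ((A * indicator S x) powr p) * epowr ?Q p \<partial>M) = epowr ?Q p"
      by (subst nn_integral_multc) (auto simp: one)
    finally show ?thesis using p by (simp add: epowr_epowr epowr_one)
  qed
  then have "(INF g\<in>frac_gradients M d \<alpha> (\<lambda>x. A * \<phi> x). Lp_enorm M p (\<lambda>x. lq_enorm q (\<lambda>k. ennreal (g k x)))) \<le> ?Q"
    using INF_lower[OF grad, of "\<lambda>g. Lp_enorm M p (\<lambda>x. lq_enorm q (\<lambda>k. ennreal (g k x)))"] by simp
  then show "HTL_norm M d \<alpha> p q (\<lambda>x. A * \<phi> x) \<le> 1 + ?Q"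
    unfolding HTL_norm_def using lp by (intro add_mono)
qed

lemma separated_not_totally_bounded:
  fixes u :: "nat \<Rightarrow> 'b"
  assumes "0 < e" "\<And>m n. m \<noteq> n \<Longrightarrow> e \<le> \<rho> (u m) (u n)"
  shows "\<not> qm_totally_bounded (range u) \<rho>"
proof
  assume "qm_totally_bounded (range u) \<rho>"
  then obtain F where F: "finite F" "F \<subseteq> range u" "range u \<subseteq> (\<Union>x\<in>F. qball (range u) \<rho> x e)"
    using assms(1) unfolding qm_totally_bounded_def by meson
  obtain G where G: "finite G" "F = u ` G" using finite_subset_image[OF F(1,2)] by auto
  obtain n where n: "n \<notin> G" using ex_new_if_finite[OF infinite_UNIV_nat G(1)] by blast
  obtain m where "m \<in> G" "\<rho> (u m) (u n) < e" using F(3) G(2) unfolding qball_def by blast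
  then show False using assms(2)[of m n] n by force
qed

text \<open>
  Normalised by \<open>\<mu>(S\<^sub>n)\<^sup>-\<^sup>1\<^sup>/\<^sup>p\<close> the bumps are bounded in both smoothness spaces. The inner sets \<open>I\<^sub>n\<close> carry a
  fixed proportion of \<open>\<mu>(S\<^sub>n)\<close>, and only one of two different bumps lives on such a set; this keeps the
  mutual \<open>L\<^sup>p\<close> distances above a fixed \<open>e > 0\<close>.
\<close>

lemma bumps_not_compact:
  fixes \<phi> :: "nat \<Rightarrow> 'a \<Rightarrow> real"
  assumes S: "\<And>n. S n \<in> sets M" "disjoint_family S" "\<And>n. emeasure M (S n) < \<infinity>"
    and I: "\<And>n. I n \<in> sets M" "\<And>n. I n \<subseteq> S n" "\<And>n. 0 < emeasure M (I n)"
    and C: "1 \<le> C" "\<And>n. emeasure M (S n) \<le> ennreal C * emeasure M (I n)"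
    and meas: "\<And>n. \<phi> n \<in> borel_measurable M"
    and range: "\<And>n x. x \<in> space M \<Longrightarrow> 0 \<le> \<phi> n x \<and> \<phi> n x \<le> 1"
    and supp: "\<And>n x. x \<in> space M - S n \<Longrightarrow> \<phi> n x = 0"
    and inner: "\<And>n x. x \<in> I n \<Longrightarrow> 1 / 2 \<le> \<phi> n x"
    and L: "0 \<le> L" and a: "0 < \<alpha>" "\<alpha> \<le> \<beta>" "\<beta> = \<alpha> \<Longrightarrow> q = \<infinity>"
    and hoelder: "\<And>n x y. x \<in> space M \<Longrightarrow> y \<in> space M \<Longrightarrow> \<bar>\<phi> n x - \<phi> n y\<bar> \<le> L * d x y powr \<beta>"
    and p: "0 < p" and q: "0 < q"
  shows "\<not> HB_compact M d \<alpha> p q" "\<not> HTL_compact M d \<alpha> p q"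
proof -
  define s where "s n = measure M (S n)" for n
  have s_eq: "emeasure M (S n) = ennreal (s n)" for n
    using S(3)[of n] by (simp add: s_def emeasure_eq_ennreal_measure less_top)
  have s: "0 < s n" for n
  proof -
    have "0 < emeasure M (S n)" using I(3)[of n] emeasure_mono[OF I(2) S(1)] by (rule less_le_trans)
    then show ?thesis by (simp add: s_eq)
  qed
  define A where "A n = s n powr (- 1 / p)" for n
  have A: "0 < A n" "A n powr p = 1 / s n" for n
  proof -
    show "0 < A n" using s[of n] by (simp add: A_def)
    have "- 1 / p * p = - 1" using p by simp
    then have "A n powr p = s n powr - 1" by (simp only: A_def powr_powr)
    then show "A n powr p = 1 / s n" using s[of n] by (simp add: powr_minus_divide)
  qed
  have normal: "ennreal (A n powr p) * emeasure M (S n) = 1" for n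
    unfolding A(2) s_eq using s[of n] by (simp add: ennreal_mult[symmetric])
  define u where "u n x = A n * \<phi> n x" for n x
  let ?Q = "lq_enorm q (\<lambda>k. ennreal (bump_coeff L \<alpha> \<beta> k))"
  have bounds: "Lp_norm M p (u n) \<le> 1" "HB_norm M d \<alpha> p q (u n) \<le> 1 + ?Q" "HTL_norm M d \<alpha> p q (u n) \<le> 1 + ?Q" for n
  proof -
    have u: "u n = (\<lambda>x. A n * \<phi> n x)" by (simp add: u_def[abs_def])
    note rules = bump_norm_bounds[where S = "S n" and \<phi> = "\<phi> n" and d = d and A = "A n",
        OF S(1) L a(1,2) less_imp_le[OF A(1)] _ _ _ p q normal]
    show "Lp_norm M p (u n) \<le> 1"
      unfolding u by (rule rules(1)) (fact range supp hoelder)+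
    show "HB_norm M d \<alpha> p q (u n) \<le> 1 + ?Q"
      unfolding u by (rule rules(2)) (fact range supp hoelder)+
    show "HTL_norm M d \<alpha> p q (u n) \<le> 1 + ?Q"
      unfolding u by (rule rules(3)) (fact range supp hoelder)+
  qed
  have Q: "?Q < \<infinity>" by (rule bump_coeff_lq[OF a(1,2) L q a(3)])
  then have Q': "1 + ?Q < \<infinity>" "1 + ?Q = ennreal (enn2real (1 + ?Q))" by (simp_all add: less_top)
  have um[measurable]: "u n \<in> borel_measurable M" for n
    using meas[of n] unfolding u_def[abs_def] by measurable
  have uL: "u n \<in> Lp_space M p" for n
    unfolding Lp_space_def using bounds(1)[of n] by (auto intro: le_less_trans)
  define e where "e = ((1 / 2) powr p / C) powr (1 / p)"
  have e: "0 < e" "e powr p = (1 / 2) powr p / C" using C(1) p by (auto simp: e_def powr_powr)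
  have sep: "e \<le> enn2real (Lp_norm M p (\<lambda>x. u m x - u n x))" if mn: "m \<noteq> n" for m n
  proof -
    note [measurable] = I(1)
    define i where "i = measure M (I m)"
    have "emeasure M (I m) \<le> emeasure M (S m)" by (rule emeasure_mono[OF I(2) S(1)])
    then have "emeasure M (I m) \<noteq> top" using S(3)[of m] by (metis infinity_ennreal_def leD)
    then have i: "emeasure M (I m) = ennreal i" by (simp add: i_def emeasure_eq_ennreal_measure)
    have i0: "0 \<le> i" by (simp add: i_def)
    have "ennreal (s m) \<le> ennreal (C * i)" using C(2)[of m] C(1) i0 by (simp add: s_eq i ennreal_mult)
    then have si: "s m \<le> C * i" using C(1) i0 by (simp add: ennreal_le_iff)
    have lower: "ennreal (e powr p) \<le> (\<integral>\<^sup>+x. ennreal (\<bar>u m x - u n x\<bar> powr p) \<partial>M)"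
    proof -
      have "e powr p \<le> (A m * (1 / 2)) powr p * i"
      proof -
        have "(A m * (1 / 2)) powr p * i = (1 / 2) powr p * (i / s m)"
          using powr_mult[of "A m" "1 / 2" p] A[of m] by simp
        moreover have "1 / C \<le> i / s m" using si s[of m] C(1) by (simp add: field_simps)
        then have "(1 / 2) powr p * (1 / C) \<le> (1 / 2) powr p * (i / s m)" by (intro mult_left_mono) auto
        ultimately show ?thesis by (simp add: e)
      qed
      then have "ennreal (e powr p) \<le> ennreal ((A m * (1 / 2)) powr p) * ennreal i"
        using i0 by (simp add: ennreal_mult[symmetric])
      also have "\<dots> = (\<integral>\<^sup>+x. ennreal ((A m * (1 / 2)) powr p) * indicator (I m) x \<partial>M)"
        by (simp add: nn_integral_cmult_indicator i)
      also have "\<dots> \<le> (\<integral>\<^sup>+x. ennreal (\<bar>u m x - u n x\<bar> powr p) \<partial>M)"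
      proof (rule nn_integral_mono)
        fix x assume x: "x \<in> space M"
        show "ennreal ((A m * (1 / 2)) powr p) * indicator (I m) x \<le> ennreal (\<bar>u m x - u n x\<bar> powr p)"
        proof (cases "x \<in> I m")
          case True
          then have "x \<notin> S n" using I(2) S(2) mn unfolding disjoint_family_on_def by blast
          then have "u n x = 0" using supp x by (simp add: u_def)
          moreover have "A m * (1 / 2) \<le> u m x" unfolding u_def using A(1)[of m] inner[OF True] by (intro mult_left_mono) auto
          ultimately have "(A m * (1 / 2)) powr p \<le> \<bar>u m x - u n x\<bar> powr p"
            using A(1)[of m] p by (intro powr_mono2) auto
          then show ?thesis using True by (simp add: ennreal_leI)
        qed simp
      qed
      finally show ?thesis .
    qed
    have "(\<integral>\<^sup>+x. ennreal (\<bar>u m x - u n x\<bar> powr p) \<partial>M) < \<infinity>"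
    proof -
      have b: "(\<integral>\<^sup>+x. ennreal (\<bar>u k x\<bar> powr p) \<partial>M) < \<infinity>" for k
        using bounds(1)[of k] Lp_norm_finite_iff[of M p "u k"] by (auto intro: le_less_trans)
      have "(\<integral>\<^sup>+x. ennreal (\<bar>u m x - u n x\<bar> powr p) \<partial>M)
          \<le> (\<integral>\<^sup>+x. ennreal (2 powr p) * (ennreal (\<bar>u m x\<bar> powr p) + ennreal (\<bar>u n x\<bar> powr p)) \<partial>M)"
      proof (rule nn_integral_mono)
        fix x
        show "ennreal (\<bar>u m x - u n x\<bar> powr p) \<le> ennreal (2 powr p) * (ennreal (\<bar>u m x\<bar> powr p) + ennreal (\<bar>u n x\<bar> powr p))"
          using powr_sum2_le[OF p, of "u m x" "- u n x"]
          by (simp add: ennreal_mult[symmetric] ennreal_plus[symmetric] del: ennreal_plus)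
      qed
      also have "\<dots> = ennreal (2 powr p) * ((\<integral>\<^sup>+x. ennreal (\<bar>u m x\<bar> powr p) \<partial>M) + (\<integral>\<^sup>+x. ennreal (\<bar>u n x\<bar> powr p) \<partial>M))"
        by (subst nn_integral_cmult, simp, subst nn_integral_add) auto
      also have "\<dots> < \<infinity>" using b[of m] b[of n] by (simp add: ennreal_mult_less_top)
      finally show ?thesis .
    qed
    then have "Lp_norm M p (\<lambda>x. u m x - u n x) < \<infinity>" by (simp only: Lp_norm_finite_iff)
    then obtain l where l: "Lp_norm M p (\<lambda>x. u m x - u n x) = ennreal l" "0 \<le> l"
      by (cases "Lp_norm M p (\<lambda>x. u m x - u n x)") auto
    have "(\<integral>\<^sup>+x. ennreal (\<bar>u m x - u n x\<bar> powr p) \<partial>M) \<le> ennreal (l powr p)"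
      using Lp_norm_le_iff[OF p l(2), of M "\<lambda>x. u m x - u n x"] l(1) by simp
    then have "e powr p \<le> l powr p" using lower l(2) by (meson order_trans ennreal_le_iff powr_ge_zero)
    then have "e \<le> l" using powr_less_mono2[OF p l(2), of e] by linarith
    then show ?thesis using l by simp
  qed
  have not_compact: "\<not> compactly_embedded_Lp M p V N"
    if "range u \<subseteq> V" "\<And>n. N (u n) \<le> 1 + ?Q" for V N
  proof
    assume "compactly_embedded_Lp M p V N"
    moreover have "\<exists>R::real. \<forall>w\<in>range u. N w \<le> ennreal R"
      using that(2) Q'(2) by (intro exI[of _ "enn2real (1 + ?Q)"]) auto
    ultimately have "qm_totally_bounded (range u) (\<lambda>u v. enn2real (Lp_norm M p (\<lambda>x. u x - v x)))"
      unfolding compactly_embedded_Lp_def using that(1) by blast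
    moreover have "\<not> qm_totally_bounded (range u) (\<lambda>u v. enn2real (Lp_norm M p (\<lambda>x. u x - v x)))"
      by (rule separated_not_totally_bounded[OF e(1)]) (rule sep)
    ultimately show False by contradiction
  qed
  show "\<not> HB_compact M d \<alpha> p q" unfolding HB_compact_def
  proof (rule not_compact)
    show "range u \<subseteq> HB_space M d \<alpha> p q" unfolding HB_space_def using uL le_less_trans[OF bounds(2) Q'(1)] by blast
  qed (rule bounds)
  show "\<not> HTL_compact M d \<alpha> p q" unfolding HTL_compact_def
  proof (rule not_compact)
    show "range u \<subseteq> HTL_space M d \<alpha> p q" unfolding HTL_space_def using uL le_less_trans[OF bounds(3) Q'(1)] by blast
  qed (rule bounds)
qed



section \<open>Compactness implies total boundedness\<close>

lemma iterated_doubling: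
  assumes K: "1 < K" and dbl: "\<And>\<delta>. 0 < \<delta> \<Longrightarrow> \<delta> \<le> \<delta>\<^sub>0 \<Longrightarrow> doubling M d K \<delta>"
    and "0 < \<delta>\<^sub>0" and balls: "\<And>x r. x \<in> space M \<Longrightarrow> 0 < r \<Longrightarrow> qball (space M) d x r \<in> sets M"
  obtains t\<^sub>0 where "0 < t\<^sub>0" "\<And>t. 0 < t \<Longrightarrow> t \<le> t\<^sub>0 \<Longrightarrow> doubling M d T t"
proof -
  obtain m where m: "T < K ^ m" using real_arch_pow[OF K] by blast
  define t\<^sub>0 where "t\<^sub>0 = \<delta>\<^sub>0 / K ^ m"
  have "doubling M d T t" if t: "0 < t" "t \<le> t\<^sub>0" for t
  proof -
    have step: "doubling M d (K ^ j) t" if "j \<le> m" for j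
      using that
    proof (induction j)
      case 0
      show ?case unfolding doubling_def by (intro exI[of _ 1]) simp
    next
      case (Suc j)
      have "K ^ j * t \<le> K ^ m * t\<^sub>0" using K t Suc.prems by (intro mult_mono power_increasing) auto
      then have le: "K ^ j * t \<le> \<delta>\<^sub>0" using K by (simp add: t\<^sub>0_def)
      have pos: "0 < K ^ j * t" using K t by simp
      obtain C1 where C1: "1 \<le> C1" "\<And>x. x \<in> space M \<Longrightarrow> emeasure M (qball (space M) d x (K * (K ^ j * t)))
          \<le> ennreal C1 * emeasure M (qball (space M) d x (K ^ j * t))"
        using dbl[OF pos le] unfolding doubling_def by blast
      obtain C2 where C2: "1 \<le> C2" "\<And>x. x \<in> space M \<Longrightarrow> emeasure M (qball (space M) d x (K ^ j * t))
          \<le> ennreal C2 * emeasure M (qball (space M) d x t)"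
        using Suc unfolding doubling_def by auto
      show ?case unfolding doubling_def
      proof (intro exI[of _ "C1 * C2"] conjI ballI)
        show "1 \<le> C1 * C2" using C1(1) C2(1) mult_mono[of 1 C1 1 C2] by simp
        fix x assume x: "x \<in> space M"
        have "emeasure M (qball (space M) d x (K ^ Suc j * t))
            \<le> ennreal C1 * emeasure M (qball (space M) d x (K ^ j * t))" using C1(2)[OF x] by (simp add: mult.assoc)
        also have "\<dots> \<le> ennreal C1 * (ennreal C2 * emeasure M (qball (space M) d x t))"
          by (intro mult_left_mono C2(2)[OF x]) auto
        also have "\<dots> = ennreal (C1 * C2) * emeasure M (qball (space M) d x t)"
          using C1(1) C2(1) by (simp add: ennreal_mult mult.assoc)
        finally show "emeasure M (qball (space M) d x (K ^ Suc j * t))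
            \<le> ennreal (C1 * C2) * emeasure M (qball (space M) d x t)" .
      qed
    qed
    obtain C where C: "1 \<le> C" "\<And>x. x \<in> space M \<Longrightarrow> emeasure M (qball (space M) d x (K ^ m * t))
        \<le> ennreal C * emeasure M (qball (space M) d x t)"
      using step[of m] unfolding doubling_def by auto
    have "T * t \<le> K ^ m * t" using m t by (intro mult_right_mono) auto
    then have sub: "qball (space M) d x (T * t) \<subseteq> qball (space M) d x (K ^ m * t)" for x
      unfolding qball_def by auto
    have pos: "0 < K ^ m * t" using K t by simp
    show ?thesis unfolding doubling_def
    proof (intro exI[of _ C] conjI ballI C(1))
      fix x assume x: "x \<in> space M"
      show "emeasure M (qball (space M) d x (T * t)) \<le> ennreal C * emeasure M (qball (space M) d x t)"
        using emeasure_mono[OF sub balls[OF x pos]] C(2)[OF x] by (rule order_trans)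
    qed
  qed
  moreover have "0 < t\<^sub>0" using K \<open>0 < \<delta>\<^sub>0\<close> by (simp add: t\<^sub>0_def)
  ultimately show thesis using that by blast
qed

text \<open>
  For \<open>C\<^sub>d > 1\<close> the doubling condition can be iterated to any factor \<open>T\<close>, so that tent functions of the
  metric \<open>D\<close> are admissible bumps. Their supports are \<open>D\<close>-balls of radius \<open>s\<close>, and their inner
  sets have radius \<open>s / 2\<close>; \<open>T = (2c\<^sup>2)\<^sup>1\<^sup>/\<^sup>\<beta>\<close> is the ratio of the radii of the \<open>d\<close>-balls that enclose the
  former and fit into the latter.
\<close>

lemma not_compact_of_separated:
  fixes x :: "nat \<Rightarrow> 'a"
  assumes M: "quasi_metric_measure_space M d" and K: "1 < qm_const (space M) d"
    and dbl: "\<And>\<delta>. 0 < \<delta> \<Longrightarrow> \<delta> \<le> \<delta>\<^sub>0 \<Longrightarrow> doubling M d (qm_const (space M) d) \<delta>" and "0 < \<delta>\<^sub>0"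
    and x: "\<And>n. x n \<in> space M" and t: "0 < t" and disj: "disjoint_family (\<lambda>n. qball (space M) d (x n) t)"
    and a: "0 < \<alpha>" and p: "0 < p" and q: "0 < q" and ind: "le_ind \<alpha> q (space M) d"
  shows "\<not> HB_compact M d \<alpha> p q" "\<not> HTL_compact M d \<alpha> p q"
proof -
  note qm = qmm_space(1)[OF M]
  let ?X = "space M"
  obtain \<beta> D c where b: "\<alpha> \<le> \<beta>" "\<beta> = \<alpha> \<Longrightarrow> q = \<infinity>" and D: "power_metric ?X d \<beta> D c"
    using le_ind_power_metric[OF qm a ind] by metis
  have b0: "0 < \<beta>" using a b(1) by simp
  have c: "0 < c" using D unfolding power_metric_def by blast
  have D1: "0 \<le> D y z" "D y z = D z y" "D y z \<le> c * d y z powr \<beta>" "d y z powr \<beta> \<le> c * D y z"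
    if "y \<in> ?X" "z \<in> ?X" for y z using D that unfolding power_metric_def by blast+
  have D2: "D y w \<le> D y z + D z w" if "y \<in> ?X" "z \<in> ?X" "w \<in> ?X" for y z w
    using D that unfolding power_metric_def by blast
  define T where "T = (2 * c\<^sup>2) powr (1 / \<beta>)"
  have T: "0 < T" "T powr \<beta> = 2 * c\<^sup>2" using c b0 by (auto simp: T_def powr_powr)
  obtain t\<^sub>0 where t0: "0 < t\<^sub>0" "\<And>t. 0 < t \<Longrightarrow> t \<le> t\<^sub>0 \<Longrightarrow> doubling M d T t"
    using iterated_doubling[OF K dbl \<open>0 < \<delta>\<^sub>0\<close> qmm_space(3)[OF M]] by blast
  \<comment> \<open>\<open>r\<close> is the radius of the inner \<open>d\<close>-balls, \<open>T r\<close> that of the outer ones\<close>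
  define r where "r = min t\<^sub>0 (t / T)"
  have "r \<le> t / T" by (simp add: r_def)
  then have "T * r \<le> t" using T(1) by (simp add: pos_le_divide_eq mult.commute)
  moreover have "0 < r" "r \<le> t\<^sub>0" using t0(1) t T(1) by (auto simp: r_def)
  ultimately have r: "0 < r" "r \<le> t\<^sub>0" "T * r \<le> t" by blast+
  define s where "s = 2 * c * r powr \<beta>"
  have s: "0 < s" using c r by (simp add: s_def)
  define S where "S n = {y\<in>?X. D (x n) y < s}" for n
  define I where "I n = {y\<in>?X. D (x n) y < s / 2}" for n
  define \<phi> where "\<phi> n y = max 0 (1 - D (x n) y / s)" for n y
  have opn: "{y\<in>?X. D (x n) y < v} \<in> sets M" for n v
    using power_metric_ball_open[OF qm b0 D x] qmm_space(2)[OF M] by blast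
  have S_sub: "S n \<subseteq> qball ?X d (x n) (T * r)" for n
  proof
    fix y assume "y \<in> S n"
    then have y: "y \<in> ?X" "D (x n) y < s" by (auto simp: S_def)
    have "d (x n) y powr \<beta> \<le> c * D (x n) y" by (rule D1(4)[OF x y(1)])
    also have "\<dots> < c * s" using y c by simp
    also have "\<dots> = (T * r) powr \<beta>" using T r c by (simp add: powr_mult s_def power2_eq_square)
    finally have lt: "d (x n) y powr \<beta> < (T * r) powr \<beta>" .
    have "d (x n) y < T * r"
    proof (rule ccontr)
      assume "\<not> ?thesis"
      then have "(T * r) powr \<beta> \<le> d (x n) y powr \<beta>" using T r b0 by (intro powr_mono2) auto
      then show False using lt by simp
    qed
    then show "y \<in> qball ?X d (x n) (T * r)" using y by (simp add: qball_def)
  qed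
  have I_sup: "qball ?X d (x n) r \<subseteq> I n" for n
  proof
    fix y assume "y \<in> qball ?X d (x n) r"
    then have y: "y \<in> ?X" "d (x n) y < r" by (auto simp: qball_def)
    have "D (x n) y \<le> c * d (x n) y powr \<beta>" by (rule D1(3)[OF x y(1)])
    also have "\<dots> < c * r powr \<beta>"
      using y c b0 quasi_metricD(1)[OF qm x y(1)] by (intro mult_strict_left_mono powr_less_mono2) auto
    finally show "y \<in> I n" using y by (simp add: I_def s_def)
  qed
  have Tr: "0 < T * r" using T r by simp
  obtain C where C: "1 \<le> C" "\<And>y. y \<in> ?X \<Longrightarrow> emeasure M (qball ?X d y (T * r)) \<le> ennreal C * emeasure M (qball ?X d y r)"
    using t0(2)[OF r(1,2)] unfolding doubling_def by blast
  have Sm: "S n \<in> sets M" and Im: "I n \<in> sets M" for n unfolding S_def I_def by (rule opn)+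
  have Sdisj: "disjoint_family S"
  proof -
    have "S n \<subseteq> qball ?X d (x n) t" for n using S_sub[of n] r(3) unfolding qball_def by fastforce
    then show ?thesis using disj unfolding disjoint_family_on_def by blast
  qed
  have Sfin: "emeasure M (S n) < \<infinity>" for n
    using emeasure_mono[OF S_sub qmm_space(3)[OF M x Tr]] qmm_space(5)[OF M x Tr] by (rule le_less_trans)
  have IS: "I n \<subseteq> S n" for n using s by (auto simp: I_def S_def)
  have Ipos: "0 < emeasure M (I n)" for n
    using qmm_space(4)[OF M x r(1)] emeasure_mono[OF I_sup Im] by (rule less_le_trans)
  have SI: "emeasure M (S n) \<le> ennreal C * emeasure M (I n)" for n
  proof -
    have "emeasure M (S n) \<le> emeasure M (qball ?X d (x n) (T * r))"
      by (rule emeasure_mono[OF S_sub qmm_space(3)[OF M x Tr]])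
    also have "\<dots> \<le> ennreal C * emeasure M (qball ?X d (x n) r)" by (rule C(2)[OF x])
    also have "\<dots> \<le> ennreal C * emeasure M (I n)" by (intro mult_left_mono emeasure_mono I_sup Im) simp
    finally show ?thesis .
  qed
  have meas: "\<phi> n \<in> borel_measurable M" for n
  proof -
    have [measurable]: "(\<lambda>y. D (x n) y) \<in> borel_measurable M"
      unfolding borel_measurable_iff_less using opn by blast
    show ?thesis unfolding \<phi>_def[abs_def] by measurable
  qed
  have range: "0 \<le> \<phi> n y \<and> \<phi> n y \<le> 1" if "y \<in> ?X" for n y
    using D1(1)[OF x that, of n] s by (auto simp: \<phi>_def)
  have supp: "\<phi> n y = 0" if "y \<in> ?X - S n" for n y
    using that s by (auto simp: \<phi>_def S_def max_def field_simps)
  have inner: "1 / 2 \<le> \<phi> n y" if "y \<in> I n" for n y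
  proof -
    have "D (x n) y / s < 1 / 2" using that s by (simp add: I_def field_simps)
    then show ?thesis unfolding \<phi>_def by linarith
  qed
  have L: "0 \<le> c / s" using c s by simp
  have hoelder: "\<bar>\<phi> n y - \<phi> n z\<bar> \<le> c / s * d y z powr \<beta>" if "y \<in> ?X" "z \<in> ?X" for n y z
  proof -
    have "\<bar>\<phi> n y - \<phi> n z\<bar> \<le> \<bar>D (x n) z / s - D (x n) y / s\<bar>" unfolding \<phi>_def by linarith
    also have "\<dots> = \<bar>D (x n) z - D (x n) y\<bar> / s" using s by (simp add: diff_divide_distrib[symmetric] abs_divide)
    also have "\<dots> \<le> D y z / s"
    proof (rule divide_right_mono)
      show "\<bar>D (x n) z - D (x n) y\<bar> \<le> D y z"
        using D2[OF x that, of n] D2[OF x that(2,1), of n] D1(2)[OF that] by linarith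
    qed (use s in simp)
    also have "\<dots> \<le> (c * d y z powr \<beta>) / s" using D1(3)[OF that] s by (intro divide_right_mono) auto
    finally show ?thesis by simp
  qed
  show "\<not> HB_compact M d \<alpha> p q"
    by (rule bumps_not_compact(1)[where \<phi> = \<phi>, OF Sm Sdisj Sfin Im IS Ipos C(1) SI meas _ _ _ L a b _ p q])
      (fact range supp inner hoelder | assumption)+
  show "\<not> HTL_compact M d \<alpha> p q"
    by (rule bumps_not_compact(2)[where \<phi> = \<phi>, OF Sm Sdisj Sfin Im IS Ipos C(1) SI meas _ _ _ L a b _ p q])
      (fact range supp inner hoelder | assumption)+
qed

text \<open>
  If \<open>C\<^sub>d = 1\<close>, a ball enlarged by the factor \<open>C\<^sub>d\<close> is the same ball, so doubling cannot pay for a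
  transition layer between an inner set and a support. None is necessary: \<open>d\<close> satisfies the
  ultrametric inequality, hence symmetrised balls have positive distance to their complements and
  their indicator functions are Hoelder continuous of every order.
\<close>

lemma not_compact_of_separated_ultrametric:
  fixes x :: "nat \<Rightarrow> 'a"
  assumes M: "quasi_metric_measure_space M d" and K: "qm_const (space M) d = 1"
    and x: "\<And>n. x n \<in> space M" and t: "0 < t" and disj: "disjoint_family (\<lambda>n. qball (space M) d (x n) t)"
    and a: "0 < \<alpha>" and p: "0 < p" and q: "0 < q"
  shows "\<not> HB_compact M d \<alpha> p q" "\<not> HTL_compact M d \<alpha> p q"
proof -
  note qm = qmm_space(1)[OF M]
  let ?X = "space M"
  obtain C where C: "1 \<le> C" "\<And>y z. y \<in> ?X \<Longrightarrow> z \<in> ?X \<Longrightarrow> d z y \<le> C * d y z" using quasi_symmetric[OF qm] by blast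
  have ultra: "d y z \<le> max (d y w) (d w z)" if "y \<in> ?X" "z \<in> ?X" "w \<in> ?X" for y z w
    using qm_const_bound[OF qm that] K by simp
  define S where "S n = {y\<in>?X. d (x n) y < t \<and> d y (x n) < t}" for n
  have small: "z \<in> S n" if y: "y \<in> S n" and z: "z \<in> ?X" "d y z < t / C" for n y z
  proof -
    have y': "y \<in> ?X" "d (x n) y < t" "d y (x n) < t" using y by (auto simp: S_def)
    have "d y z < t"
    proof -
      have "t / C \<le> t" using C(1) t by (simp add: field_simps)
      then show ?thesis using z by simp
    qed
    moreover have "d z y < t"
    proof -
      have "d z y \<le> C * d y z" using C(2) y' z by blast
      also have "\<dots> < t" using z C(1) by (simp add: field_simps)
      finally show ?thesis .
    qed
    ultimately show ?thesis
      using ultra[OF x z(1) y'(1), of n] ultra[OF z(1) x y'(1), of n] y' z(1) unfolding S_def by auto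
  qed
  have tC: "0 < t / C" using C(1) t by simp
  have "S n \<in> qm_open_sets ?X d" for n
    unfolding qm_open_sets_def
  proof (intro CollectI conjI ballI)
    show "S n \<subseteq> ?X" by (auto simp: S_def)
    fix y assume "y \<in> S n"
    then have "qball ?X d y (t / C) \<subseteq> S n" using small unfolding qball_def by blast
    then show "\<exists>r>0. qball ?X d y r \<subseteq> S n" using tC by blast
  qed
  then have Sm: "S n \<in> sets M" for n using qmm_space(2)[OF M] by blast
  have S_sub: "S n \<subseteq> qball ?X d (x n) t" for n by (auto simp: S_def qball_def)
  have Sdisj: "disjoint_family S" using disj S_sub unfolding disjoint_family_on_def by blast
  have Sfin: "emeasure M (S n) < \<infinity>" for n
    using emeasure_mono[OF S_sub qmm_space(3)[OF M x t]] qmm_space(5)[OF M x t] by (rule le_less_trans)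
  have "x n \<in> S n" for n using quasi_metricD(2)[OF qm x x, of n n] x t by (simp add: S_def)
  then have "qball ?X d (x n) (t / C) \<subseteq> S n" for n using small unfolding qball_def by blast
  then have Spos: "0 < emeasure M (S n)" for n
    using qmm_space(4)[OF M x tC] emeasure_mono[OF _ Sm] by (meson less_le_trans)
  have SI: "emeasure M (S n) \<le> ennreal 1 * emeasure M (S n)" for n by simp
  define \<phi> where "\<phi> n y = (indicator (S n) y :: real)" for n y
  have meas: "\<phi> n \<in> borel_measurable M" for n unfolding \<phi>_def[abs_def] using Sm by measurable
  let ?\<beta> = "\<alpha> + 1"
  define L where "L = (C\<^sup>2 / t) powr ?\<beta>"
  have L: "0 \<le> L" by (simp add: L_def)
  have sep: "t / C \<le> d y z" if "y \<in> S n" "z \<in> ?X - S n" for n y z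
    using small[OF that(1), of z] that(2) by force
  have far: "t / C\<^sup>2 \<le> d y z" if yz: "y \<in> ?X" "z \<in> ?X" and ne: "\<phi> n y \<noteq> \<phi> n z" for n y z
  proof -
    consider "y \<in> S n" "z \<in> ?X - S n" | "z \<in> S n" "y \<in> ?X - S n"
      using yz ne unfolding \<phi>_def by (cases "y \<in> S n"; cases "z \<in> S n") auto
    then show ?thesis
    proof cases
      case 1
      have "t / C\<^sup>2 \<le> t / C" using C(1) t by (simp add: field_simps power2_eq_square)
      then show ?thesis using sep[OF 1] by simp
    next
      case 2
      have "t / C \<le> C * d y z" using sep[OF 2] C(2)[OF yz] by simp
      then show ?thesis using C(1) by (simp add: field_simps power2_eq_square)
    qed
  qed
  have hoelder: "\<bar>\<phi> n y - \<phi> n z\<bar> \<le> L * d y z powr ?\<beta>" if "y \<in> ?X" "z \<in> ?X" for n y z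
  proof (cases "\<phi> n y = \<phi> n z")
    case True
    then show ?thesis using L by simp
  next
    case False
    have "1 \<le> C\<^sup>2 / t * d y z" using far[OF that False] C(1) t by (simp add: field_simps)
    then have "1 powr ?\<beta> \<le> (C\<^sup>2 / t * d y z) powr ?\<beta>" using a by (intro powr_mono2) auto
    also have "\<dots> = L * d y z powr ?\<beta>"
      unfolding L_def using t C(1) quasi_metricD(1)[OF qm that] by (intro powr_mult)
    finally show ?thesis using False by (auto simp: \<phi>_def indicator_def)
  qed
  have range: "0 \<le> \<phi> n y \<and> \<phi> n y \<le> 1" if "y \<in> ?X" for n y by (simp add: \<phi>_def)
  have supp: "\<phi> n y = 0" if "y \<in> ?X - S n" for n y using that by (simp add: \<phi>_def)
  have inner: "1 / 2 \<le> \<phi> n y" if "y \<in> S n" for n y using that by (simp add: \<phi>_def)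
  have b: "\<alpha> \<le> ?\<beta>" "?\<beta> = \<alpha> \<Longrightarrow> q = \<infinity>" by simp_all
  show "\<not> HB_compact M d \<alpha> p q"
    by (rule bumps_not_compact(1)[where \<phi> = \<phi>, OF Sm Sdisj Sfin Sm order_refl Spos order_refl SI meas _ _ _ L a b _ p q])
      (fact range supp inner hoelder | assumption)+
  show "\<not> HTL_compact M d \<alpha> p q"
    by (rule bumps_not_compact(2)[where \<phi> = \<phi>, OF Sm Sdisj Sfin Sm order_refl Spos order_refl SI meas _ _ _ L a b _ p q])
      (fact range supp inner hoelder | assumption)+
qed

lemma compact_imp_totally_bounded:
  assumes M: "quasi_metric_measure_space M d"
    and dbl: "\<And>\<delta>. 0 < \<delta> \<Longrightarrow> \<delta> \<le> \<delta>\<^sub>0 \<Longrightarrow> doubling M d (qm_const (space M) d) \<delta>" and "0 < \<delta>\<^sub>0"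
    and a: "0 < \<alpha>" and p: "0 < p" and q: "0 < q" and ind: "le_ind \<alpha> q (space M) d"
    and compact: "HB_compact M d \<alpha> p q \<or> HTL_compact M d \<alpha> p q"
  shows "qm_totally_bounded (space M) d"
proof (rule ccontr)
  assume ntb: "\<not> ?thesis"
  note qm = qmm_space(1)[OF M]
  let ?X = "space M"
  obtain \<epsilon> and x :: "nat \<Rightarrow> 'a" where e: "0 < \<epsilon>" and x: "\<And>n. x n \<in> ?X" and sep: "\<And>m n. m < n \<Longrightarrow> \<epsilon> \<le> d (x m) (x n)"
    using not_totally_bounded_separated[OF ntb] by blast
  obtain t where t: "0 < t" "\<And>x y. x \<in> ?X \<Longrightarrow> y \<in> ?X \<Longrightarrow> \<epsilon> \<le> d x y \<Longrightarrow> qball ?X d x t \<inter> qball ?X d y t = {}"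
    using separated_balls_disjoint[OF qm e] by blast
  have "qball ?X d (x m) t \<inter> qball ?X d (x n) t = {}" if "m < n" for m n
    by (rule t(2)[OF x x sep[OF that]])
  then have disj: "disjoint_family (\<lambda>n. qball ?X d (x n) t)"
    unfolding disjoint_family_on_def by (metis inf_commute nat_neq_iff)
  consider "qm_const ?X d = 1" | "1 < qm_const ?X d" using qm_const_ge_1[OF qm] by linarith
  then show False
  proof cases
    case 1
    show ?thesis using not_compact_of_separated_ultrametric[OF M 1 x t(1) disj a p q] compact by blast
  next
    case 2
    show ?thesis using not_compact_of_separated[OF M 2 dbl \<open>0 < \<delta>\<^sub>0\<close> x t(1) disj a p q ind] compact by blast
  qed
qed

theorem theorem6p11:
  fixes M :: "'a measure" and d :: "'a \<Rightarrow> 'a \<Rightarrow> real"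
  assumes "quasi_metric_measure_space M d"
    and "\<exists>\<delta>\<^sub>0>0. \<forall>\<delta>. 0 < \<delta> \<and> \<delta> \<le> \<delta>\<^sub>0 \<longrightarrow> doubling M d (qm_const (space M) d) \<delta>"
  shows
    "(qm_totally_bounded (space M) d \<longleftrightarrow> integrable_measure M d) \<and>
     (qm_totally_bounded (space M) d \<longleftrightarrow>
        (\<forall>(\<alpha>::real) (p::real) (q::ennreal).
           0 < \<alpha> \<and> 0 < p \<and> 0 < q \<and> le_ind \<alpha> q (space M) d \<longrightarrow> HTL_compact M d \<alpha> p q)) \<and>
     (qm_totally_bounded (space M) d \<longleftrightarrow>
        (\<forall>(\<alpha>::real) (p::real) (q::ennreal).
           0 < \<alpha> \<and> 0 < p \<and> 0 < q \<and> le_ind \<alpha> q (space M) d \<longrightarrow> HB_compact M d \<alpha> p q)) \<and>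
     (qm_totally_bounded (space M) d \<longleftrightarrow>
        (\<exists>(\<alpha>::real) (p::real) (q::ennreal).
           0 < \<alpha> \<and> 0 < p \<and> 0 < q \<and> le_ind \<alpha> q (space M) d \<and> HTL_compact M d \<alpha> p q)) \<and>
     (qm_totally_bounded (space M) d \<longleftrightarrow>
        (\<exists>(\<alpha>::real) (p::real) (q::ennreal).
           0 < \<alpha> \<and> 0 < p \<and> 0 < q \<and> le_ind \<alpha> q (space M) d \<and> HB_compact M d \<alpha> p q))"
proof (intro conjI)
  note qm = qmm_space(1)[OF assms(1)]
  obtain \<delta>\<^sub>0 where \<delta>\<^sub>0: "0 < \<delta>\<^sub>0" "\<And>\<delta>. 0 < \<delta> \<Longrightarrow> \<delta> \<le> \<delta>\<^sub>0 \<Longrightarrow> doubling M d (qm_const (space M) d) \<delta>"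
    using assms(2) by blast
  obtain \<alpha>\<^sub>0 where \<alpha>\<^sub>0: "0 < \<alpha>\<^sub>0" "\<And>q. le_ind \<alpha>\<^sub>0 q (space M) d" using le_ind_exists[OF qm] by blast
  have exponents: "0 < \<alpha>\<^sub>0 \<and> (0::real) < 1 \<and> (0::ennreal) < 1 \<and> le_ind \<alpha>\<^sub>0 1 (space M) d" using \<alpha>\<^sub>0 by simp
  note to_compact = totally_bounded_imp_compact[OF assms(1)]
  note from_compact = compact_imp_totally_bounded[OF assms(1) \<delta>\<^sub>0(2,1)]
  show "qm_totally_bounded (space M) d \<longleftrightarrow> integrable_measure M d"
    using totally_bounded_imp_integrable[OF assms(1)]
      integrable_imp_totally_bounded[OF assms(1) \<delta>\<^sub>0(2,1)] by blast
  show "qm_totally_bounded (space M) d \<longleftrightarrow>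
      (\<forall>(\<alpha>::real) (p::real) (q::ennreal).
         0 < \<alpha> \<and> 0 < p \<and> 0 < q \<and> le_ind \<alpha> q (space M) d \<longrightarrow> HTL_compact M d \<alpha> p q)"
  proof (intro iffI allI impI)
    fix \<alpha> p :: real and q :: ennreal
    assume "qm_totally_bounded (space M) d" "0 < \<alpha> \<and> 0 < p \<and> 0 < q \<and> le_ind \<alpha> q (space M) d"
    then show "HTL_compact M d \<alpha> p q" using to_compact by blast
  next
    assume "\<forall>(\<alpha>::real) (p::real) (q::ennreal).
         0 < \<alpha> \<and> 0 < p \<and> 0 < q \<and> le_ind \<alpha> q (space M) d \<longrightarrow> HTL_compact M d \<alpha> p q"
    then have "HTL_compact M d \<alpha>\<^sub>0 1 1" using exponents by blast
    then show "qm_totally_bounded (space M) d" using from_compact exponents by blast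
  qed
  show "qm_totally_bounded (space M) d \<longleftrightarrow>
      (\<forall>(\<alpha>::real) (p::real) (q::ennreal).
         0 < \<alpha> \<and> 0 < p \<and> 0 < q \<and> le_ind \<alpha> q (space M) d \<longrightarrow> HB_compact M d \<alpha> p q)"
  proof (intro iffI allI impI)
    fix \<alpha> p :: real and q :: ennreal
    assume "qm_totally_bounded (space M) d" "0 < \<alpha> \<and> 0 < p \<and> 0 < q \<and> le_ind \<alpha> q (space M) d"
    then show "HB_compact M d \<alpha> p q" using to_compact by blast
  next
    assume "\<forall>(\<alpha>::real) (p::real) (q::ennreal).
         0 < \<alpha> \<and> 0 < p \<and> 0 < q \<and> le_ind \<alpha> q (space M) d \<longrightarrow> HB_compact M d \<alpha> p q"
    then have "HB_compact M d \<alpha>\<^sub>0 1 1" using exponents by blast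
    then show "qm_totally_bounded (space M) d" using from_compact exponents by blast
  qed
  show "qm_totally_bounded (space M) d \<longleftrightarrow>
      (\<exists>(\<alpha>::real) (p::real) (q::ennreal).
         0 < \<alpha> \<and> 0 < p \<and> 0 < q \<and> le_ind \<alpha> q (space M) d \<and> HTL_compact M d \<alpha> p q)"
  proof
    assume "qm_totally_bounded (space M) d"
    then have "HTL_compact M d \<alpha>\<^sub>0 1 1" using to_compact exponents by blast
    then show "\<exists>(\<alpha>::real) (p::real) (q::ennreal).
         0 < \<alpha> \<and> 0 < p \<and> 0 < q \<and> le_ind \<alpha> q (space M) d \<and> HTL_compact M d \<alpha> p q"
      using exponents by blast
  next
    assume "\<exists>(\<alpha>::real) (p::real) (q::ennreal).
         0 < \<alpha> \<and> 0 < p \<and> 0 < q \<and> le_ind \<alpha> q (space M) d \<and> HTL_compact M d \<alpha> p q"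
    then show "qm_totally_bounded (space M) d" using from_compact by blast
  qed
  show "qm_totally_bounded (space M) d \<longleftrightarrow>
      (\<exists>(\<alpha>::real) (p::real) (q::ennreal).
         0 < \<alpha> \<and> 0 < p \<and> 0 < q \<and> le_ind \<alpha> q (space M) d \<and> HB_compact M d \<alpha> p q)"
  proof
    assume "qm_totally_bounded (space M) d"
    then have "HB_compact M d \<alpha>\<^sub>0 1 1" using to_compact exponents by blast
    then show "\<exists>(\<alpha>::real) (p::real) (q::ennreal).
         0 < \<alpha> \<and> 0 < p \<and> 0 < q \<and> le_ind \<alpha> q (space M) d \<and> HB_compact M d \<alpha> p q"
      using exponents by blast
  next
    assume "\<exists>(\<alpha>::real) (p::real) (q::ennreal).
         0 < \<alpha> \<and> 0 < p \<and> 0 < q \<and> le_ind \<alpha> q (space M) d \<and> HB_compact M d \<alpha> p q"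
    then show "qm_totally_bounded (space M) d" using from_compact by blast
  qed
qed

end
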